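(* $\partial^{-1}(\mathscr{H}^2 \odot \partial \mathscr{H}^2) \subsetneq \mathscr{H}^1$, i.e. the space $\partial^{-1}(\mathscr{H}^2 \odot \partial \mathscr{H}^2)$ is contained in, and not equal to, $\mathscr{H}^1$.
   Context: $\mathscr{H}^2$ is the Hilbert space of Dirichlet series $f(s)=\sum_{n\ge1}a_nn^{-s}$ with $\|f\|_{\mathscr{H}^2}=(\sum_{n\ge1}|a_n|^2)^{1/2}<\infty$; $f(+\infty)=a_1$; $f'$ denotes the derivative $f'(s)=-\sum_{n\ge2}a_n(\log n)n^{-s}$. The skew product space $\partial^{-1}(\mathscr{H}^2 \odot \partial \mathscr{H}^2)$ is the Banach space completion of the space of Dirichlet series $F$ whose derivatives have a finite sum representation $F'=\sum_kf_kg_k'$ with $f_k,g_k\in\mathscr{H}^2$, under the norm $\|F\|=|F(+\infty)|+\inf\sum_k\|f_k\|_{\mathscr{H}^2}\|g_k\|_{\mathscr{H}^2}$, where the infimum is over all finite representations; it is regarded as a space of Dirichlet series. For $n=\prod_jp_j^{\kappa_j}$ ($p_j$ the $j$th prime) put $\kappa(n)=(\kappa_1,\kappa_2,\dots)$; the Bohr lift of $f$ is $\mathscr{B}f(z)=\sum_na_nz^{\kappa(n)}$, $z\in\mathbb{T}^\infty$. $\mathscr{H}^1$ is the space of Dirichlet series $f$ with $\mathscr{B}f\in H^1(\mathbb{T}^\infty)$ (the closure of analytic polynomials in $L^1(\mathbb{T}^\infty,m_\infty)$, $m_\infty$ the normalized Haar measure), with norm $\|f\|_{\mathscr{H}^1}=\int_{\mathbb{T}^\infty}|\mathscr{B}f|\,dm_\infty$.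 *)

theory Defs
  imports "HOL-Probability.Probability" "HOL-Computational_Algebra.Primes"
begin

section \<open>Dirichlet series\<close>

text \<open>
  A Dirichlet series is represented by its coefficient sequence. The index \<open>0\<close> carries no
  information, so every space below consists of sequences \<open>a\<close> with \<open>a 0 = 0\<close>.
  The value at \<open>+\<infinity>\<close> is \<open>a 1\<close>. All series involved converge absolutely for real part
  greater than \<open>1/2\<close>, so that identities between them are identities between coefficients.
\<close>

type_synonym dirichlet = "nat \<Rightarrow> complex"

text \<open>
  Product of Dirichlet series. At \<open>n = 0\<close> the index set is infinite, so the value is \<open>0\<close>.
\<close>

definition dir_mult :: "dirichlet \<Rightarrow> dirichlet \<Rightarrow> dirichlet" where
  "dir_mult a b n = (\<Sum>d | d dvd n. a d * b (n div d))"

definition dir_deriv :: "dirichlet \<Rightarrow> dirichlet" where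
  "dir_deriv a n = - (a n * of_real (ln (real n)))"

definition H2 :: "dirichlet set" where
  "H2 = {a. a 0 = 0 \<and> summable (\<lambda>n. (norm (a n))\<^sup>2)}"

definition H2_norm :: "dirichlet \<Rightarrow> real" where
  "H2_norm a = sqrt (\<Sum>n. (norm (a n))\<^sup>2)"

section \<open>The skew product space\<close>

definition skew_rep :: "dirichlet \<Rightarrow> nat \<Rightarrow> (nat \<Rightarrow> dirichlet) \<Rightarrow> (nat \<Rightarrow> dirichlet) \<Rightarrow> bool" where
  "skew_rep F N f g \<longleftrightarrow>
     (\<forall>k<N. f k \<in> H2 \<and> g k \<in> H2) \<and>
     dir_deriv F = (\<lambda>n. \<Sum>k<N. dir_mult (f k) (dir_deriv (g k)) n)"

definition skew_finite :: "dirichlet set" where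
  "skew_finite = {F. F 0 = 0 \<and> (\<exists>N f g. skew_rep F N f g)}"

definition skew_norm :: "dirichlet \<Rightarrow> real" where
  "skew_norm F = norm (F 1) +
     Inf {\<Sum>k<N. H2_norm (f k) * H2_norm (g k) | N f g. skew_rep F N f g}"

text \<open>
  The completion of \<open>skew_finite\<close> under \<open>skew_norm\<close>, as a space of Dirichlet series: each
  coefficient functional satisfies \<open>norm (F n) \<le> skew_norm F\<close> and hence extends to the
  completion, and an element of the completion, i.e. a class of Cauchy sequences, is identified
  with the Dirichlet series of its coefficients, i.e. with its coefficientwise limit.
\<close>

definition skew_product_space :: "dirichlet set" where
  "skew_product_space = {F. \<exists>G :: nat \<Rightarrow> dirichlet.
     (\<forall>m. G m \<in> skew_finite) \<and>
     (\<forall>e>0. \<exists>M. \<forall>i\<ge>M. \<forall>j\<ge>M. skew_norm (\<lambda>n. G i n - G j n) < e) \<and>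
     (\<forall>n. (\<lambda>m. G m n) \<longlonglongrightarrow> F n)}"

section \<open>The space \<open>H\<^sup>1\<close> of the infinite torus and of Dirichlet series\<close>

definition circle_measure :: "complex measure" where
  "circle_measure =
     distr (uniform_measure lborel {0..<2 * pi}) (restrict_space borel (sphere 0 1)) cis"

text \<open>
  The normalized Haar measure of the infinite torus is the product of the normalized Haar
  measures of its factors.
\<close>

definition torus_measure :: "(nat \<Rightarrow> complex) measure" where
  "torus_measure = (\<Pi>\<^sub>M j\<in>UNIV. circle_measure)"

definition monomial :: "(nat \<Rightarrow> nat) \<Rightarrow> (nat \<Rightarrow> complex) \<Rightarrow> complex" where
  "monomial \<alpha> z = (\<Prod>j | \<alpha> j \<noteq> 0. z j ^ \<alpha> j)"

definition analytic_polynomials :: "((nat \<Rightarrow> complex) \<Rightarrow> complex) set" where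
  "analytic_polynomials = {P. \<exists>A c. finite A \<and> (\<forall>\<alpha>\<in>A. finite {j. \<alpha> j \<noteq> 0}) \<and>
     P = (\<lambda>z. \<Sum>\<alpha>\<in>A. c \<alpha> * monomial \<alpha> z)}"

definition H1_torus :: "((nat \<Rightarrow> complex) \<Rightarrow> complex) set" where
  "H1_torus = {\<phi>. integrable torus_measure \<phi> \<and>
     (\<forall>e>0. \<exists>P\<in>analytic_polynomials. (LINT z|torus_measure. norm (\<phi> z - P z)) < e)}"

text \<open>The exponents are indexed from \<open>0\<close>: \<open>enumerate {p. prime p} 0 = 2\<close>.\<close>

definition kappa :: "nat \<Rightarrow> nat \<Rightarrow> nat" where
  "kappa n j = multiplicity (enumerate {p::nat. prime p} j) n"

text \<open>
  The Bohr lift is a Fourier series: it represents the function \<open>\<phi>\<close> on the torus if the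
  Fourier coefficient of \<open>\<phi>\<close> at the frequency \<open>kappa n\<close> is the \<open>n\<close>-th coefficient of the
  Dirichlet series. For \<open>\<phi>\<close> in \<open>H1_torus\<close> all other Fourier coefficients vanish.
\<close>

definition bohr_lift :: "dirichlet \<Rightarrow> ((nat \<Rightarrow> complex) \<Rightarrow> complex) \<Rightarrow> bool" where
  "bohr_lift a \<phi> \<longleftrightarrow>
     (\<forall>n\<ge>1. a n = (LINT z|torus_measure. \<phi> z * cnj (monomial (kappa n) z)))"

definition H1 :: "dirichlet set" where
  "H1 = {a. a 0 = 0 \<and> (\<exists>\<phi>\<in>H1_torus. bohr_lift a \<phi>)}"

end

theory Submission
  imports Defs "HOL-Complex_Analysis.Complex_Analysis"
begin

text \<open>
  Inclusion. By duality with bounded functions \<open>\<phi>\<close> on the torus it suffices to bound the pairing of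
  \<open>F\<close> and \<open>\<phi>\<close> for \<open>F' = f g'\<close>. Extend \<open>f\<close>, \<open>g\<close>, \<open>F\<close> analytically and \<open>\<phi>\<close> harmonically along the
  vertical flow \<open>n\<^sup>-\<^sup>s\<close>, to the half-plane of \<open>s = u + i t\<close>. With \<open>\<bar>\<phi>\<bar> \<le> 1\<close> and a unimodular \<open>\<omega>\<close>, the
  function \<open>\<bar>g\<bar>\<^sup>2 / 2 + \<bar>f\<bar>\<^sup>2 (3 + \<bar>\<phi>\<bar>\<^sup>2) - Re (\<omega> F \<phi>\<^sup>*)\<close> is subharmonic, so its mean over the torus
  is a bounded convex function of \<open>u\<close>, hence decreasing; comparing \<open>u = 0\<close> with \<open>u = \<infinity>\<close> gives the
  bound. A polynomial in \<open>\<bar>F\<bar>\<^sup>2\<close> times \<open>F\<close> serves as \<open>\<phi>\<close>.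

  Strictness. Let \<open>P\<close> be a product of \<open>N\<close> sums of two distinct coordinates. Pairing with \<open>P\<close> is bounded
  on the skew product space by \<open>2\<close> to the power \<open>N/2\<close>, because the weights \<open>log e / log (d e)\<close> are
  at most \<open>1\<close> and the Hankel form of \<open>P\<close> has nonnegative entries. On the other hand \<open>P\<close> pairs with
  itself to \<open>2\<^sup>N\<close> while its \<open>L\<^sup>1\<close> norm is smaller than \<open>2\<close> to the power \<open>N/2\<close> by an exponential
  factor. A weighted sum of such \<open>P\<close> is in \<open>H\<^sup>1\<close> but not in the skew product space.
\<close>

section \<open>Characters of the torus\<close>

text \<open>The obstacle in the inclusion is that \<open>\<phi>\<close> is only bounded: pairing F
  with it brings in the gradient of its extension, which is not bounded. It is enough to control
  |f|^2 |grad \<phi>|^2, a Carleson-type estimate, and the Laplacian of |f|^2 |\<phi>|^2 contains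
  exactly this term. The summand 3 |f|^2 absorbs the cross terms of that Laplacian, and |g|^2 / 2
  together with half of |f|^2 |grad \<phi>|^2 absorbs f g' grad \<phi>. At u = infinity F
  contributes nothing, having no constant term, and the other two summands are nonnegative.

  All of this is done for finite sums of waves, where means can be differentiated term by term.
  Infinite series enter afterwards, as absolutely convergent series of blocks.

  For strictness, one pair already shows a gap: the Hankel form of z_1 + z_2 has norm sqrt 2, while
  the mean of |z_1 + z_2| is at most sqrt 2 * 23/24. Both quantities multiply over disjoint pairs of
  coordinates, so N pairs turn the fixed gap into an exponential one.\<close>

lemma prob_space_circle_measure: "prob_space circle_measure"
proof -
  have cis: "cis \<in> borel_measurable borel"
    by (intro borel_measurable_continuous_onI continuous_intros)
  have "cis \<in> measurable (uniform_measure lborel {0..<2 * pi}) (restrict_space borel (sphere 0 1))"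
    using cis by (intro measurable_restrict_space2) (auto simp: measurable_cong_sets[OF sets_uniform_measure refl])
  moreover have "prob_space (uniform_measure lborel {0..<2 * pi})"
    by (rule prob_space_uniform_measure) auto
  ultimately show ?thesis
    unfolding circle_measure_def by (rule prob_space.prob_space_distr[rotated])
qed

lemma space_circle_measure [simp]: "space circle_measure = sphere 0 1"
  by (simp add: circle_measure_def space_restrict_space)

lemma sets_circle_measure: "sets circle_measure = sets (restrict_space borel (sphere 0 1))"
  by (simp add: circle_measure_def)

lemma borel_measurable_circle_measure:
  "f \<in> borel_measurable borel \<Longrightarrow> f \<in> borel_measurable circle_measure"
  by (subst measurable_cong_sets[OF sets_circle_measure refl]) (rule measurable_restrict_space1)

lemma integral_circle_measure:
  fixes f :: "complex \<Rightarrow> complex"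
  assumes "f \<in> borel_measurable borel"
  shows "(LINT w|circle_measure. f w) =
    (LINT t|lborel. indicator {0..<2 * pi} t *\<^sub>R f (cis t)) / (2 * pi)"
proof -
  have cis: "cis \<in> borel_measurable borel"
    by (intro borel_measurable_continuous_onI continuous_intros)
  have cis': "cis \<in> measurable (uniform_measure lborel {0..<2 * pi}) (restrict_space borel (sphere 0 1))"
    using cis by (intro measurable_restrict_space2) (auto simp: measurable_cong_sets[OF sets_uniform_measure refl])
  have "(LINT w|circle_measure. f w) = (LINT t|uniform_measure lborel {0..<2 * pi}. f (cis t))"
    unfolding circle_measure_def
    by (rule integral_distr[OF cis']) (use assms in \<open>auto intro: measurable_restrict_space1\<close>)
  also have "uniform_measure lborel {0..<2 * pi} =
      density lborel (\<lambda>t. ennreal (indicator {0..<2 * pi} t / (2 * pi)))"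
    unfolding uniform_measure_def
    by (intro density_cong) (auto simp: divide_ennreal[symmetric] ennreal_indicator split: split_indicator)
  also have "(LINT t|density lborel (\<lambda>t. ennreal (indicator {0..<2 * pi} t / (2 * pi))). f (cis t)) =
      (LINT t|lborel. (indicator {0..<2 * pi} t / (2 * pi)) *\<^sub>R f (cis t))"
    by (rule integral_density) (use assms cis in \<open>auto simp: indicator_def\<close>)
  also have "\<dots> = (LINT t|lborel. indicator {0..<2 * pi} t *\<^sub>R f (cis t) / (2 * pi))"
    by (intro Bochner_Integration.integral_cong) (auto simp: scaleR_conv_of_real)
  also have "\<dots> = (LINT t|lborel. indicator {0..<2 * pi} t *\<^sub>R f (cis t)) / (2 * pi)"
    by simp
  finally show ?thesis .
qed

lemma integral_circle_measure_monomial: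
  "(LINT w|circle_measure. w ^ k * cnj (w ^ l)) = (if k = l then 1 else 0)"
proof -
  define j where "j = real k - real l"
  have eq: "cis t ^ k * cnj (cis t ^ l) = cis (j * t)" for t
    unfolding Complex.DeMoivre cis_cnj cis_mult j_def by (rule arg_cong[where f = cis]) (simp add: algebra_simps)
  have "(LINT w|circle_measure. w ^ k * cnj (w ^ l)) =
      (LINT t|lborel. indicator {0..<2 * pi} t *\<^sub>R cis (j * t)) / (2 * pi)"
    by (subst integral_circle_measure)
       (auto simp only: eq intro!: borel_measurable_continuous_onI continuous_intros)
  also have "(LINT t|lborel. indicator {0..<2 * pi} t *\<^sub>R cis (j * t)) =
      (LINT t|lborel. indicator {0..2 * pi} t *\<^sub>R cis (j * t))"
  proof (rule integral_cong_AE)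
    show "AE t in lborel. indicator {0..<2 * pi} t *\<^sub>R cis (j * t) = indicator {0..2 * pi} t *\<^sub>R cis (j * t)"
      using AE_lborel_singleton[of "2 * pi"] by eventually_elim (auto simp: indicator_def)
    have [measurable]: "(\<lambda>t. cis (j * t)) \<in> borel_measurable borel"
      by (intro borel_measurable_continuous_onI continuous_intros)
    show "(\<lambda>t. indicator {0..<2 * pi} t *\<^sub>R cis (j * t)) \<in> borel_measurable lborel"
      "(\<lambda>t. indicator {0..2 * pi} t *\<^sub>R cis (j * t)) \<in> borel_measurable lborel"
      by measurable
  qed
  also have "\<dots> = (if k = l then 2 * pi else 0)"
  proof (cases "k = l")
    case True
    have "(LINT t|lborel. indicator {0..2 * pi} t *\<^sub>R cis (j * t)) = of_real (2 * pi) - of_real 0"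
      by (rule integral_FTC_atLeastAtMost)
         (auto simp: True j_def intro!: derivative_eq_intros)
    then show ?thesis
      using True by simp
  next
    case False
    then have j0: "j \<noteq> 0"
      by (simp add: j_def)
    have jint: "cis (j * (2 * pi)) = 1"
    proof -
      have "j * (2 * pi) = real_of_int (int k - int l) * (2 * pi)"
        by (simp add: j_def)
      then show ?thesis
        using cis_multiple_2pi[of "real_of_int (int k - int l)"] by (metis Ints_of_int mult.commute mult.left_commute)
    qed
    have "(LINT t|lborel. indicator {0..2 * pi} t *\<^sub>R cis (j * t)) =
        cis (j * (2 * pi)) / (\<i> * j) - cis (j * 0) / (\<i> * j)"
    proof (rule integral_FTC_atLeastAtMost)
      fix t
      have "((\<lambda>t. exp (of_real t * (\<i> * j)) / (\<i> * j)) has_vector_derivative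
          exp (of_real t * (\<i> * j))) (at t within {0..2 * pi})"
        using j0 by (intro has_vector_derivative_real_field) (auto intro!: derivative_eq_intros)
      moreover have "exp (of_real t * (\<i> * j)) = cis (j * t)" for t
        by (simp add: cis_conv_exp mult_ac)
      ultimately show "((\<lambda>t. cis (j * t) / (\<i> * j)) has_vector_derivative cis (j * t)) (at t within {0..2 * pi})"
        by simp
    qed (auto intro!: continuous_intros)
    then show ?thesis
      using False jint by simp
  qed
  finally show ?thesis
    by simp
qed

interpretation torus: product_prob_space "\<lambda>_::nat. circle_measure" UNIV
proof -
  interpret prob_space circle_measure
    by (rule prob_space_circle_measure)
  show "product_prob_space (\<lambda>_::nat. circle_measure)"
    by unfold_locales
qed

lemma prob_space_torus_measure: "prob_space torus_measure"
  unfolding torus_measure_def by (intro prob_space_PiM prob_space_circle_measure)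

interpretation torus_measure: prob_space torus_measure
  by (rule prob_space_torus_measure)

lemma norm_torus_coordinate: "z \<in> space torus_measure \<Longrightarrow> norm (z j) = 1"
  by (auto simp: torus_measure_def space_PiM PiE_def)

lemma measurable_torus_coordinate [measurable]: "(\<lambda>z. z j) \<in> borel_measurable torus_measure"
proof -
  have "(\<lambda>w::complex. w) \<in> borel_measurable circle_measure"
    by (rule borel_measurable_circle_measure) simp
  then show ?thesis
    unfolding torus_measure_def by (rule measurable_PiM_component_rev[OF UNIV_I])
qed

text \<open>Only the coordinates below \<open>K\<close> occur, so the integral descends to the
  finite product measure, where Fubini applies. The bound by 1 makes each factor integrable.\<close>

lemma integral_torus_prod:
  fixes h :: "nat \<Rightarrow> complex \<Rightarrow> complex"
  assumes "\<And>j. h j \<in> borel_measurable borel" and bdd: "\<And>j w. norm w = 1 \<Longrightarrow> norm (h j w) \<le> 1"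
  shows "(LINT z|torus_measure. (\<Prod>j<K. h j (z j))) = (\<Prod>j<K. LINT w|circle_measure. h j w)"
proof -
  let ?J = "{..<K}"
  have m: "h j \<in> borel_measurable circle_measure" for j
    by (rule borel_measurable_circle_measure) fact
  have "(LINT z|torus_measure. (\<Prod>j<K. h j (z j))) =
      (LINT z|torus_measure. (\<Prod>j<K. h j (restrict z ?J j)))"
    by (intro Bochner_Integration.integral_cong refl prod.cong) auto
  also have "\<dots> = (LINT y|distr torus_measure (PiM ?J (\<lambda>_. circle_measure)) (\<lambda>z. restrict z ?J).
      (\<Prod>j<K. h j (y j)))"
    unfolding torus_measure_def
    by (rule integral_distr[symmetric])
       (auto intro!: borel_measurable_prod measurable_PiM_component_rev m measurable_restrict_subset simp del: restrict_apply)
  also have "distr torus_measure (PiM ?J (\<lambda>_. circle_measure)) (\<lambda>z. restrict z ?J) = PiM ?J (\<lambda>_. circle_measure)"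
    unfolding torus_measure_def by (rule torus.distr_PiM_restrict_finite) auto
  also have "(LINT y|PiM ?J (\<lambda>_. circle_measure). (\<Prod>j<K. h j (y j))) = (\<Prod>j<K. LINT w|circle_measure. h j w)"
  proof (rule torus.product_integral_prod)
    fix j
    show "integrable circle_measure (h j)"
      by (rule torus.M.integrable_const_bound[of _ 1]) (auto intro!: m bdd)
  qed auto
  finally show ?thesis .
qed

section \<open>Primes, exponents and the characters they define on the torus\<close>

abbreviation nth_prime :: "nat \<Rightarrow> nat" where
  "nth_prime \<equiv> enumerate {p. prime p}"

lemma prime_nth_prime [simp]: "prime (nth_prime j)"
  using enumerate_in_set[OF primes_infinite, of j] by simp

lemma nth_prime_inject [simp]: "nth_prime i = nth_prime j \<longleftrightarrow> i = j"
  using primes_infinite by (metis enumerate_mono_iff nat_neq_iff)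

lemma prime_eq_nth_prime: "prime p \<Longrightarrow> \<exists>j. p = nth_prime j"
  using enumerate_Ex[of "{p. prime p}" p] primes_infinite by (metis mem_Collect_eq)

text \<open>The prime of index j exceeds j, so a prime of index at least n is too large to divide n.
  Hence finitely many characters can always be written over one common range of coordinates.\<close>

lemma kappa_eq_0:
  assumes "n \<le> j"
  shows "kappa n j = 0"
proof -
  have "j \<le> nth_prime j" "nth_prime j \<noteq> j"
  proof -
    show *: "j \<le> nth_prime j" for j
      by (rule le_enumerate[OF primes_infinite])
    show "nth_prime j \<noteq> j"
    proof (induction j)
      case 0
      show ?case
        using prime_nth_prime[of 0] by (metis not_prime_0)
    next
      case (Suc j)
      with *[of j] have "j < nth_prime j"
        by simp
      moreover have "nth_prime j < nth_prime (Suc j)"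
        using primes_infinite by (simp add: enumerate_step)
      ultimately show ?case
        by simp
    qed
  qed
  with assms have "\<not> nth_prime j dvd n" if "n > 0"
    using that by (auto dest: dvd_imp_le)
  then show ?thesis
    unfolding kappa_def by (cases "n = 0") (auto intro: not_dvd_imp_multiplicity_0)
qed

lemma kappa_mult: "m > 0 \<Longrightarrow> n > 0 \<Longrightarrow> kappa (m * n) j = kappa m j + kappa n j"
  unfolding kappa_def by (rule prime_elem_multiplicity_mult_distrib) auto

lemma kappa_inject:
  assumes "m > 0" "n > 0" "\<And>j. kappa m j = kappa n j"
  shows "m = n"
  using assms(1,2)
proof (rule multiplicity_eq_nat)
  fix p :: nat
  assume "prime p"
  then show "multiplicity p m = multiplicity p n"
    using prime_eq_nth_prime[of p] assms(3) by (auto simp: kappa_def)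
qed

lemma monomial_eq_prod: "(\<And>j. K \<le> j \<Longrightarrow> \<alpha> j = 0) \<Longrightarrow> monomial \<alpha> z = (\<Prod>j<K. z j ^ \<alpha> j)"
  unfolding monomial_def by (rule prod.mono_neutral_left) (auto simp: not_less[symmetric] intro: ccontr)

text \<open>A torus point read as a completely multiplicative function of n, so that multiplying
  monomials becomes multiplying integers. At 0 all exponents are 0 and the value is 1.\<close>

definition character :: "(nat \<Rightarrow> complex) \<Rightarrow> nat \<Rightarrow> complex" where
  "character z n = monomial (kappa n) z"

lemma character_eq_prod: "n \<le> K \<Longrightarrow> character z n = (\<Prod>j<K. z j ^ kappa n j)"
  unfolding character_def by (rule monomial_eq_prod) (auto intro: kappa_eq_0)

lemma character_mult: "m > 0 \<Longrightarrow> n > 0 \<Longrightarrow> character z (m * n) = character z m * character z n"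
  by (simp add: character_eq_prod[of _ "m * n"] prod.distrib[symmetric] kappa_mult power_add)

lemma norm_character: "z \<in> space torus_measure \<Longrightarrow> norm (character z n) = 1"
  by (simp add: character_def monomial_def prod_norm[symmetric] norm_power norm_torus_coordinate)

lemma measurable_character [measurable]: "(\<lambda>z. character z n) \<in> borel_measurable torus_measure"
  unfolding character_def monomial_def by measurable

lemma integral_character:
  assumes "m > 0" "n > 0"
  shows "(LINT z|torus_measure. character z m * cnj (character z n)) = (if m = n then 1 else 0)"
proof -
  define K where "K = max m n"
  have "(LINT z|torus_measure. character z m * cnj (character z n)) =
      (LINT z|torus_measure. (\<Prod>j<K. z j ^ kappa m j * cnj (z j ^ kappa n j)))"
    by (simp add: character_eq_prod[of _ K] K_def prod.distrib)
  also have "\<dots> = (\<Prod>j<K. LINT w|circle_measure. w ^ kappa m j * cnj (w ^ kappa n j))"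
    by (rule integral_torus_prod)
       (auto intro!: borel_measurable_continuous_onI continuous_intros simp: norm_mult norm_power)
  also have "\<dots> = (\<Prod>j<K. if kappa m j = kappa n j then 1 else 0)"
    by (simp only: integral_circle_measure_monomial)
  also have "\<dots> = (if m = n then 1 else 0)"
  proof (cases "m = n")
    case False
    then obtain j where j: "kappa m j \<noteq> kappa n j"
      using kappa_inject[OF assms] by blast
    have "j < K"
      using j kappa_eq_0[of m j] kappa_eq_0[of n j] by (force simp: K_def)
    with j False show ?thesis
      by (auto intro!: prod_zero)
  qed simp
  finally show ?thesis .
qed

section \<open>Exponential polynomials along the vertical flow\<close>

text \<open>Multiplicative functions are used in place of torus points because the flow acts on them
  by the plain factor n^(-it), with no coordinates to recompute. The value at 0 is left
  free.\<close>

definition characters :: "(nat \<Rightarrow> complex) set" where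
  "characters = {x. (\<forall>m>0. \<forall>n>0. x (m * n) = x m * x n) \<and> (\<forall>n>0. norm (x n) = 1)}"

lemma characters_mult: "x \<in> characters \<Longrightarrow> m > 0 \<Longrightarrow> n > 0 \<Longrightarrow> x (m * n) = x m * x n"
  by (simp add: characters_def)

lemma norm_characters: "x \<in> characters \<Longrightarrow> n > 0 \<Longrightarrow> norm (x n) = 1"
  by (simp add: characters_def)

lemma characters_one: "x \<in> characters \<Longrightarrow> x 1 = 1"
proof -
  assume x: "x \<in> characters"
  then have "x 1 = x 1 * x 1" "x 1 \<noteq> 0"
    using characters_mult[OF x, of 1 1] norm_characters[OF x, of 1] by auto
  then show ?thesis
    by simp
qed

lemma character_in_characters: "z \<in> space torus_measure \<Longrightarrow> character z \<in> characters"
  by (auto simp: characters_def character_mult norm_character)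

lemma measurable_cnj_character [measurable]:
  "(\<lambda>z. cnj (character z n)) \<in> borel_measurable torus_measure"
  by (rule borel_measurable_continuous_on[OF continuous_on_cnj[OF continuous_on_id] measurable_character])

type_synonym field = "real \<Rightarrow> (nat \<Rightarrow> complex) \<Rightarrow> complex"

text \<open>A wave of frequency k/l. Its value depends on \<open>\<alpha>\<close> and
  \<open>\<beta>\<close> only through their sum, but each Wirtinger derivative multiplies by one of
  them, so both are recorded.\<close>

definition wave :: "real \<Rightarrow> real \<Rightarrow> nat \<Rightarrow> nat \<Rightarrow> field" where
  "wave \<alpha> \<beta> k l u x = of_real (exp (- (\<alpha> + \<beta>) * u)) * x k * cnj (x l)"

lemma wave_mult:
  "x \<in> characters \<Longrightarrow> k > 0 \<Longrightarrow> l > 0 \<Longrightarrow> k' > 0 \<Longrightarrow> l' > 0 \<Longrightarrow>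
    wave (\<alpha> + \<alpha>') (\<beta> + \<beta>') (k * k') (l * l') u x = wave \<alpha> \<beta> k l u x * wave \<alpha>' \<beta>' k' l' u x"
  by (simp add: wave_def characters_mult distrib_right exp_add[symmetric] of_real_mult[symmetric]
      exp_diff exp_minus field_simps del: of_real_mult)

lemma cnj_wave: "cnj (wave \<alpha> \<beta> k l u x) = wave \<beta> \<alpha> l k u x"
  by (simp add: wave_def ac_simps)

lemma norm_wave:
  "x \<in> characters \<Longrightarrow> k > 0 \<Longrightarrow> l > 0 \<Longrightarrow> norm (wave \<alpha> \<beta> k l u x) = exp (- (\<alpha> + \<beta>) * u)"
  by (simp add: wave_def norm_mult norm_characters)

text \<open>
  \<open>jet h p q r\<close>: the function \<open>h\<close> is a combination of waves, with \<open>p\<close>, \<open>q\<close> and \<open>r\<close> the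
  functions \<open>\<partial>h\<close>, \<open>\<partial>\<^sup>*h\<close> and \<open>\<partial>\<partial>\<^sup>*h\<close> for the Wirtinger derivatives in the variable
  \<open>u + i t\<close>, where \<open>t\<close> is the time of the flow \<open>x n \<mapsto> x n n\<^sup>-\<^sup>i\<^sup>t\<close>. The condition on
  \<open>\<alpha> - \<beta>\<close> says that \<open>wave \<alpha> \<beta> k l\<close> is \<open>exp (- \<alpha> s - \<beta> s\<^sup>*)\<close> along this flow.
\<close>

inductive jet :: "field \<Rightarrow> field \<Rightarrow> field \<Rightarrow> field \<Rightarrow> bool" where
  wave: "\<alpha> \<ge> 0 \<Longrightarrow> \<beta> \<ge> 0 \<Longrightarrow> k > 0 \<Longrightarrow> l > 0 \<Longrightarrow> \<alpha> - \<beta> = ln (real k) - ln (real l) \<Longrightarrow>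
    jet (\<lambda>u x. c * wave \<alpha> \<beta> k l u x) (\<lambda>u x. - of_real \<alpha> * c * wave \<alpha> \<beta> k l u x)
      (\<lambda>u x. - of_real \<beta> * c * wave \<alpha> \<beta> k l u x) (\<lambda>u x. of_real \<alpha> * of_real \<beta> * c * wave \<alpha> \<beta> k l u x)"
| add: "jet h p q r \<Longrightarrow> jet h' p' q' r' \<Longrightarrow>
    jet (\<lambda>u x. h u x + h' u x) (\<lambda>u x. p u x + p' u x) (\<lambda>u x. q u x + q' u x) (\<lambda>u x. r u x + r' u x)"
| cong: "jet h p q r \<Longrightarrow> (\<And>u x. x \<in> characters \<Longrightarrow> h' u x = h u x) \<Longrightarrow>
    (\<And>u x. x \<in> characters \<Longrightarrow> p' u x = p u x) \<Longrightarrow> (\<And>u x. x \<in> characters \<Longrightarrow> q' u x = q u x) \<Longrightarrow>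
    (\<And>u x. x \<in> characters \<Longrightarrow> r' u x = r u x) \<Longrightarrow> jet h' p' q' r'"

lemma jet_const: "jet (\<lambda>u x. c) (\<lambda>u x. 0) (\<lambda>u x. 0) (\<lambda>u x. 0)"
  by (rule jet.cong[OF jet.wave[of 0 0 1 1 c]]) (auto simp: wave_def characters_one[simplified])

lemma jet_cnj:
  "jet h p q r \<Longrightarrow> jet (\<lambda>u x. cnj (h u x)) (\<lambda>u x. cnj (q u x)) (\<lambda>u x. cnj (p u x)) (\<lambda>u x. cnj (r u x))"
proof (induction rule: jet.induct)
  case (wave \<alpha> \<beta> k l c)
  then show ?case
    by (intro jet.cong[OF jet.wave[of \<beta> \<alpha> l k "cnj c"]]) (auto simp: cnj_wave)
next
  case (add h p q r h' p' q' r')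
  show ?case
    by (rule jet.cong[OF jet.add[OF add.IH]]) auto
next
  case (cong h p q r h' p' q' r')
  show ?case
    by (rule jet.cong[OF cong.IH]) (auto simp: cong.hyps)
qed

text \<open>The Leibniz rule with one factor frozen to a single wave, so that
  \<open>jet_mult\<close> becomes an induction over the other factor.\<close>

lemma jet_wave_mult:
  assumes "jet h p q r"
  assumes w: "\<alpha> \<ge> 0" "\<beta> \<ge> 0" "k > 0" "l > 0" "\<alpha> - \<beta> = ln (real k) - ln (real l)"
  shows "jet (\<lambda>u x. c * wave \<alpha> \<beta> k l u x * h u x)
    (\<lambda>u x. - of_real \<alpha> * c * wave \<alpha> \<beta> k l u x * h u x + c * wave \<alpha> \<beta> k l u x * p u x)
    (\<lambda>u x. - of_real \<beta> * c * wave \<alpha> \<beta> k l u x * h u x + c * wave \<alpha> \<beta> k l u x * q u x)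
    (\<lambda>u x. of_real \<alpha> * of_real \<beta> * c * wave \<alpha> \<beta> k l u x * h u x
      + - of_real \<alpha> * c * wave \<alpha> \<beta> k l u x * q u x + - of_real \<beta> * c * wave \<alpha> \<beta> k l u x * p u x
      + c * wave \<alpha> \<beta> k l u x * r u x)"
  using assms(1)
proof (induction rule: jet.induct)
  case (wave \<alpha>' \<beta>' k' l' c')
  have "\<alpha> + \<alpha>' - (\<beta> + \<beta>') = ln (real (k * k')) - ln (real (l * l'))"
    using wave w by (simp add: ln_mult)
  then show ?case
    using wave w
    by (intro jet.cong[OF jet.wave[of "\<alpha> + \<alpha>'" "\<beta> + \<beta>'" "k * k'" "l * l'" "c * c'"]])
       (auto simp: wave_mult algebra_simps)
next
  case (add h p q r h' p' q' r')
  show ?case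
    by (rule jet.cong[OF jet.add[OF add.IH]]) (auto simp: algebra_simps)
next
  case (cong h p q r h' p' q' r')
  show ?case
    by (rule jet.cong[OF cong.IH]) (auto simp: cong.hyps)
qed

lemma jet_mult:
  assumes "jet h p q r" "jet h' p' q' r'"
  shows "jet (\<lambda>u x. h u x * h' u x) (\<lambda>u x. p u x * h' u x + h u x * p' u x)
    (\<lambda>u x. q u x * h' u x + h u x * q' u x)
    (\<lambda>u x. r u x * h' u x + p u x * q' u x + q u x * p' u x + h u x * r' u x)"
  using assms(1)
proof (induction rule: jet.induct)
  case (wave \<alpha> \<beta> k l c)
  then show ?case
    by (rule jet_wave_mult[OF assms(2)])
next
  case (add h p q r h' p' q' r')
  show ?case
    by (rule jet.cong[OF jet.add[OF add.IH]]) (auto simp: algebra_simps)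
next
  case (cong h p q r h' p' q' r')
  show ?case
    by (rule jet.cong[OF cong.IH]) (auto simp: cong.hyps)
qed

lemma jet_scale:
  "jet h p q r \<Longrightarrow> jet (\<lambda>u x. c * h u x) (\<lambda>u x. c * p u x) (\<lambda>u x. c * q u x) (\<lambda>u x. c * r u x)"
  by (rule jet.cong[OF jet_mult[OF jet_const[of c]]]) auto

lemma jet_sum:
  "(\<And>i. i \<in> I \<Longrightarrow> jet (h i) (p i) (q i) (r i)) \<Longrightarrow>
    jet (\<lambda>u x. \<Sum>i\<in>I. h i u x) (\<lambda>u x. \<Sum>i\<in>I. p i u x) (\<lambda>u x. \<Sum>i\<in>I. q i u x) (\<lambda>u x. \<Sum>i\<in>I. r i u x)"
proof (induction I rule: infinite_finite_induct)
  case (insert i I)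
  show ?case
    by (rule jet.cong[OF jet.add[OF insert.prems insert.IH]]) (use insert in auto)
qed (use jet_const[of 0] in auto)

lemma jet_bounded:
  assumes "jet h p q r"
  obtains K where "\<And>u x. u \<ge> 0 \<Longrightarrow> x \<in> characters \<Longrightarrow> norm (h u x) \<le> K"
proof -
  from assms have "\<exists>K. \<forall>u\<ge>0. \<forall>x\<in>characters. norm (h u x) \<le> K"
  proof (induction rule: jet.induct)
    case (wave \<alpha> \<beta> k l c)
    then have "\<forall>u\<ge>0. \<forall>x\<in>characters. norm (c * wave \<alpha> \<beta> k l u x) \<le> norm c"
      by (auto simp: norm_mult norm_wave minus_add_distrib[symmetric] simp del: minus_add_distrib intro!: mult_left_le mult_nonneg_nonneg)
    then show ?case ..
  next
    case (add h p q r h' p' q' r')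
    then obtain K K' where "\<forall>u\<ge>0. \<forall>x\<in>characters. norm (h u x) \<le> K" "\<forall>u\<ge>0. \<forall>x\<in>characters. norm (h' u x) \<le> K'"
      by blast
    then have "\<forall>u\<ge>0. \<forall>x\<in>characters. norm (h u x + h' u x) \<le> K + K'"
      by (blast intro: norm_triangle_le add_mono)
    then show ?case ..
  qed auto
  with that show thesis
    by blast
qed

text \<open>Makes derivatives available as wave combinations themselves; in particular the mean of a
  Laplacian is then additive and monotone.\<close>

lemma jet_derivatives:
  "jet h p q r \<Longrightarrow> (\<exists>a b c. jet p a b c) \<and> (\<exists>a b c. jet q a b c) \<and> (\<exists>a b c. jet r a b c)"
proof (induction rule: jet.induct)
  case (wave \<alpha> \<beta> k l c)
  note j = jet.wave[OF wave]
  show ?case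
    using j[of "- of_real \<alpha> * c"] j[of "- of_real \<beta> * c"] j[of "of_real \<alpha> * of_real \<beta> * c"] by blast
next
  case (add h p q r h' p' q' r')
  then show ?case
    by (blast intro: jet.add)
next
  case (cong h p q r h' p' q' r')
  have *: "\<exists>a b c. jet p' a b c" if "\<exists>a b c. jet p a b c" "\<And>u x. x \<in> characters \<Longrightarrow> p' u x = p u x" for p p'
    using that by (blast intro: jet.cong)
  show ?case
    by (intro conjI *[OF _ cong.hyps(3)] *[OF _ cong.hyps(4)] *[OF _ cong.hyps(5)]) (use cong.IH in auto)
qed

definition mean :: "field \<Rightarrow> real \<Rightarrow> complex" where
  "mean h u = (LINT z|torus_measure. h u (character z))"

lemma mean_cong: "(\<And>x. x \<in> characters \<Longrightarrow> h u x = h' u x) \<Longrightarrow> mean h u = mean h' u"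
  unfolding mean_def by (intro Bochner_Integration.integral_cong refl) (simp add: character_in_characters)

lemma jet_integrable:
  assumes "jet h p q r"
  shows "integrable torus_measure (\<lambda>z. h u (character z))"
  using assms
proof (induction rule: jet.induct)
  case (wave \<alpha> \<beta> k l c)
  have "integrable torus_measure (\<lambda>z. wave \<alpha> \<beta> k l u (character z))"
  proof (rule torus_measure.integrable_const_bound)
    show "AE z in torus_measure. norm (wave \<alpha> \<beta> k l u (character z)) \<le> exp (- (\<alpha> + \<beta>) * u)"
      using wave by (intro AE_I2) (simp only: norm_wave character_in_characters order.refl)
  qed (simp add: wave_def)
  then show ?case
    by simp
next
  case (cong h p q r h' p' q' r')
  then show ?case
    by (simp add: character_in_characters cong: Bochner_Integration.integrable_cong)
qed auto

lemma mean_wave: "k > 0 \<Longrightarrow> l > 0 \<Longrightarrow> mean (wave \<alpha> \<beta> k l) u = (if k = l then of_real (exp (- (\<alpha> + \<beta>) * u)) else 0)"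
  unfolding mean_def wave_def
  by (simp only: mult.assoc integral_mult_right_zero integral_character) simp

lemma mean_scale: "mean (\<lambda>u x. c * h u x) u = c * mean h u"
  by (simp add: mean_def)

lemma mean_add: "jet h p q r \<Longrightarrow> jet h' p' q' r' \<Longrightarrow> mean (\<lambda>u x. h u x + h' u x) u = mean h u + mean h' u"
  unfolding mean_def by (intro Bochner_Integration.integral_add jet_integrable)

text \<open>The mean kills the derivative along the flow, so only the radial part of the Laplacian remains.\<close>

lemma mean_second_derivative:
  "jet h p q r \<Longrightarrow> \<exists>D. \<forall>u. (mean h has_vector_derivative D u) (at u) \<and>
    (D has_vector_derivative 4 * mean r u) (at u)"
proof (induction rule: jet.induct)
  case (wave \<alpha> \<beta> k l c)
  show ?case
  \<comment> \<open>Only frequency 1 survives the mean. There \<open>\<alpha> = \<beta>\<close>, so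
    two derivatives in u give (\<open>\<alpha>\<close> + \<open>\<beta>\<close>)^2 = 4
    \<open>\<alpha>\<close> \<open>\<beta>\<close>, which is the factor 4 in the claim.\<close>
  proof (cases "k = l")
    case True
    then have "\<alpha> = \<beta>"
      using wave by simp
    define e where "e = (\<lambda>u. exp (- (\<alpha> + \<beta>) * u))"
    have e: "(e has_real_derivative - (\<alpha> + \<beta>) * e u) (at u)" for u
      unfolding e_def by (auto intro!: derivative_eq_intros)
    have e': "((\<lambda>u. d * of_real (e u)) has_vector_derivative d * of_real (- (\<alpha> + \<beta>) * e u)) (at u)" for d :: complex and u
      by (intro has_vector_derivative_mult_right has_vector_derivative_of_real e)
    have m: "mean (\<lambda>u x. d * wave \<alpha> \<beta> k l u x) = (\<lambda>u. d * of_real (e u))" for d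
      using True wave by (auto simp: mean_scale mean_wave e_def)
    have "(mean (\<lambda>u x. c * wave \<alpha> \<beta> k l u x) has_vector_derivative (- of_real (\<alpha> + \<beta>) * c) * of_real (e u)) (at u)" for u
      unfolding m using e'[of c u] by (simp add: mult_ac)
    moreover have "((\<lambda>u. (- of_real (\<alpha> + \<beta>) * c) * of_real (e u)) has_vector_derivative
        4 * mean (\<lambda>u x. of_real \<alpha> * of_real \<beta> * c * wave \<alpha> \<beta> k l u x) u) (at u)" for u
      unfolding m using e'[of "- of_real (\<alpha> + \<beta>) * c" u] by (simp add: \<open>\<alpha> = \<beta>\<close> algebra_simps)
    ultimately show ?thesis
      by (intro exI[of _ "\<lambda>u. (- of_real (\<alpha> + \<beta>) * c) * of_real (e u)"] allI conjI)
  next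
    case False
    have "mean (\<lambda>u x. d * wave \<alpha> \<beta> k l u x) = (\<lambda>u. 0)" for d
      using False wave by (auto simp: mean_scale mean_wave)
    then show ?thesis
      by (intro exI[of _ "\<lambda>u. 0"]) simp
  qed
next
  case (add h p q r h' p' q' r')
  obtain D D' where
    D: "\<And>u. (mean h has_vector_derivative D u) (at u)" "\<And>u. (D has_vector_derivative 4 * mean r u) (at u)" and
    D': "\<And>u. (mean h' has_vector_derivative D' u) (at u)" "\<And>u. (D' has_vector_derivative 4 * mean r' u) (at u)"
    using add.IH by metis
  have h: "mean (\<lambda>u x. h u x + h' u x) = (\<lambda>u. mean h u + mean h' u)"
    by (rule ext) (rule mean_add[OF add.hyps])
  have r: "mean (\<lambda>u x. r u x + r' u x) u = mean r u + mean r' u" for u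
    using jet_derivatives[OF add.hyps(1)] jet_derivatives[OF add.hyps(2)] mean_add by blast
  show ?case
  proof (intro exI allI conjI)
    fix u
    show "(mean (\<lambda>u x. h u x + h' u x) has_vector_derivative D u + D' u) (at u)"
      unfolding h by (intro has_vector_derivative_add D D')
    show "((\<lambda>u. D u + D' u) has_vector_derivative 4 * mean (\<lambda>u x. r u x + r' u x) u) (at u)"
      unfolding r distrib_left by (intro has_vector_derivative_add D D')
  qed
next
  case (cong h p q r h' p' q' r')
  have "mean h' = mean h" "mean r' = mean r"
    by (intro ext mean_cong cong.hyps; assumption)+
  with cong.IH show ?case
    by simp
qed

section \<open>Bounded harmonic extension\<close>

text \<open>A Phragmen-Lindelof argument: exp H is divided by 1 + e s, whose modulus is at least 1
  on the half-plane, so nothing is lost on the imaginary axis, and large far away, so a big half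
  disc obeys the maximum principle with bound exp B. Then e tends to 0.\<close>

lemma Re_le_on_right_halfplane:
  assumes H: "H holomorphic_on UNIV" and K: "\<And>s. Re s \<ge> 0 \<Longrightarrow> norm (H s) \<le> K"
    and B: "\<And>t. Re (H (\<i> * of_real t)) \<le> B" and s0: "Re s0 \<ge> 0"
  shows "Re (H s0) \<le> B"
proof -
  have bound: "exp (Re (H s0)) \<le> exp B * norm (1 + of_real e * s0)" if "e > 0" for e
  proof -
    define f where "f s = exp (H s) / (1 + of_real e * s)" for s
    \<comment> \<open>Large enough for the half disc to contain \<open>s0\<close> and for |1 + e s|
      to reach exp (K - B) on the arc; the extra 1 pays for the triangle inequality.\<close>
    define R where "R = max (norm s0) ((exp (K - B) + 1) / e)"
    define S where "S = cball 0 R \<inter> {s. Re s \<ge> 0}"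
    have closedS: "closed S"
      unfolding S_def by (intro closed_Int closed_cball closed_halfspace_Re_ge)
    have nz: "1 + of_real e * s \<noteq> 0" "norm (1 + of_real e * s) \<ge> 1" if "Re s \<ge> 0" for s
    proof -
      have "1 \<le> Re (1 + of_real e * s)"
        using that \<open>e > 0\<close> by simp
      also have "\<dots> \<le> norm (1 + of_real e * s)"
        by (rule complex_Re_le_cmod)
      finally show "norm (1 + of_real e * s) \<ge> 1" .
      then show "1 + of_real e * s \<noteq> 0"
        by auto
    qed
    have fhol: "f holomorphic_on S"
      unfolding f_def using nz
      by (intro holomorphic_intros holomorphic_on_subset[OF H]) (auto simp: S_def)
    have "norm (f s0) \<le> exp B"
    proof (rule maximum_modulus_frontier[of f S])
      show "f holomorphic_on interior S"
        using fhol interior_subset by (rule holomorphic_on_subset)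
      show "continuous_on (closure S) f"
        using fhol closedS by (simp add: holomorphic_on_imp_continuous_on)
      show "bounded S"
        unfolding S_def by (intro bounded_Int) auto
      show "s0 \<in> S"
        using s0 by (simp add: S_def R_def)
    next
      fix s
      assume "s \<in> frontier S"
      then have s: "s \<in> S" "s \<notin> interior S"
        using closedS by (auto simp: frontier_def)
      have "ball 0 R \<inter> {s. Re s > 0} \<subseteq> interior S"
        by (rule interior_maximal)
           (auto simp: S_def intro!: open_Int open_halfspace_Re_gt)
      then have "Re s = 0 \<or> norm s = R"
        using s by (force simp: S_def)
      moreover have Re: "Re s \<ge> 0"
        using s by (simp add: S_def)
      ultimately show "norm (f s) \<le> exp B"
      proof (elim disjE)
        assume "Re s = 0"
        then have "s = \<i> * of_real (Im s)"
          by (simp add: complex_eq_iff)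
        then have "Re (H s) \<le> B"
          using B[of "Im s"] by simp
        then have "exp (Re (H s)) / norm (1 + of_real e * s) \<le> exp B / 1"
          using nz[OF Re] by (intro frac_le) auto
        then show ?thesis
          by (simp add: f_def norm_divide)
      next
        assume R: "norm s = R"
        have "Re (H s) \<le> K"
          using complex_Re_le_cmod[of "H s"] K[OF Re] by linarith
        moreover have "exp (K - B) \<le> norm (1 + of_real e * s)"
        proof -
          have "exp (K - B) + 1 \<le> e * norm s"
            using R \<open>e > 0\<close> by (simp add: R_def max_def field_simps split: if_splits)
          also have "\<dots> = norm ((1 + of_real e * s) - 1)"
            using \<open>e > 0\<close> by (simp add: norm_mult)
          also have "\<dots> \<le> norm (1 + of_real e * s) + 1"
            using norm_triangle_ineq4[of "1 + of_real e * s" 1] by simp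
          finally show ?thesis
            by simp
        qed
        ultimately have "exp (Re (H s)) / norm (1 + of_real e * s) \<le> exp K / exp (K - B)"
          by (intro frac_le) auto
        also have "\<dots> = exp B"
          by (simp add: exp_diff)
        finally show ?thesis
          by (simp add: f_def norm_divide)
      qed
    qed
    then show ?thesis
      using nz[OF s0] by (simp add: f_def norm_divide field_simps)
  qed
  have "((\<lambda>e. exp B * norm (1 + of_real e * s0)) \<longlongrightarrow> exp B * norm (1 + of_real 0 * s0)) (at_right 0)"
    by (intro tendsto_intros)
  then have "exp (Re (H s0)) \<le> exp B * norm (1 + of_real 0 * s0)"
    by (rule tendsto_lowerbound) (auto simp: eventually_at_right_less bound eventually_at_filter)
  then show ?thesis
    by simp
qed

section \<open>The vertical flow and harmonic extension along its orbits\<close>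

definition flow :: "real \<Rightarrow> (nat \<Rightarrow> complex) \<Rightarrow> nat \<Rightarrow> complex" where
  "flow t x n = x n * cis (- t * ln (real n))"

lemma flow_0 [simp]: "flow 0 x = x"
  by (simp add: flow_def fun_eq_iff)

lemma flow_in_characters: "x \<in> characters \<Longrightarrow> flow t x \<in> characters"
proof -
  assume "x \<in> characters"
  moreover have "cis (- t * ln (real (m * n))) = cis (- t * ln (real m)) * cis (- t * ln (real n))"
    if "m > 0" "n > 0" for m n
    using that unfolding cis_mult by (intro arg_cong[where f = cis]) (simp add: ln_mult algebra_simps)
  ultimately show ?thesis
    by (simp add: characters_def flow_def norm_mult)
qed

lemma flow_wave:
  "wave \<alpha> \<beta> k l u (flow t x) = x k * cnj (x l) * exp (- (of_real (\<alpha> + \<beta>) * of_real u) - \<i> * t * (ln (real k) - ln (real l)))"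
proof -
  have "cis (- t * ln (real k)) * cnj (cis (- t * ln (real l))) = cis (- t * (ln (real k) - ln (real l)))"
    unfolding cis_cnj cis_mult by (rule arg_cong[where f = cis]) (simp add: algebra_simps)
  then have "cis (- t * ln (real k)) * cnj (cis (- t * ln (real l))) = exp (\<i> * of_real (- t * (ln (real k) - ln (real l))))"
    by (simp only: cis_conv_exp)
  note A = this
  have E: "complex_of_real (exp (- (\<alpha> + \<beta>) * u)) = exp (- (of_real (\<alpha> + \<beta>) * of_real u))"
    unfolding exp_of_real[symmetric] by (rule arg_cong[where f = exp]) (simp add: algebra_simps)
  have S: "exp (- (of_real (\<alpha> + \<beta>) * of_real u)) * exp (\<i> * of_real (- t * (ln (real k) - ln (real l)))) =
      exp (- (of_real (\<alpha> + \<beta>) * of_real u) - \<i> * t * (ln (real k) - ln (real l)))"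
    unfolding exp_add[symmetric] by (rule arg_cong[where f = exp]) (simp add: algebra_simps)
  have "wave \<alpha> \<beta> k l u (flow t x) = x k * cnj (x l) *
      (of_real (exp (- (\<alpha> + \<beta>) * u)) * (cis (- t * ln (real k)) * cnj (cis (- t * ln (real l)))))"
    by (simp only: wave_def flow_def complex_cnj_mult mult_ac)
  then show ?thesis
    by (simp only: A E S)
qed

text \<open>Only the boundary values of \<open>h\<close> are kept: a frequency k/l is extended by an
  exponential of s if ln k >= ln l and of the conjugate of s otherwise, which replaces the rates of
  \<open>h\<close> by a pair with one entry 0 and kills the mixed derivative. Real parts are used
  because conjugating an antiholomorphic wave leaves its real part alone and makes it holomorphic,
  so that both kinds of waves can be summed into one entire \<open>H\<close>.\<close>

lemma harmonic_extension_waves: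
  assumes "jet h p q r"
  shows "\<exists>\<Phi> P Q. jet \<Phi> P Q (\<lambda>u x. 0) \<and> (\<forall>x\<in>characters. \<Phi> 0 x = h 0 x) \<and>
    (\<forall>\<omega>. \<forall>x\<in>characters. \<exists>H K. H holomorphic_on UNIV \<and> (\<forall>s. Re s \<ge> 0 \<longrightarrow> norm (H s) \<le> K) \<and>
      (\<forall>u t. Re (\<omega> * \<Phi> u (flow t x)) = Re (H (Complex u t))))"
  using assms
proof (induction rule: jet.induct)
  case (wave \<alpha> \<beta> k l c)
  define \<nu> where "\<nu> = ln (real k) - ln (real l)"
  have Complex: "Complex u t = of_real u + \<i> * of_real t" for u t
    by (simp add: complex_eq_iff)
  have norm_exp: "norm (a * exp (of_real (- \<bar>\<nu>\<bar>) * s)) \<le> norm a" if "Re s \<ge> 0" for a s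
    using that by (simp add: norm_mult mult_left_le)
  show ?case
  proof (cases "\<nu> \<ge> 0")
    case True
    have "jet (\<lambda>u x. c * wave \<nu> 0 k l u x) (\<lambda>u x. - of_real \<nu> * c * wave \<nu> 0 k l u x) (\<lambda>u x. - of_real 0 * c * wave \<nu> 0 k l u x) (\<lambda>u x. 0)"
      by (rule jet.cong[OF jet.wave[of \<nu> 0 k l c]]) (use wave True in \<open>auto simp: \<nu>_def\<close>)
    moreover have "\<exists>H K. H holomorphic_on UNIV \<and> (\<forall>s. Re s \<ge> 0 \<longrightarrow> norm (H s) \<le> K) \<and>
      (\<forall>u t. Re (\<omega> * (c * wave \<nu> 0 k l u (flow t x))) = Re (H (Complex u t)))" for \<omega> x
    proof (intro exI conjI allI impI)
      let ?a = "\<omega> * c * x k * cnj (x l)"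
      let ?H = "\<lambda>s. ?a * exp (of_real (- \<bar>\<nu>\<bar>) * s)"
      show "?H holomorphic_on UNIV"
        by (intro holomorphic_intros)
      show "norm (?H s) \<le> norm ?a" if "Re s \<ge> 0" for s
        by (rule norm_exp[OF that])
      show "Re (\<omega> * (c * wave \<nu> 0 k l u (flow t x))) = Re (?H (Complex u t))" for u t
      proof -
        have "- (of_real (\<nu> + 0) * of_real u) - \<i> * t * (ln (real k) - ln (real l)) = of_real (- \<bar>\<nu>\<bar>) * Complex u t"
          using True by (simp add: Complex \<nu>_def algebra_simps)
        then show ?thesis
          by (simp only: flow_wave mult.assoc)
      qed
    qed
    ultimately show ?thesis
      by (intro exI[of _ "\<lambda>u x. c * wave \<nu> 0 k l u x"] exI[of _ "\<lambda>u x. - of_real \<nu> * c * wave \<nu> 0 k l u x"]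
          exI[of _ "\<lambda>u x. - of_real 0 * c * wave \<nu> 0 k l u x"] conjI ballI allI) (assumption | simp only: | simp add: wave_def)+
  next
    case False
    have "jet (\<lambda>u x. c * wave 0 (- \<nu>) k l u x) (\<lambda>u x. - of_real 0 * c * wave 0 (- \<nu>) k l u x) (\<lambda>u x. - of_real (- \<nu>) * c * wave 0 (- \<nu>) k l u x) (\<lambda>u x. 0)"
      by (rule jet.cong[OF jet.wave[of 0 "- \<nu>" k l c]]) (use wave False in \<open>auto simp: \<nu>_def\<close>)
    moreover have "\<exists>H K. H holomorphic_on UNIV \<and> (\<forall>s. Re s \<ge> 0 \<longrightarrow> norm (H s) \<le> K) \<and>
      (\<forall>u t. Re (\<omega> * (c * wave 0 (- \<nu>) k l u (flow t x))) = Re (H (Complex u t)))" for \<omega> x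
    proof (intro exI conjI allI impI)
      let ?a = "\<omega> * c * x k * cnj (x l)"
      let ?H = "\<lambda>s. cnj ?a * exp (of_real (- \<bar>\<nu>\<bar>) * s)"
      show "?H holomorphic_on UNIV"
        by (intro holomorphic_intros)
      show "norm (?H s) \<le> norm (cnj ?a)" if "Re s \<ge> 0" for s
        by (rule norm_exp[OF that])
      show "Re (\<omega> * (c * wave 0 (- \<nu>) k l u (flow t x))) = Re (?H (Complex u t))" for u t
      proof -
        have eq: "- (of_real (0 + - \<nu>) * of_real u) - \<i> * t * (ln (real k) - ln (real l)) = cnj (of_real (- \<bar>\<nu>\<bar>) * Complex u t)"
          using False by (simp add: Complex \<nu>_def algebra_simps)
        have "\<omega> * (c * wave 0 (- \<nu>) k l u (flow t x)) = ?a * exp (cnj (of_real (- \<bar>\<nu>\<bar>) * Complex u t))"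
          unfolding flow_wave eq by (simp only: mult.assoc)
        also have "\<dots> = cnj (?H (Complex u t))"
          by (simp add: exp_cnj)
        finally show ?thesis
          by (simp only: cnj.simps)
      qed
    qed
    ultimately show ?thesis
      by (intro exI[of _ "\<lambda>u x. c * wave 0 (- \<nu>) k l u x"] exI[of _ "\<lambda>u x. - of_real 0 * c * wave 0 (- \<nu>) k l u x"]
          exI[of _ "\<lambda>u x. - of_real (- \<nu>) * c * wave 0 (- \<nu>) k l u x"] conjI ballI allI) (assumption | simp only: | simp add: wave_def)+
  qed
next
  case (add h p q r h' p' q' r')
  from add.IH(1) obtain \<Phi> P Q where
    1: "jet \<Phi> P Q (\<lambda>u x. 0)" "\<forall>x\<in>characters. \<Phi> 0 x = h 0 x" and
    H: "\<forall>\<omega>. \<forall>x\<in>characters. \<exists>H K. H holomorphic_on UNIV \<and> (\<forall>s. Re s \<ge> 0 \<longrightarrow> norm (H s) \<le> K) \<and>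
      (\<forall>u t. Re (\<omega> * \<Phi> u (flow t x)) = Re (H (Complex u t)))"
    by blast
  from add.IH(2) obtain \<Phi>' P' Q' where
    2: "jet \<Phi>' P' Q' (\<lambda>u x. 0)" "\<forall>x\<in>characters. \<Phi>' 0 x = h' 0 x" and
    H': "\<forall>\<omega>. \<forall>x\<in>characters. \<exists>H K. H holomorphic_on UNIV \<and> (\<forall>s. Re s \<ge> 0 \<longrightarrow> norm (H s) \<le> K) \<and>
      (\<forall>u t. Re (\<omega> * \<Phi>' u (flow t x)) = Re (H (Complex u t)))"
    by blast
  show ?case
  proof (rule exI, rule exI, rule exI, intro conjI ballI allI)
    show "jet (\<lambda>u x. \<Phi> u x + \<Phi>' u x) (\<lambda>u x. P u x + P' u x) (\<lambda>u x. Q u x + Q' u x) (\<lambda>u x. 0)"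
      using jet.add[OF 1(1) 2(1)] by simp
    show "\<Phi> 0 x + \<Phi>' 0 x = h 0 x + h' 0 x" if "x \<in> characters" for x
      using that 1 2 by simp
    fix \<omega> x
    assume x: "x \<in> characters"
    obtain H K where H: "H holomorphic_on UNIV" "\<forall>s. Re s \<ge> 0 \<longrightarrow> norm (H s) \<le> K"
      "\<forall>u t. Re (\<omega> * \<Phi> u (flow t x)) = Re (H (Complex u t))"
      using H x by blast
    obtain H' K' where H': "H' holomorphic_on UNIV" "\<forall>s. Re s \<ge> 0 \<longrightarrow> norm (H' s) \<le> K'"
      "\<forall>u t. Re (\<omega> * \<Phi>' u (flow t x)) = Re (H' (Complex u t))"
      using H' x by blast
    show "\<exists>H K. H holomorphic_on UNIV \<and> (\<forall>s. Re s \<ge> 0 \<longrightarrow> norm (H s) \<le> K) \<and>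
      (\<forall>u t. Re (\<omega> * (\<Phi> u (flow t x) + \<Phi>' u (flow t x))) = Re (H (Complex u t)))"
    proof (intro exI conjI allI impI)
      show "(\<lambda>s. H s + H' s) holomorphic_on UNIV"
        by (intro holomorphic_intros H H')
      show "norm (H s + H' s) \<le> K + K'" if "Re s \<ge> 0" for s
        using H(2) H'(2) that by (blast intro: norm_triangle_le add_mono)
      show "Re (\<omega> * (\<Phi> u (flow t x) + \<Phi>' u (flow t x))) = Re (H (Complex u t) + H' (Complex u t))" for u t
        using H(3) H'(3) by (simp only: distrib_left plus_complex.simps)
    qed
  qed
next
  case (cong h p q r h' p' q' r')
  then show ?case
    by simp
qed

text \<open>The maximum principle is applied on each orbit of the flow, whose boundary points are
  again characters. Rotating by the \<open>\<omega>\<close> that makes the value at the given point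
  positive turns bounds for real parts into a bound for the modulus.\<close>

lemma harmonic_extension:
  assumes "jet h p q r" and B: "\<And>x. x \<in> characters \<Longrightarrow> norm (h 0 x) \<le> B"
  obtains \<Phi> P Q where "jet \<Phi> P Q (\<lambda>u x. 0)" "\<And>x. x \<in> characters \<Longrightarrow> \<Phi> 0 x = h 0 x"
    "\<And>u x. u \<ge> 0 \<Longrightarrow> x \<in> characters \<Longrightarrow> norm (\<Phi> u x) \<le> B"
proof -
  from harmonic_extension_waves[OF assms(1)] obtain \<Phi> P Q where
    \<Phi>: "jet \<Phi> P Q (\<lambda>u x. 0)" "\<forall>x\<in>characters. \<Phi> 0 x = h 0 x" and
    H: "\<forall>\<omega>. \<forall>x\<in>characters. \<exists>H K. H holomorphic_on UNIV \<and> (\<forall>s. Re s \<ge> 0 \<longrightarrow> norm (H s) \<le> K) \<and>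
      (\<forall>u t. Re (\<omega> * \<Phi> u (flow t x)) = Re (H (Complex u t)))"
    by blast
  have "norm (\<Phi> u x) \<le> B" if "u \<ge> 0" and x: "x \<in> characters" for u x
  proof -
    define \<omega> where "\<omega> = cis (- Arg (\<Phi> u x))"
    have "\<Phi> u x = of_real (norm (\<Phi> u x)) * cis (Arg (\<Phi> u x))"
      using rcis_cmod_Arg[of "\<Phi> u x"] by (simp add: rcis_def)
    then have \<omega>: "Re (\<omega> * \<Phi> u x) = norm (\<Phi> u x)"
      by (metis (no_types, lifting) \<omega>_def Re_complex_of_real add.left_inverse cis_mult cis_zero mult.left_commute mult.right_neutral)
    obtain H K where HK: "H holomorphic_on UNIV" "\<forall>s. Re s \<ge> 0 \<longrightarrow> norm (H s) \<le> K"
      "\<forall>u t. Re (\<omega> * \<Phi> u (flow t x)) = Re (H (Complex u t))"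
      using H x by blast
    have "Re (H (Complex u 0)) \<le> B"
    proof (rule Re_le_on_right_halfplane[OF HK(1)])
      show "Re (H (\<i> * of_real t)) \<le> B" for t
      proof -
        have "Re (H (\<i> * of_real t)) = Re (\<omega> * \<Phi> 0 (flow t x))"
          using HK(3) by (metis Complex_eq add.left_neutral of_real_0)
        also have "\<dots> \<le> norm (\<omega> * \<Phi> 0 (flow t x))"
          by (rule complex_Re_le_cmod)
        also have "\<dots> = norm (h 0 (flow t x))"
          using \<Phi>(2) flow_in_characters[OF x] by (simp add: norm_mult \<omega>_def)
        also have "\<dots> \<le> B"
          by (intro B flow_in_characters x)
        finally show ?thesis .
      qed
    qed (use HK \<open>u \<ge> 0\<close> in auto)
    then show ?thesis
      using HK(3) \<omega> by (metis flow_0)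
  qed
  with \<Phi> that show thesis
    by blast
qed

text \<open>A positive slope anywhere would persist by convexity and force unbounded growth, so the
  slope is never positive.\<close>

lemma bounded_convex_le_at_0:
  fixes G :: "real \<Rightarrow> real"
  assumes G: "\<And>u. (G has_real_derivative G' u) (at u)" and G': "\<And>u. (G' has_real_derivative G'' u) (at u)"
    and pos: "\<And>u. u \<ge> 0 \<Longrightarrow> G'' u \<ge> 0" and K: "\<And>u. u \<ge> 0 \<Longrightarrow> \<bar>G u\<bar> \<le> K" and "u \<ge> 0"
  shows "G u \<le> G 0"
proof -
  have mono: "G' a \<le> G' b" if "0 \<le> a" "a \<le> b" for a b
    using that(2)
  proof (rule DERIV_nonneg_imp_nondecreasing)
    show "\<exists>y. (G' has_real_derivative y) (at x) \<and> 0 \<le> y" if "a \<le> x" for x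
      using G'[of x] pos[of x] that \<open>0 \<le> a\<close> by (intro exI[of _ "G'' x"]) simp
  qed
  have "G' a \<le> 0" if "a \<ge> 0" for a
  proof (rule ccontr)
    assume "\<not> G' a \<le> 0"
    then have pos: "G' a > 0"
      by simp
    have "K \<ge> 0"
      using K[of 0] by simp
    \<comment> \<open>Far enough for a slope of at least \<open>G' a\<close> to produce an increase
      of 2 K + 1, more than the bound K allows.\<close>
    define b where "b = a + (2 * K + 1) / G' a"
    have "a < b"
      using pos \<open>K \<ge> 0\<close> by (simp add: b_def)
    then obtain c where c: "a < c" "c < b" "G b - G a = (b - a) * G' c"
      using MVT2[of a b G G'] G by blast
    have "2 * K + 1 = (b - a) * G' a"
      using pos by (simp add: b_def)
    also have "\<dots> \<le> (b - a) * G' c"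
      using c that by (intro mult_left_mono mono) auto
    also have "\<dots> = G b - G a"
      using c by simp
    also have "\<dots> \<le> 2 * K"
      using K[of a] K[of b] that \<open>a < b\<close> by simp
    finally show False
      by simp
  qed
  with G have "\<exists>y. (G has_real_derivative y) (at x) \<and> y \<le> 0" if "0 \<le> x" for x
    using that by (intro exI[of _ "G' x"]) simp
  then show ?thesis
    using \<open>u \<ge> 0\<close> by (intro DERIV_nonpos_imp_nonincreasing[of 0 u])
qed

section \<open>The bilinear estimate for Dirichlet polynomials\<close>

definition dpoly :: "nat set \<Rightarrow> dirichlet \<Rightarrow> field" where
  "dpoly A f u x = (\<Sum>n\<in>A. f n * wave (ln (real n)) 0 n 1 u x)"

lemma jet_dpoly:
  assumes "\<And>n. n \<in> A \<Longrightarrow> n > 0"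
  shows "jet (dpoly A f) (dpoly A (\<lambda>n. - of_real (ln (real n)) * f n)) (\<lambda>u x. 0) (\<lambda>u x. 0)"
proof -
  have "jet (\<lambda>u x. \<Sum>n\<in>A. f n * wave (ln (real n)) 0 n 1 u x)
      (\<lambda>u x. \<Sum>n\<in>A. - of_real (ln (real n)) * f n * wave (ln (real n)) 0 n 1 u x)
      (\<lambda>u x. \<Sum>n\<in>A. - of_real 0 * f n * wave (ln (real n)) 0 n 1 u x)
      (\<lambda>u x. \<Sum>n\<in>A. of_real (ln (real n)) * of_real 0 * f n * wave (ln (real n)) 0 n 1 u x)"
    using assms by (intro jet_sum jet.wave) (auto simp: Suc_le_eq)
  then show ?thesis
    by (rule jet.cong) (auto simp: dpoly_def)
qed

text \<open>The function \<open>F\<close> with \<open>F' = f g'\<close>. The terms with \<open>d e = 1\<close> vanish since \<open>x / 0 = 0\<close>.\<close>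

definition skew_poly :: "nat set \<Rightarrow> dirichlet \<Rightarrow> dirichlet \<Rightarrow> field" where
  "skew_poly A f g u x = (\<Sum>d\<in>A. \<Sum>e\<in>A. f d * g e * of_real (ln (real e) / ln (real (d * e)))
    * wave (ln (real (d * e))) 0 (d * e) 1 u x)"

text \<open>Differentiation multiplies the frequency d e by ln (d e), which cancels the denominator
  and leaves the coefficients of f g'. For d e = 1 both sides are 0.\<close>

lemma jet_skew_poly:
  assumes "\<And>n. n \<in> A \<Longrightarrow> n > 0"
  shows "jet (skew_poly A f g) (\<lambda>u x. dpoly A f u x * dpoly A (\<lambda>n. - of_real (ln (real n)) * g n) u x)
    (\<lambda>u x. 0) (\<lambda>u x. 0)"
proof -
  let ?c = "\<lambda>d e. f d * g e * of_real (ln (real e) / ln (real (d * e)))"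
  have "jet (\<lambda>u x. \<Sum>d\<in>A. \<Sum>e\<in>A. ?c d e * wave (ln (real (d * e))) 0 (d * e) 1 u x)
      (\<lambda>u x. \<Sum>d\<in>A. \<Sum>e\<in>A. - of_real (ln (real (d * e))) * ?c d e * wave (ln (real (d * e))) 0 (d * e) 1 u x)
      (\<lambda>u x. \<Sum>d\<in>A. \<Sum>e\<in>A. - of_real 0 * ?c d e * wave (ln (real (d * e))) 0 (d * e) 1 u x)
      (\<lambda>u x. \<Sum>d\<in>A. \<Sum>e\<in>A. of_real (ln (real (d * e))) * of_real 0 * ?c d e * wave (ln (real (d * e))) 0 (d * e) 1 u x)"
    using assms by (intro jet_sum jet.wave) (auto simp: Suc_le_eq simp del: of_nat_mult)
  then show ?thesis
  proof (rule jet.cong)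
    fix u x
    assume x: "x \<in> characters"
    have "- of_real (ln (real (d * e))) * ?c d e * wave (ln (real (d * e))) 0 (d * e) 1 u x =
        f d * wave (ln (real d)) 0 d 1 u x * (- of_real (ln (real e)) * g e * wave (ln (real e)) 0 e 1 u x)"
      if "d \<in> A" "e \<in> A" for d e
    proof -
      have d: "d > 0" and e: "e > 0"
        using assms that by auto
      have w: "wave (ln (real (d * e))) 0 (d * e) 1 u x = wave (ln (real d)) 0 d 1 u x * wave (ln (real e)) 0 e 1 u x"
        using wave_mult[OF x d _ e, of 1 1 "ln (real d)" "ln (real e)" 0 0 u] d e by (simp add: ln_mult)
      have l: "of_real (ln (real (d * e))) * complex_of_real (ln (real e) / ln (real (d * e))) = of_real (ln (real e))"
      proof (cases "d * e = 1")
        case False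
        then have "ln (real (d * e)) \<noteq> 0"
          using d e by (simp add: ln_eq_zero_iff del: of_nat_mult)
        then show ?thesis
          by (simp del: of_nat_mult)
      qed simp
      have "- of_real (ln (real (d * e))) * ?c d e = f d * (- of_real (ln (real e)) * g e)"
        unfolding l[symmetric] by (simp only: mult_ac minus_mult_left minus_mult_right)
      then show ?thesis
        unfolding w by (simp only: mult_ac)
    qed
    then show "dpoly A f u x * dpoly A (\<lambda>n. - of_real (ln (real n)) * g n) u x =
        (\<Sum>d\<in>A. \<Sum>e\<in>A. - of_real (ln (real (d * e))) * ?c d e * wave (ln (real (d * e))) 0 (d * e) 1 u x)"
      unfolding dpoly_def sum_product by (intro sum.cong refl) simp
  qed (auto simp: skew_poly_def)
qed

text \<open>Every frequency that survives is at least 2, since the term d e = 1 has coefficient 0.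
  This is where the normalisation F(+infinity) = 0 enters the estimate.\<close>

lemma skew_poly_decay:
  assumes A: "\<And>n. n \<in> A \<Longrightarrow> n > 0"
  obtains C where "\<And>u x. u \<ge> 0 \<Longrightarrow> x \<in> characters \<Longrightarrow> norm (skew_poly A f g u x) \<le> C * exp (- ln 2 * u)"
proof -
  let ?c = "\<lambda>d e. f d * g e * of_real (ln (real e) / ln (real (d * e)))"
  have "norm (skew_poly A f g u x) \<le> (\<Sum>d\<in>A. \<Sum>e\<in>A. norm (?c d e)) * exp (- ln 2 * u)"
    if u: "u \<ge> 0" and x: "x \<in> characters" for u x
    unfolding skew_poly_def sum_distrib_right
  proof (intro sum_norm_le)
    fix d e
    assume "d \<in> A" "e \<in> A"
    then have de: "d * e > 0"
      using A by simp
    show "norm (?c d e * wave (ln (real (d * e))) 0 (d * e) 1 u x) \<le> norm (?c d e) * exp (- ln 2 * u)"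
    proof (cases "d * e = 1")
      case False
      with de have "d * e \<ge> 2"
        by linarith
      then have "real 2 \<le> real (d * e)"
        by (simp only: of_nat_le_iff)
      then have "ln 2 \<le> ln (real (d * e))"
        using de by simp
      then have "norm (wave (ln (real (d * e))) 0 (d * e) 1 u x) \<le> exp (- ln 2 * u)"
        using u de x by (simp add: norm_wave mult_right_mono del: of_nat_mult)
      then show ?thesis
        unfolding norm_mult[of "?c d e"] by (intro mult_left_mono) auto
    qed simp
  qed
  then show thesis
    by (rule that)
qed

lemma Re_mean_mono:
  assumes "jet h p q r" "jet h' p' q' r'" "\<And>x. x \<in> characters \<Longrightarrow> Re (h u x) \<le> Re (h' u x)"
  shows "Re (mean h u) \<le> Re (mean h' u)"
proof -
  have "Re (mean h u) = (LINT z|torus_measure. Re (h u (character z)))"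
    unfolding mean_def using jet_integrable[OF assms(1)] by simp
  also have "\<dots> \<le> (LINT z|torus_measure. Re (h' u (character z)))"
    using jet_integrable[OF assms(1)] jet_integrable[OF assms(2)]
    by (intro integral_mono integrable_Re) (auto intro: assms(3) character_in_characters)
  also have "\<dots> = Re (mean h' u)"
    unfolding mean_def using jet_integrable[OF assms(2)] by simp
  finally show ?thesis .
qed

lemma mean_const: "mean (\<lambda>u x. c) u = c"
  by (simp add: mean_def torus_measure.prob_space)

lemma mean_dpoly_square:
  assumes "finite A" and A: "\<And>n. n \<in> A \<Longrightarrow> n > 0"
  shows "mean (\<lambda>u x. dpoly A f u x * cnj (dpoly A f u x)) 0 = of_real (\<Sum>n\<in>A. (norm (f n))\<^sup>2)"
proof -
  have "mean (\<lambda>u x. dpoly A f u x * cnj (dpoly A f u x)) 0 =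
      (LINT z|torus_measure. (\<Sum>n\<in>A. \<Sum>m\<in>A. f n * cnj (f m) * (character z n * cnj (character z m))))"
    unfolding mean_def
  proof (intro Bochner_Integration.integral_cong refl)
    fix z
    assume "z \<in> space torus_measure"
    then have "character z 1 = 1"
      using character_in_characters characters_one by blast
    then have "dpoly A f 0 (character z) = (\<Sum>n\<in>A. f n * character z n)"
      by (simp add: dpoly_def wave_def)
    then show "dpoly A f 0 (character z) * cnj (dpoly A f 0 (character z)) =
        (\<Sum>n\<in>A. \<Sum>m\<in>A. f n * cnj (f m) * (character z n * cnj (character z m)))"
      by (simp add: sum_product mult_ac)
  qed
  also have "\<dots> = (\<Sum>n\<in>A. \<Sum>m\<in>A. f n * cnj (f m) * (if n = m then 1 else 0))"
  proof -
    have int: "integrable torus_measure (\<lambda>z. character z n * cnj (character z m))" if "n \<in> A" "m \<in> A" for n m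
    proof (rule torus_measure.integrable_const_bound[of _ 1])
      show "AE z in torus_measure. norm (character z n * cnj (character z m)) \<le> 1"
        by (intro AE_I2) (simp add: norm_mult norm_character)
    qed measurable
    have "(LINT z|torus_measure. (\<Sum>n\<in>A. \<Sum>m\<in>A. f n * cnj (f m) * (character z n * cnj (character z m)))) =
        (\<Sum>n\<in>A. LINT z|torus_measure. (\<Sum>m\<in>A. f n * cnj (f m) * (character z n * cnj (character z m))))"
      using int by (intro Bochner_Integration.integral_sum Bochner_Integration.integrable_sum integrable_mult_right)
    also have "\<dots> = (\<Sum>n\<in>A. \<Sum>m\<in>A. LINT z|torus_measure. f n * cnj (f m) * (character z n * cnj (character z m)))"
      using int by (intro sum.cong refl Bochner_Integration.integral_sum integrable_mult_right)
    also have "\<dots> = (\<Sum>n\<in>A. \<Sum>m\<in>A. f n * cnj (f m) * (if n = m then 1 else 0))"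
      using A by (intro sum.cong refl) (simp only: integral_mult_right_zero integral_character)
    finally show ?thesis .
  qed
  also have "\<dots> = of_real (\<Sum>n\<in>A. (norm (f n))\<^sup>2)"
    using \<open>finite A\<close> by (simp add: complex_norm_square[symmetric] of_real_sum if_distrib sum.delta cong: if_cong)
  finally show ?thesis .
qed

text \<open>Pointwise form of the subharmonicity: \<open>f1\<close> and \<open>g1\<close> stand for
  the derivatives of f and g, \<open>P\<close> and \<open>Q\<close> for the two Wirtinger
  derivatives of the harmonic function. All phases are discarded, leaving a quadratic form in
  moduli.\<close>

lemma skew_laplacian_nonneg:
  fixes f f1 g1 \<Phi> P Q :: complex
  assumes \<Phi>: "norm \<Phi> \<le> 1" and \<omega>: "norm \<omega> = 1"
  shows "0 \<le> Re (1/2 * (g1 * cnj g1) + (f1 * cnj f1 * (3 + \<Phi> * cnj \<Phi>) + f1 * cnj f * (Q * cnj \<Phi> + \<Phi> * cnj P)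
    + f * cnj f1 * (P * cnj \<Phi> + \<Phi> * cnj Q) + f * cnj f * (P * cnj P + Q * cnj Q)) + - \<omega> * (f * g1 * cnj P))"
proof -
  define a b p q where "a = norm f" and "b = norm f1" and "p = norm P" and "q = norm Q"
  have sq: "w * cnj w = of_real ((norm w)\<^sup>2)" for w :: complex
    by (rule complex_norm_square[symmetric])
  have low: "- norm w \<le> Re w" for w
    using abs_Re_le_cmod[of w] by linarith
  have 1: "Re (f1 * cnj f * (Q * cnj \<Phi> + \<Phi> * cnj P)) \<ge> - (b * a * (q + p))"
  proof -
    have "norm (Q * cnj \<Phi> + \<Phi> * cnj P) \<le> q * norm \<Phi> + norm \<Phi> * p"
      unfolding p_def q_def by (rule norm_triangle_le) (simp add: norm_mult)
    also have "\<dots> \<le> q * 1 + 1 * p"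
      using \<Phi> by (intro add_mono mult_left_mono mult_right_mono) (auto simp: p_def q_def)
    finally have "norm (f1 * cnj f * (Q * cnj \<Phi> + \<Phi> * cnj P)) \<le> b * a * (q + p)"
      by (simp add: norm_mult a_def b_def mult_left_mono)
    then show ?thesis
      using low[of "f1 * cnj f * (Q * cnj \<Phi> + \<Phi> * cnj P)"] by linarith
  qed
  have "f * cnj f1 * (P * cnj \<Phi> + \<Phi> * cnj Q) = cnj (f1 * cnj f * (Q * cnj \<Phi> + \<Phi> * cnj P))"
    by (simp add: algebra_simps)
  then have 2: "Re (f * cnj f1 * (P * cnj \<Phi> + \<Phi> * cnj Q)) \<ge> - (b * a * (q + p))"
    using 1 by (simp only: cnj.simps)
  have 3: "Re (- \<omega> * (f * g1 * cnj P)) \<ge> - (a * norm g1 * p)"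
    using low[of "- \<omega> * (f * g1 * cnj P)"] \<omega> by (simp add: norm_mult a_def p_def)
  have 4: "Re (f1 * cnj f1 * (3 + \<Phi> * cnj \<Phi>)) \<ge> 3 * b\<^sup>2"
    unfolding sq by (simp add: b_def algebra_simps del: of_real_power)
  have 5: "Re (f * cnj f * (P * cnj P + Q * cnj Q)) = a\<^sup>2 * (p\<^sup>2 + q\<^sup>2)"
    unfolding sq of_real_add[symmetric] of_real_mult[symmetric] by (simp only: Re_complex_of_real a_def p_def q_def)
  have 6: "Re (1/2 * (g1 * cnj g1)) = 1/2 * (norm g1)\<^sup>2"
    unfolding sq by (simp del: of_real_power)
  \<comment> \<open>The weight 3 of b^2 splits as 2 + 1 to absorb the cross terms with p and with q.
    Of a^2 p^2, one half goes with \<open>g1\<close> and one half with b; a^2 q^2 is used up by the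
    last square.\<close>
  have "0 \<le> 1/2 * (norm g1 - a * p)\<^sup>2 + 2 * (b - a * p / 2)\<^sup>2 + (b - a * q)\<^sup>2"
    by simp
  also have "\<dots> = 1/2 * (norm g1)\<^sup>2 + 3 * b\<^sup>2 - 2 * (b * a * (q + p)) + a\<^sup>2 * (p\<^sup>2 + q\<^sup>2) - a * norm g1 * p"
    by (simp add: power2_eq_square field_simps)
  finally show ?thesis
    using 1 2 3 4 5 6 by (simp only: plus_complex.simps)
qed

text \<open>The zero in the last slot of the jet of \<open>\<Phi>\<close> is its harmonicity: it
  keeps second derivatives of \<open>\<Phi>\<close>, which nothing here would dominate, out of the
  Laplacian.\<close>

lemma skew_duality:
  assumes "finite A" and A: "\<And>n. n \<in> A \<Longrightarrow> n > 0"
    and \<Phi>: "jet \<Phi> P Q (\<lambda>u x. 0)" and \<Phi>1: "\<And>u x. u \<ge> 0 \<Longrightarrow> x \<in> characters \<Longrightarrow> norm (\<Phi> u x) \<le> 1"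
    and \<omega>: "norm \<omega> = 1"
  shows "Re (\<omega> * mean (\<lambda>u x. skew_poly A f g u x * cnj (\<Phi> u x)) 0) \<le>
    1/2 * (\<Sum>n\<in>A. (norm (g n))\<^sup>2) + 4 * (\<Sum>n\<in>A. (norm (f n))\<^sup>2)"
proof -
  define f0 f1 g0 g1 F where "f0 = dpoly A f" and "f1 = dpoly A (\<lambda>n. - of_real (ln (real n)) * f n)"
    and "g0 = dpoly A g" and "g1 = dpoly A (\<lambda>n. - of_real (ln (real n)) * g n)" and "F = skew_poly A f g"
  have jf: "jet f0 f1 (\<lambda>u x. 0) (\<lambda>u x. 0)" and jg: "jet g0 g1 (\<lambda>u x. 0) (\<lambda>u x. 0)"
    unfolding f0_def f1_def g0_def g1_def by (intro jet_dpoly A; assumption)+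
  have jF: "jet F (\<lambda>u x. f0 u x * g1 u x) (\<lambda>u x. 0) (\<lambda>u x. 0)"
    unfolding F_def f0_def g1_def by (intro jet_skew_poly A)
  note jF\<Phi> = jet_mult[OF jF jet_cnj[OF \<Phi>]]
  note jgg = jet_mult[OF jg jet_cnj[OF jg]]
  note jff = jet_mult[OF jf jet_cnj[OF jf]]
  note j\<Phi>\<Phi> = jet_mult[OF \<Phi> jet_cnj[OF \<Phi>]]
  note jW = jet_mult[OF jff jet.add[OF jet_const[of 3] j\<Phi>\<Phi>]]
  define G where "G u x = 1/2 * (g0 u x * cnj (g0 u x)) + f0 u x * cnj (f0 u x) * (3 + \<Phi> u x * cnj (\<Phi> u x))
    + - \<omega> * (F u x * cnj (\<Phi> u x))" for u x
  \<comment> \<open>A quarter of the Laplacian of \<open>G\<close>, arranged in the shape of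
    \<open>skew_laplacian_nonneg\<close>.\<close>
  define R where "R u x = 1/2 * (g1 u x * cnj (g1 u x)) + (f1 u x * cnj (f1 u x) * (3 + \<Phi> u x * cnj (\<Phi> u x))
    + f1 u x * cnj (f0 u x) * (Q u x * cnj (\<Phi> u x) + \<Phi> u x * cnj (P u x))
    + f0 u x * cnj (f1 u x) * (P u x * cnj (\<Phi> u x) + \<Phi> u x * cnj (Q u x))
    + f0 u x * cnj (f0 u x) * (P u x * cnj (P u x) + Q u x * cnj (Q u x)))
    + - \<omega> * (f0 u x * g1 u x * cnj (P u x))" for u x
  obtain G1 G2 where jG: "jet G G1 G2 R"
  proof -
    note j = jet.add[OF jet.add[OF jet_scale[OF jgg, of "1/2"] jW] jet_scale[OF jF\<Phi>, of "- \<omega>"]]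
    show thesis
      by (rule that, rule jet.cong[OF j]) (auto simp: G_def R_def add_ac)
  qed
  have Rpos: "Re (R u x) \<ge> 0" if "u \<ge> 0" "x \<in> characters" for u x
    unfolding R_def by (intro skew_laplacian_nonneg \<Phi>1 \<omega> that)
  have ReG_le: "Re (mean G u) \<le> Re (mean G 0)" if "u \<ge> 0" for u
  proof -
    obtain D where D: "\<And>u. (mean G has_vector_derivative D u) (at u)"
      "\<And>u. (D has_vector_derivative 4 * mean R u) (at u)"
      using mean_second_derivative[OF jG] by blast
    obtain K where K: "\<And>u x. u \<ge> 0 \<Longrightarrow> x \<in> characters \<Longrightarrow> norm (G u x) \<le> K"
      using jet_bounded[OF jG] by blast
    show ?thesis
    proof (rule bounded_convex_le_at_0[where K = K])
      show "((\<lambda>u. Re (mean G u)) has_real_derivative Re (D u)) (at u)" for u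
        using bounded_linear.has_vector_derivative[OF bounded_linear_Re D(1)] by (simp add: has_real_derivative_iff_has_vector_derivative)
      show "((\<lambda>u. Re (D u)) has_real_derivative Re (4 * mean R u)) (at u)" for u
        using bounded_linear.has_vector_derivative[OF bounded_linear_Re D(2)] by (simp add: has_real_derivative_iff_has_vector_derivative)
      show "Re (4 * mean R u) \<ge> 0" if "u \<ge> 0" for u
      proof -
        obtain a b c where "jet R a b c"
          using jet_derivatives[OF jG] by blast
        then have "Re (mean (\<lambda>u x. 0) u) \<le> Re (mean R u)"
          using that by (intro Re_mean_mono[OF jet_const]) (auto intro: Rpos)
        then show ?thesis
          by (simp add: mean_const)
      qed
      show "\<bar>Re (mean G u)\<bar> \<le> K" if "u \<ge> 0" for u
      proof -
        have "norm (mean G u) \<le> (LINT z|torus_measure. norm (G u (character z)))"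
          unfolding mean_def by (rule integral_norm_bound)
        also have "\<dots> \<le> (LINT z|torus_measure. K)"
          using jet_integrable[OF jG] that
          by (intro integral_mono integrable_norm) (auto intro: K character_in_characters)
        also have "\<dots> = K"
          by (simp add: torus_measure.prob_space)
        finally show ?thesis
          using abs_Re_le_cmod[of "mean G u"] by linarith
      qed
    qed fact
  qed
  obtain C where C: "\<And>u x. u \<ge> 0 \<Longrightarrow> x \<in> characters \<Longrightarrow> norm (F u x) \<le> C * exp (- ln 2 * u)"
    unfolding F_def using skew_poly_decay[OF A] by blast
  \<comment> \<open>No limit of \<open>mean G u\<close> is computed: the two square terms are
    nonnegative, so only F can make the mean negative, and F decays. Letting u grow gives
    \<open>0 \<le> Re (mean G 0)\<close>.\<close>
  have "- (C * exp (- ln 2 * u)) \<le> Re (mean G 0)" if "u \<ge> 0" for u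
  proof -
    have "- (C * exp (- ln 2 * u)) = Re (mean (\<lambda>u' x. of_real (- (C * exp (- ln 2 * u)))) u)"
      by (simp only: mean_const Re_complex_of_real)
    also have "\<dots> \<le> Re (mean G u)"
    proof (rule Re_mean_mono[OF jet_const jG])
      fix x
      assume x: "x \<in> characters"
      have sq: "w * cnj w = of_real ((norm w)\<^sup>2)" for w :: complex
        by (rule complex_norm_square[symmetric])
      have "norm (- \<omega> * (F u x * cnj (\<Phi> u x))) = norm (F u x) * norm (\<Phi> u x)"
        using \<omega> by (simp add: norm_mult)
      also have "\<dots> \<le> norm (F u x)"
        using \<Phi>1[OF that x] by (simp add: mult_left_le)
      also have "\<dots> \<le> C * exp (- ln 2 * u)"
        by (rule C[OF that x])
      finally have "- (C * exp (- ln 2 * u)) \<le> Re (- \<omega> * (F u x * cnj (\<Phi> u x)))"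
        using abs_Re_le_cmod[of "- \<omega> * (F u x * cnj (\<Phi> u x))"] by linarith
      moreover have "0 \<le> Re (1/2 * (g0 u x * cnj (g0 u x)))"
        unfolding sq by (simp del: of_real_power)
      moreover have "0 \<le> Re (f0 u x * cnj (f0 u x) * (3 + \<Phi> u x * cnj (\<Phi> u x)))"
        unfolding sq by (simp del: of_real_power)
      ultimately show "Re (of_real (- (C * exp (- ln 2 * u)))) \<le> Re (G u x)"
        unfolding G_def by (simp only: plus_complex.simps Re_complex_of_real)
    qed
    also have "\<dots> \<le> Re (mean G 0)"
      by (rule ReG_le[OF that])
    finally show ?thesis .
  qed
  then have "\<forall>\<^sub>F u in at_top. - (C * exp (- ln 2 * u)) \<le> Re (mean G 0)"
    by (intro eventually_mono[OF eventually_ge_at_top[of 0]]) auto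
  moreover have "((\<lambda>u. - (C * exp (- ln 2 * u))) \<longlongrightarrow> - (C * 0)) at_top"
    by (intro tendsto_intros filterlim_compose[OF exp_at_bot] filterlim_tendsto_neg_mult_at_bot[OF tendsto_const _ filterlim_ident]) simp
  ultimately have "0 \<le> Re (mean G 0)"
    using tendsto_upperbound[of _ _ at_top] by fastforce
  also have "\<dots> \<le> Re (mean (\<lambda>u x. 1/2 * (g0 u x * cnj (g0 u x)) + 4 * (f0 u x * cnj (f0 u x)) + - \<omega> * (F u x * cnj (\<Phi> u x))) 0)"
  proof (rule Re_mean_mono[OF jG jet.add[OF jet.add[OF jet_scale[OF jgg] jet_scale[OF jff]] jet_scale[OF jF\<Phi>]]])
    fix x
    assume x: "x \<in> characters"
    have sq: "w * cnj w = of_real ((norm w)\<^sup>2)" for w :: complex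
      by (rule complex_norm_square[symmetric])
    \<comment> \<open>On the boundary 3 + |\<open>\<Phi>\<close>|^2 is at most 4, the origin of the
      4 in the conclusion.\<close>
    have "(norm (f0 0 x))\<^sup>2 * (3 + (norm (\<Phi> 0 x))\<^sup>2) \<le> (norm (f0 0 x))\<^sup>2 * 4"
      using \<Phi>1[of 0 x] x by (intro mult_left_mono) (auto simp: abs_square_le_1)
    then have "Re (f0 0 x * cnj (f0 0 x) * (3 + \<Phi> 0 x * cnj (\<Phi> 0 x))) \<le> Re (4 * (f0 0 x * cnj (f0 0 x)))"
      unfolding sq by (simp del: of_real_power)
    then show "Re (G 0 x) \<le> Re (1/2 * (g0 0 x * cnj (g0 0 x)) + 4 * (f0 0 x * cnj (f0 0 x)) + - \<omega> * (F 0 x * cnj (\<Phi> 0 x)))"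
      unfolding G_def by (simp only: plus_complex.simps)
  qed
  also have "mean (\<lambda>u x. 1/2 * (g0 u x * cnj (g0 u x)) + 4 * (f0 u x * cnj (f0 u x)) + - \<omega> * (F u x * cnj (\<Phi> u x))) 0
     = 1/2 * mean (\<lambda>u x. g0 u x * cnj (g0 u x)) 0 + 4 * mean (\<lambda>u x. f0 u x * cnj (f0 u x)) 0
       + - \<omega> * mean (\<lambda>u x. F u x * cnj (\<Phi> u x)) 0"
    by (simp only: mean_add[OF jet.add[OF jet_scale[OF jgg] jet_scale[OF jff]] jet_scale[OF jF\<Phi>]]
        mean_add[OF jet_scale[OF jgg] jet_scale[OF jff]] mean_scale)
  also have "\<dots> = 1/2 * of_real (\<Sum>n\<in>A. (norm (g n))\<^sup>2) + 4 * of_real (\<Sum>n\<in>A. (norm (f n))\<^sup>2)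
       + - \<omega> * mean (\<lambda>u x. F u x * cnj (\<Phi> u x)) 0"
    unfolding f0_def g0_def by (simp only: mean_dpoly_square[OF assms(1) A])
  finally show ?thesis
    by (simp add: F_def del: of_real_sum)
qed

section \<open>Approximate sign functions and the L1 estimate for Dirichlet polynomials\<close>

lemma continuous_on_regularised_inverse_sqrt:
  "\<epsilon> > 0 \<Longrightarrow> continuous_on {0..1} (\<lambda>y::real. 1 / (sqrt y + \<epsilon>))"
  by (intro continuous_intros) (auto simp: add_nonneg_eq_0_iff)

text \<open>A polynomial in \<open>|F|\<^sup>2\<close> close to \<open>1 / |F|\<close> turns \<open>F\<close> into a wave combination almost norming \<open>F\<close>.\<close>

lemma inverse_sqrt_approximation:
  fixes \<epsilon> :: real
  assumes "\<epsilon> > 0"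
  obtains n and a :: "nat \<Rightarrow> real"
  where "\<And>s. 0 \<le> s \<Longrightarrow> s \<le> 1 \<Longrightarrow> s * \<bar>\<Sum>k\<le>n. a k * (s\<^sup>2) ^ k * (1 - s\<^sup>2) ^ (n - k)\<bar> \<le> 1 + \<epsilon>"
    and "\<And>s. 0 \<le> s \<Longrightarrow> s \<le> 1 \<Longrightarrow> s - 2 * \<epsilon> \<le> s\<^sup>2 * (\<Sum>k\<le>n. a k * (s\<^sup>2) ^ k * (1 - s\<^sup>2) ^ (n - k))"
proof -
  \<comment> \<open>Since 1 / sqrt y is unbounded at 0, its regularisation is approximated.
    Regularising and approximating each cost at most \<open>\<epsilon>\<close> in the lower bound,
    hence the 2 \<open>\<epsilon>\<close>. Below, y is s^2.\<close>
  obtain N where N: "\<And>n y. N \<le> n \<Longrightarrow> y \<in> {0..1} \<Longrightarrow>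
      \<bar>1 / (sqrt y + \<epsilon>) - (\<Sum>k\<le>n. (1 / (sqrt (k / n) + \<epsilon>)) * Bernstein n k y)\<bar> < \<epsilon>"
    using Bernstein_Weierstrass[OF continuous_on_regularised_inverse_sqrt[OF assms] assms] by blast
  define p where "p s = (\<Sum>k\<le>N. (1 / (sqrt (k / N) + \<epsilon>) * (N choose k)) * (s\<^sup>2) ^ k * (1 - s\<^sup>2) ^ (N - k))" for s
  have p: "\<bar>1 / (s + \<epsilon>) - p s\<bar> < \<epsilon>" if "0 \<le> s" "s \<le> 1" for s
    using N[of N "s\<^sup>2"] that by (simp add: p_def Bernstein_def mult.assoc abs_square_le_1)
  show thesis
  proof (rule that[of "\<lambda>k. 1 / (sqrt (k / N) + \<epsilon>) * (N choose k)" N, folded p_def])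
    fix s :: real
    assume s: "0 \<le> s" "s \<le> 1"
    have "\<bar>p s\<bar> \<le> 1 / (s + \<epsilon>) + \<epsilon>"
      using p[OF s] s assms by (simp add: abs_le_iff abs_less_iff) (smt (verit) divide_nonneg_pos)
    then have "s * \<bar>p s\<bar> \<le> s * (1 / (s + \<epsilon>)) + s * \<epsilon>"
      using mult_left_mono[of "\<bar>p s\<bar>" "1 / (s + \<epsilon>) + \<epsilon>" s] s by (simp add: distrib_left)
    also have "s * (1 / (s + \<epsilon>)) \<le> 1"
      using s assms by simp
    also have "s * \<epsilon> \<le> \<epsilon>"
      using s assms by (simp add: mult_left_le_one_le)
    finally show "s * \<bar>p s\<bar> \<le> 1 + \<epsilon>"
      by simp
    have "s - \<epsilon> \<le> s\<^sup>2 * (1 / (s + \<epsilon>))"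
    proof -
      have "(s - \<epsilon>) * (s + \<epsilon>) \<le> s\<^sup>2"
        by (simp add: algebra_simps power2_eq_square)
      then show ?thesis
        using s assms by (simp add: pos_le_divide_eq)
    qed
    moreover have "s\<^sup>2 * (1 / (s + \<epsilon>) - p s) \<le> s\<^sup>2 * \<epsilon>"
      using p[OF s] by (intro mult_left_mono) auto
    moreover have "s\<^sup>2 * \<epsilon> \<le> 1 * \<epsilon>"
      using s assms by (intro mult_right_mono) (auto simp: abs_square_le_1)
    ultimately show "s - 2 * \<epsilon> \<le> s\<^sup>2 * p s"
      by (simp add: algebra_simps)
  qed
qed

text \<open>Lets a polynomial in F and its conjugate be recognised as a wave combination without
  writing out its derivatives.\<close>

definition wave_sum :: "field \<Rightarrow> bool" where
  "wave_sum h \<longleftrightarrow> (\<exists>p q r. jet h p q r)"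

lemma wave_sum_const: "wave_sum (\<lambda>u x. c)"
  unfolding wave_sum_def by (blast intro: jet_const)

lemma wave_sum_add: "wave_sum h \<Longrightarrow> wave_sum h' \<Longrightarrow> wave_sum (\<lambda>u x. h u x + h' u x)"
  unfolding wave_sum_def by (blast intro: jet.add)

lemma wave_sum_mult: "wave_sum h \<Longrightarrow> wave_sum h' \<Longrightarrow> wave_sum (\<lambda>u x. h u x * h' u x)"
  unfolding wave_sum_def by (blast intro: jet_mult)

lemma wave_sum_cnj: "wave_sum h \<Longrightarrow> wave_sum (\<lambda>u x. cnj (h u x))"
  unfolding wave_sum_def by (blast intro: jet_cnj)

lemma wave_sum_power: "wave_sum h \<Longrightarrow> wave_sum (\<lambda>u x. h u x ^ n)"
  by (induction n) (auto intro: wave_sum_const wave_sum_mult)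

lemma wave_sum_sum: "(\<And>i. i \<in> I \<Longrightarrow> wave_sum (h i)) \<Longrightarrow> wave_sum (\<lambda>u x. \<Sum>i\<in>I. h i u x)"
  by (induction I rule: infinite_finite_induct) (auto intro: wave_sum_const wave_sum_add)

lemmas wave_sum_intros = wave_sum_const wave_sum_add wave_sum_mult wave_sum_cnj wave_sum_power wave_sum_sum

text \<open>The ideal test function F / |F| is not a wave combination. The approximation
  \<open>h\<close> is one, at the price of an error of order \<open>\<epsilon>\<close> that
  disappears at the end.\<close>

lemma skew_poly_L1_additive:
  assumes "finite A" and A: "\<And>n. n \<in> A \<Longrightarrow> n > 0"
  shows "(LINT z|torus_measure. norm (skew_poly A f g 0 (character z))) \<le>
    1/2 * (\<Sum>n\<in>A. (norm (g n))\<^sup>2) + 4 * (\<Sum>n\<in>A. (norm (f n))\<^sup>2)" (is "?I \<le> ?C")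
proof -
  let ?F = "skew_poly A f g"
  note jF = jet_skew_poly[OF A, of A f g]
  obtain L where L: "L > 0" "\<And>x. x \<in> characters \<Longrightarrow> norm (?F 0 x) \<le> L"
  proof -
    obtain K where "\<And>x. x \<in> characters \<Longrightarrow> norm (?F 0 x) \<le> K"
      using jet_bounded[OF jF] by (metis order.refl)
    then show thesis
      by (intro that[of "max 1 K"]) (auto simp: le_max_iff_disj)
  qed
  have bound: "?I - 2 * \<epsilon> * L \<le> (1 + \<epsilon>) * ?C" if "\<epsilon> > 0" for \<epsilon>
  proof -
    obtain n a where
      a1: "\<And>s. 0 \<le> s \<Longrightarrow> s \<le> 1 \<Longrightarrow> s * \<bar>\<Sum>k\<le>n. a k * (s\<^sup>2) ^ k * (1 - s\<^sup>2) ^ (n - k)\<bar> \<le> 1 + \<epsilon>" and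
      a2: "\<And>s. 0 \<le> s \<Longrightarrow> s \<le> 1 \<Longrightarrow> s - 2 * \<epsilon> \<le> s\<^sup>2 * (\<Sum>k\<le>n. a k * (s\<^sup>2) ^ k * (1 - s\<^sup>2) ^ (n - k))"
      by (rule inverse_sqrt_approximation[OF \<open>\<epsilon> > 0\<close>]) blast
    define p where "p s = (\<Sum>k\<le>n. a k * (s\<^sup>2) ^ k * (1 - s\<^sup>2) ^ (n - k))" for s :: real
    define Y where "Y u x = ?F u x * cnj (?F u x) * of_real (1 / L\<^sup>2)" for u x
    \<comment> \<open>Division by \<open>L\<close> brings |F| into [0, 1], where the Bernstein
      approximation is valid; division by 1 + \<open>\<epsilon>\<close> makes |h| at most 1 at u =
      0.\<close>
    define h where "h u x = of_real (1 / (L * (1 + \<epsilon>))) * (?F u x *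
      (\<Sum>k\<le>n. of_real (a k) * Y u x ^ k * (1 + - 1 * Y u x) ^ (n - k)))" for u x
    have "wave_sum ?F"
      using jF unfolding wave_sum_def by blast
    then have "wave_sum h"
      unfolding h_def[abs_def] Y_def[abs_def] by (intro wave_sum_intros)
    then obtain P0 Q0 R0 where jh: "jet h P0 Q0 R0"
      unfolding wave_sum_def by blast
    have h0: "h 0 x = ?F 0 x * of_real (p (norm (?F 0 x) / L) / (L * (1 + \<epsilon>)))" for x
    proof -
      have Y: "Y 0 x = of_real ((norm (?F 0 x) / L)\<^sup>2)"
        unfolding Y_def complex_norm_square[symmetric] of_real_mult[symmetric] by (simp add: power_divide)
      show ?thesis
        unfolding h_def Y p_def by simp
    qed
    have h1: "norm (h 0 x) \<le> 1" if x: "x \<in> characters" for x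
    proof -
      define s where "s = norm (?F 0 x) / L"
      have s: "0 \<le> s" "s \<le> 1"
        using L x by (auto simp: s_def)
      have "norm (h 0 x) = s * \<bar>p s\<bar> / (1 + \<epsilon>)"
        unfolding h0 s_def[symmetric] norm_mult norm_of_real
        using L \<open>\<epsilon> > 0\<close> by (simp add: s_def abs_mult)
      also have "\<dots> \<le> 1"
        using a1[OF s] \<open>\<epsilon> > 0\<close> by (simp add: p_def)
      finally show ?thesis .
    qed
    \<comment> \<open>A product of waves need not be harmonic, so only the boundary values of
      \<open>h\<close> are kept and extended anew.\<close>
    obtain \<Phi> P Q where \<Phi>: "jet \<Phi> P Q (\<lambda>u x. 0)" "\<And>x. x \<in> characters \<Longrightarrow> \<Phi> 0 x = h 0 x"
      "\<And>u x. u \<ge> 0 \<Longrightarrow> x \<in> characters \<Longrightarrow> norm (\<Phi> u x) \<le> 1"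
      using harmonic_extension[OF jh h1] by blast
    note j = jet_mult[OF jF jet_cnj[OF \<Phi>(1)]]
    have "(?I - 2 * \<epsilon> * L) / (1 + \<epsilon>) = (LINT z|torus_measure. (norm (?F 0 (character z)) - 2 * \<epsilon> * L) / (1 + \<epsilon>))"
      using jet_integrable[OF jF] by (simp add: torus_measure.prob_space)
    also have "\<dots> \<le> (LINT z|torus_measure. Re (?F 0 (character z) * cnj (\<Phi> 0 (character z))))"
    proof (rule integral_mono)
      show "integrable torus_measure (\<lambda>z. (norm (?F 0 (character z)) - 2 * \<epsilon> * L) / (1 + \<epsilon>))"
        using jet_integrable[OF jF] by simp
      show "integrable torus_measure (\<lambda>z. Re (?F 0 (character z) * cnj (\<Phi> 0 (character z))))"
        by (intro integrable_Re jet_integrable[OF j])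
      fix z
      assume "z \<in> space torus_measure"
      then have x: "character z \<in> characters"
        by (rule character_in_characters)
      define s where "s = norm (?F 0 (character z)) / L"
      have s: "0 \<le> s" "s \<le> 1"
        using L x by (auto simp: s_def)
      have F: "norm (?F 0 (character z)) = L * s"
        using L by (simp add: s_def)
      have "?F 0 (character z) * cnj (\<Phi> 0 (character z)) = of_real (L\<^sup>2 * s\<^sup>2 * (p s / (L * (1 + \<epsilon>))))"
        unfolding \<Phi>(2)[OF x] h0
        unfolding s_def[symmetric] complex_cnj_mult complex_cnj_complex_of_real mult.assoc[symmetric]
          complex_norm_square[symmetric]
        unfolding F of_real_mult[symmetric] power_mult_distrib ..
      also have "L\<^sup>2 * s\<^sup>2 * (p s / (L * (1 + \<epsilon>))) = L * (s\<^sup>2 * p s) / (1 + \<epsilon>)"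
        using L by (simp add: power2_eq_square)
      finally have "Re (?F 0 (character z) * cnj (\<Phi> 0 (character z))) = L * (s\<^sup>2 * p s) / (1 + \<epsilon>)"
        by (simp only: Re_complex_of_real)
      moreover have "L * (s - 2 * \<epsilon>) \<le> L * (s\<^sup>2 * p s)"
        using a2[OF s] L by (intro mult_left_mono) (auto simp: p_def)
      ultimately show "(norm (?F 0 (character z)) - 2 * \<epsilon> * L) / (1 + \<epsilon>) \<le> Re (?F 0 (character z) * cnj (\<Phi> 0 (character z)))"
        using \<open>\<epsilon> > 0\<close> unfolding F by (simp only: divide_right_mono right_diff_distrib mult_ac)
    qed
    also have "\<dots> = Re (1 * mean (\<lambda>u x. ?F u x * cnj (\<Phi> u x)) 0)"
      unfolding mean_def mult_1 by (rule integral_Re[OF jet_integrable[OF j]])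
    also have "\<dots> \<le> ?C"
      by (rule skew_duality[OF assms \<Phi>(1,3)]) auto
    finally show ?thesis
      using \<open>\<epsilon> > 0\<close> by (simp add: pos_divide_le_eq mult.commute)
  qed
  have "((\<lambda>\<epsilon>. ?I - 2 * \<epsilon> * L - (1 + \<epsilon>) * ?C) \<longlongrightarrow> ?I - 2 * 0 * L - (1 + 0) * ?C) (at_right 0)"
    by (intro tendsto_intros)
  then have "?I - 2 * 0 * L - (1 + 0) * ?C \<le> 0"
    by (rule tendsto_upperbound) (use bound in \<open>auto simp: eventually_at_filter\<close>)
  then show ?thesis
    by simp
qed

lemma skew_poly_scale: "skew_poly A (\<lambda>n. a * f n) (\<lambda>n. b * g n) u x = a * b * skew_poly A f g u x"
  by (simp add: skew_poly_def sum_distrib_left mult_ac)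

text \<open>By homogeneity f and g may be scaled to norm 1, and the additive bound becomes 1/2 + 4,
  rounded up to 5. If one norm is 0, the polynomial vanishes.\<close>

lemma skew_poly_L1:
  assumes "finite A" and A: "\<And>n. n \<in> A \<Longrightarrow> n > 0"
  shows "(LINT z|torus_measure. norm (skew_poly A f g 0 (character z))) \<le>
    5 * sqrt (\<Sum>n\<in>A. (norm (f n))\<^sup>2) * sqrt (\<Sum>n\<in>A. (norm (g n))\<^sup>2)"
proof -
  define a b where "a = sqrt (\<Sum>n\<in>A. (norm (f n))\<^sup>2)" and "b = sqrt (\<Sum>n\<in>A. (norm (g n))\<^sup>2)"
  have ab: "a \<ge> 0" "b \<ge> 0"
    by (simp_all add: a_def b_def sum_nonneg)
  show ?thesis
  proof (cases "a = 0 \<or> b = 0")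
    case True
    then have "(\<forall>n\<in>A. f n = 0) \<or> (\<forall>n\<in>A. g n = 0)"
      using \<open>finite A\<close> by (auto simp: a_def b_def sum_nonneg_eq_0_iff)
    then have "skew_poly A f g = (\<lambda>u x. 0)"
      by (auto simp: skew_poly_def fun_eq_iff intro!: sum.neutral)
    then show ?thesis
      by (simp add: sum_nonneg)
  next
    case False
    with ab have pos: "a > 0" "b > 0"
      by auto
    have sq: "(\<Sum>n\<in>A. (norm (f n))\<^sup>2) = a\<^sup>2" "(\<Sum>n\<in>A. (norm (g n))\<^sup>2) = b\<^sup>2"
      by (simp_all add: a_def b_def sum_nonneg)
    have "(LINT z|torus_measure. norm (skew_poly A (\<lambda>n. of_real (1 / a) * f n) (\<lambda>n. of_real (1 / b) * g n) 0 (character z)))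
        \<le> 1/2 * (\<Sum>n\<in>A. (norm (of_real (1 / b) * g n))\<^sup>2) + 4 * (\<Sum>n\<in>A. (norm (of_real (1 / a) * f n))\<^sup>2)"
      by (rule skew_poly_L1_additive[OF assms])
    also have "(\<Sum>n\<in>A. (norm (of_real (1 / b) * g n))\<^sup>2) = 1"
      using pos by (simp add: norm_mult norm_divide power_divide sum_divide_distrib[symmetric] sq)
    also have "(\<Sum>n\<in>A. (norm (of_real (1 / a) * f n))\<^sup>2) = 1"
      using pos by (simp add: norm_mult norm_divide power_divide sum_divide_distrib[symmetric] sq)
    also have "(LINT z|torus_measure. norm (skew_poly A (\<lambda>n. of_real (1 / a) * f n) (\<lambda>n. of_real (1 / b) * g n) 0 (character z)))
        = (LINT z|torus_measure. norm (skew_poly A f g 0 (character z))) / (a * b)"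
      unfolding skew_poly_scale using pos by (simp add: norm_mult norm_divide)
    finally have "(LINT z|torus_measure. norm (skew_poly A f g 0 (character z))) / (a * b) \<le> 1/2 * 1 + 4 * 1" .
    also have "\<dots> \<le> (5::real)"
      by simp
    finally show ?thesis
      using pos by (simp add: pos_divide_le_eq mult.assoc a_def[symmetric] b_def[symmetric])
  qed
qed

section \<open>Dirichlet series represented on the torus\<close>

text \<open>A quantitative form of membership in \<open>H1\<close>, ignoring the coefficient at 0:
  the L1 bound travels with the series, so that infinite sums can be controlled.\<close>

definition lifts :: "dirichlet \<Rightarrow> real \<Rightarrow> bool" where
  "lifts a K \<longleftrightarrow> (\<exists>\<phi>\<in>H1_torus. bohr_lift a \<phi> \<and> (LINT z|torus_measure. norm (\<phi> z)) \<le> K)"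

lemma lifts_mono: "lifts a K \<Longrightarrow> K \<le> L \<Longrightarrow> lifts a L"
  unfolding lifts_def by force

lemma lifts_cong: "lifts a K \<Longrightarrow> (\<And>n. n \<ge> 1 \<Longrightarrow> b n = a n) \<Longrightarrow> lifts b K"
  unfolding lifts_def bohr_lift_def by auto

lemma bohr_lift_iff:
  "bohr_lift a \<phi> \<longleftrightarrow> (\<forall>n\<ge>1. a n = (LINT z|torus_measure. \<phi> z * cnj (character z n)))"
  by (simp add: bohr_lift_def character_def)

lemma integrable_mult_cnj_character:
  assumes "integrable torus_measure \<phi>"
  shows "integrable torus_measure (\<lambda>z. \<phi> z * cnj (character z n))"
proof (rule Bochner_Integration.integrable_bound[OF assms])
  show "(\<lambda>z. \<phi> z * cnj (character z n)) \<in> borel_measurable torus_measure"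
    using assms by measurable
  show "AE z in torus_measure. norm (\<phi> z * cnj (character z n)) \<le> norm (\<phi> z)"
    by (intro AE_I2) (simp add: norm_mult norm_character)
qed

lemma analytic_polynomials_zero: "(\<lambda>z. 0) \<in> analytic_polynomials"
  unfolding analytic_polynomials_def by (auto intro!: exI[of _ "{}"])

lemma analytic_polynomials_character: "(\<lambda>z. c * character z n) \<in> analytic_polynomials"
proof -
  have "finite {j. kappa n j \<noteq> 0}"
  proof (rule finite_subset[of _ "{..<n}"])
    show "{j. kappa n j \<noteq> 0} \<subseteq> {..<n}"
      using kappa_eq_0[of n] by (auto simp: not_less[symmetric] intro: ccontr)
  qed simp
  then show ?thesis
    unfolding analytic_polynomials_def character_def
    by (auto intro!: exI[of _ "{kappa n}"] exI[of _ "\<lambda>_. c"])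
qed

lemma analytic_polynomials_add:
  assumes "P \<in> analytic_polynomials" "Q \<in> analytic_polynomials"
  shows "(\<lambda>z. P z + Q z) \<in> analytic_polynomials"
proof -
  obtain A c where A: "finite A" "\<forall>\<alpha>\<in>A. finite {j. \<alpha> j \<noteq> 0}" and P: "P = (\<lambda>z. \<Sum>\<alpha>\<in>A. c \<alpha> * monomial \<alpha> z)"
    using assms(1) unfolding analytic_polynomials_def by blast
  obtain B d where B: "finite B" "\<forall>\<alpha>\<in>B. finite {j. \<alpha> j \<noteq> 0}" and Q: "Q = (\<lambda>z. \<Sum>\<alpha>\<in>B. d \<alpha> * monomial \<alpha> z)"
    using assms(2) unfolding analytic_polynomials_def by blast
  have "P z + Q z = (\<Sum>\<alpha>\<in>A \<union> B. ((if \<alpha> \<in> A then c \<alpha> else 0) + (if \<alpha> \<in> B then d \<alpha> else 0)) * monomial \<alpha> z)" for z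
  proof -
    have "P z = (\<Sum>\<alpha>\<in>A \<union> B. (if \<alpha> \<in> A then c \<alpha> else 0) * monomial \<alpha> z)"
      unfolding P using A B by (intro sum.mono_neutral_cong_left) auto
    moreover have "Q z = (\<Sum>\<alpha>\<in>A \<union> B. (if \<alpha> \<in> B then d \<alpha> else 0) * monomial \<alpha> z)"
      unfolding Q using A B by (intro sum.mono_neutral_cong_left) auto
    ultimately show ?thesis
      by (simp only: sum.distrib distrib_right)
  qed
  then show ?thesis
    using A B unfolding analytic_polynomials_def
    by (intro CollectI exI[of _ "A \<union> B"] exI[of _ "\<lambda>\<alpha>. (if \<alpha> \<in> A then c \<alpha> else 0) + (if \<alpha> \<in> B then d \<alpha> else 0)"]) auto
qed

lemma analytic_polynomials_sum:
  "(\<And>i. i \<in> I \<Longrightarrow> P i \<in> analytic_polynomials) \<Longrightarrow> (\<lambda>z. \<Sum>i\<in>I. P i z) \<in> analytic_polynomials"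
  by (induction I rule: infinite_finite_induct) (auto intro: analytic_polynomials_zero analytic_polynomials_add)

lemma integrable_monomial: "integrable torus_measure (monomial \<alpha>)"
proof (rule torus_measure.integrable_const_bound[of _ 1])
  show "AE z in torus_measure. norm (monomial \<alpha> z) \<le> 1"
    by (intro AE_I2) (simp add: monomial_def prod_norm[symmetric] norm_power norm_torus_coordinate)
  show "monomial \<alpha> \<in> borel_measurable torus_measure"
    unfolding monomial_def[abs_def] by measurable
qed

lemma integrable_analytic_polynomial: "P \<in> analytic_polynomials \<Longrightarrow> integrable torus_measure P"
  unfolding analytic_polynomials_def by (auto intro!: Bochner_Integration.integrable_sum integrable_mult_right integrable_monomial)

lemma analytic_polynomial_in_H1_torus: "P \<in> analytic_polynomials \<Longrightarrow> P \<in> H1_torus"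
  unfolding H1_torus_def by (auto intro!: integrable_analytic_polynomial bexI[of _ P])

lemma integral_norm_triangle:
  fixes \<phi> \<psi> \<xi> :: "(nat \<Rightarrow> complex) \<Rightarrow> complex"
  assumes "integrable torus_measure \<phi>" "integrable torus_measure \<psi>" "integrable torus_measure \<xi>"
  shows "(LINT z|torus_measure. norm (\<phi> z - \<xi> z)) \<le>
    (LINT z|torus_measure. norm (\<phi> z - \<psi> z)) + (LINT z|torus_measure. norm (\<psi> z - \<xi> z))"
proof -
  have "(LINT z|torus_measure. norm (\<phi> z - \<xi> z)) \<le>
      (LINT z|torus_measure. norm (\<phi> z - \<psi> z) + norm (\<psi> z - \<xi> z))"
    using assms norm_triangle_ineq[of "\<phi> z - \<psi> z" "\<psi> z - \<xi> z" for z] by (intro integral_mono) auto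
  then show ?thesis
    using assms by simp
qed

lemma H1_torus_closed:
  assumes \<phi>: "integrable torus_measure \<phi>"
    and approx: "\<And>e. e > 0 \<Longrightarrow> \<exists>\<psi>\<in>H1_torus. (LINT z|torus_measure. norm (\<phi> z - \<psi> z)) < e"
  shows "\<phi> \<in> H1_torus"
  unfolding H1_torus_def
proof (intro CollectI conjI allI impI \<phi>)
  fix e :: real
  assume "e > 0"
  then obtain \<psi> where \<psi>: "\<psi> \<in> H1_torus" "(LINT z|torus_measure. norm (\<phi> z - \<psi> z)) < e / 2"
    using approx[of "e / 2"] by auto
  then obtain P where P: "P \<in> analytic_polynomials" "(LINT z|torus_measure. norm (\<psi> z - P z)) < e / 2"
    using \<open>e > 0\<close> unfolding H1_torus_def by (auto elim!: allE[of _ "e / 2"])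
  have "(LINT z|torus_measure. norm (\<phi> z - P z)) < e"
    using integral_norm_triangle[of \<phi> \<psi> P] \<phi> \<psi> P integrable_analytic_polynomial[OF P(1)] by (auto simp: H1_torus_def)
  with P show "\<exists>P\<in>analytic_polynomials. (LINT z|torus_measure. norm (\<phi> z - P z)) < e"
    by blast
qed

lemma H1_torus_add:
  assumes \<phi>: "\<phi> \<in> H1_torus" and \<psi>: "\<psi> \<in> H1_torus"
  shows "(\<lambda>z. \<phi> z + \<psi> z) \<in> H1_torus"
  unfolding H1_torus_def
proof (intro CollectI conjI allI impI)
  have int: "integrable torus_measure \<phi>" "integrable torus_measure \<psi>"
    using assms by (auto simp: H1_torus_def)
  then show "integrable torus_measure (\<lambda>z. \<phi> z + \<psi> z)"
    by simp
  fix e :: real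
  assume "e > 0"
  then have "e / 2 > 0"
    by simp
  obtain P where P: "P \<in> analytic_polynomials" "(LINT z|torus_measure. norm (\<phi> z - P z)) < e / 2"
    using \<phi> \<open>e / 2 > 0\<close> unfolding H1_torus_def by blast
  obtain Q where Q: "Q \<in> analytic_polynomials" "(LINT z|torus_measure. norm (\<psi> z - Q z)) < e / 2"
    using \<psi> \<open>e / 2 > 0\<close> unfolding H1_torus_def by blast
  note int = int integrable_analytic_polynomial[OF P(1)] integrable_analytic_polynomial[OF Q(1)]
  have "(LINT z|torus_measure. norm ((\<phi> z + \<psi> z) - (P z + Q z))) \<le>
      (LINT z|torus_measure. norm (\<phi> z - P z) + norm (\<psi> z - Q z))"
    using int by (intro integral_mono) (auto intro: norm_diff_triangle_ineq)
  also have "\<dots> < e"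
    using int P Q by simp
  finally show "\<exists>P\<in>analytic_polynomials. (LINT z|torus_measure. norm (\<phi> z + \<psi> z - P z)) < e"
    using analytic_polynomials_add[OF P(1) Q(1)] by (intro bexI[of _ "\<lambda>z. P z + Q z"])
qed

lemma H1_torus_sum:
  "(\<And>i. i \<in> I \<Longrightarrow> \<phi> i \<in> H1_torus) \<Longrightarrow> (\<lambda>z. \<Sum>i\<in>I. \<phi> i z) \<in> H1_torus"
  by (induction I rule: infinite_finite_induct)
     (auto intro: H1_torus_add analytic_polynomial_in_H1_torus[OF analytic_polynomials_zero])

lemma lifts_add:
  assumes "lifts a K" "lifts b L"
  shows "lifts (\<lambda>n. a n + b n) (K + L)"
proof -
  obtain \<phi> where \<phi>: "\<phi> \<in> H1_torus" "bohr_lift a \<phi>" "(LINT z|torus_measure. norm (\<phi> z)) \<le> K"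
    using assms(1) unfolding lifts_def by blast
  obtain \<psi> where \<psi>: "\<psi> \<in> H1_torus" "bohr_lift b \<psi>" "(LINT z|torus_measure. norm (\<psi> z)) \<le> L"
    using assms(2) unfolding lifts_def by blast
  have int: "integrable torus_measure \<phi>" "integrable torus_measure \<psi>"
    using \<phi> \<psi> by (auto simp: H1_torus_def)
  have "(LINT z|torus_measure. norm (\<phi> z + \<psi> z)) \<le> (LINT z|torus_measure. norm (\<phi> z) + norm (\<psi> z))"
    using int by (intro integral_mono) (auto intro: norm_triangle_ineq)
  also have "\<dots> \<le> K + L"
    using int \<phi>(3) \<psi>(3) by simp
  finally have "(LINT z|torus_measure. norm (\<phi> z + \<psi> z)) \<le> K + L" .
  moreover have "bohr_lift (\<lambda>n. a n + b n) (\<lambda>z. \<phi> z + \<psi> z)"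
    using \<phi>(2) \<psi>(2) int by (simp add: bohr_lift_iff distrib_right integrable_mult_cnj_character)
  ultimately show ?thesis
    using H1_torus_add[OF \<phi>(1) \<psi>(1)] unfolding lifts_def by blast
qed

text \<open>Indexed by terms and not by frequencies: \<open>k\<close> may repeat values, as the map
  from (d, e) to d e does.\<close>

lemma lifts_poly:
  assumes "finite I" and k: "\<And>i. i \<in> I \<Longrightarrow> k i > 0"
  shows "lifts (\<lambda>n. \<Sum>i\<in>I. if k i = n then c i else 0)
    (LINT z|torus_measure. norm (\<Sum>i\<in>I. c i * character z (k i)))"
  unfolding lifts_def
proof (intro bexI[of _ "\<lambda>z. \<Sum>i\<in>I. c i * character z (k i)"] conjI)
  show "(\<lambda>z. \<Sum>i\<in>I. c i * character z (k i)) \<in> H1_torus"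
    by (intro analytic_polynomial_in_H1_torus analytic_polynomials_sum analytic_polynomials_character)
  show "bohr_lift (\<lambda>n. \<Sum>i\<in>I. if k i = n then c i else 0) (\<lambda>z. \<Sum>i\<in>I. c i * character z (k i))"
    unfolding bohr_lift_iff
  proof (intro allI impI)
    fix n :: nat
    assume "n \<ge> 1"
    have int: "integrable torus_measure (\<lambda>z. character z m * cnj (character z n))" for m
      by (intro integrable_mult_cnj_character integrable_analytic_polynomial)
         (use analytic_polynomials_character[of 1] in simp)
    have "(LINT z|torus_measure. (\<Sum>i\<in>I. c i * character z (k i)) * cnj (character z n)) =
        (LINT z|torus_measure. (\<Sum>i\<in>I. c i * (character z (k i) * cnj (character z n))))"
      by (simp add: sum_distrib_right mult.assoc)
    also have "\<dots> = (\<Sum>i\<in>I. LINT z|torus_measure. c i * (character z (k i) * cnj (character z n)))"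
      by (intro Bochner_Integration.integral_sum integrable_mult_right int)
    also have "\<dots> = (\<Sum>i\<in>I. if k i = n then c i else 0)"
      using k \<open>n \<ge> 1\<close> by (intro sum.cong refl) (simp add: integral_character)
    finally show "(\<Sum>i\<in>I. if k i = n then c i else 0) =
        (LINT z|torus_measure. (\<Sum>i\<in>I. c i * character z (k i)) * cnj (character z n))" ..
  qed
qed simp

text \<open>Completeness of L1 in series form. The tail bound gives convergence in mean of the
  partial sums to the pointwise sum.\<close>

lemma L1_series:
  fixes \<phi> :: "nat \<Rightarrow> 'a \<Rightarrow> complex"
  assumes int: "\<And>k. integrable M (\<phi> k)" and summable: "summable (\<lambda>k. LINT z|M. norm (\<phi> k z))"
  shows "integrable M (\<lambda>z. \<Sum>k. \<phi> k z)"
    and "(LINT z|M. norm ((\<Sum>k. \<phi> k z) - (\<Sum>k<K. \<phi> k z))) \<le> (\<Sum>k. LINT z|M. norm (\<phi> (k + K) z))"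
proof -
  have "(\<integral>\<^sup>+z. (\<Sum>k. ennreal (norm (\<phi> k z))) \<partial>M) = (\<Sum>k. \<integral>\<^sup>+z. ennreal (norm (\<phi> k z)) \<partial>M)"
    using int by (intro nn_integral_suminf) auto
  also have "\<dots> = (\<Sum>k. ennreal (LINT z|M. norm (\<phi> k z)))"
    using int by (simp add: nn_integral_eq_integral)
  also have "\<dots> = ennreal (\<Sum>k. LINT z|M. norm (\<phi> k z))"
    using summable by (intro suminf_ennreal2) auto
  finally have "(\<integral>\<^sup>+z. (\<Sum>k. ennreal (norm (\<phi> k z))) \<partial>M) \<noteq> \<infinity>"
    by simp
  then have "AE z in M. (\<Sum>k. ennreal (norm (\<phi> k z))) \<noteq> \<infinity>"
    using int by (intro nn_integral_noteq_infinite) auto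
  then have AE: "AE z in M. summable (\<lambda>k. norm (\<phi> k z))"
    by eventually_elim (intro summable_suminf_not_top; simp)
  show int_sum: "integrable M (\<lambda>z. \<Sum>k. \<phi> k z)"
    by (rule integrable_suminf[OF int AE summable])
  have AE': "AE z in M. summable (\<lambda>k. norm (norm (\<phi> (k + K) z)))"
    using AE
  proof eventually_elim
    case (elim z)
    show ?case
      using summable_ignore_initial_segment[OF elim, of K] by simp
  qed
  have summable': "summable (\<lambda>k. LINT z|M. norm (norm (\<phi> (k + K) z)))"
    using summable_ignore_initial_segment[OF summable, of K] by simp
  have int': "integrable M (\<lambda>z. norm (\<phi> (k + K) z))" for k
    using int by simp
  have "(LINT z|M. norm ((\<Sum>k. \<phi> k z) - (\<Sum>k<K. \<phi> k z))) \<le> (LINT z|M. (\<Sum>k. norm (\<phi> (k + K) z)))"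
  proof (rule integral_mono_AE)
    show "integrable M (\<lambda>z. norm ((\<Sum>k. \<phi> k z) - (\<Sum>k<K. \<phi> k z)))"
      using int_sum int by simp
    show "integrable M (\<lambda>z. \<Sum>k. norm (\<phi> (k + K) z))"
      by (rule integrable_suminf[OF int' AE' summable'])
    show "AE z in M. norm ((\<Sum>k. \<phi> k z) - (\<Sum>k<K. \<phi> k z)) \<le> (\<Sum>k. norm (\<phi> (k + K) z))"
      using AE AE'
    proof eventually_elim
      case (elim z)
      have "(\<Sum>k. \<phi> k z) - (\<Sum>k<K. \<phi> k z) = (\<Sum>k. \<phi> (k + K) z)"
        using suminf_minus_initial_segment[OF summable_norm_cancel[OF elim(1)], of K] by simp
      then show ?case
        using elim(2) summable_norm[of "\<lambda>k. \<phi> (k + K) z"] by simp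
    qed
  qed
  also have "\<dots> = (\<Sum>k. LINT z|M. norm (\<phi> (k + K) z))"
    by (rule integral_suminf[OF int' AE' summable'])
  finally show "(LINT z|M. norm ((\<Sum>k. \<phi> k z) - (\<Sum>k<K. \<phi> k z))) \<le> (\<Sum>k. LINT z|M. norm (\<phi> (k + K) z))" .
qed

text \<open>Coefficientwise convergence is enough to identify the sum, because Fourier coefficients
  are continuous for the L1 norm. It serves the block decompositions, the completion and the witness
  alike.\<close>

lemma lifts_series:
  assumes lifts: "\<And>k. lifts (b k) (B k)" and B: "summable B"
    and sums: "\<And>n. n \<ge> 1 \<Longrightarrow> (\<lambda>k. b k n) sums a n"
  shows "lifts a (suminf B)"
proof -
  have "\<forall>k. \<exists>\<phi>. \<phi> \<in> H1_torus \<and> bohr_lift (b k) \<phi> \<and> (LINT z|torus_measure. norm (\<phi> z)) \<le> B k"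
    using lifts unfolding lifts_def by blast
  then obtain \<phi> where \<phi>: "\<And>k. \<phi> k \<in> H1_torus" "\<And>k. bohr_lift (b k) (\<phi> k)"
    "\<And>k. (LINT z|torus_measure. norm (\<phi> k z)) \<le> B k"
    by metis
  have int: "integrable torus_measure (\<phi> k)" for k
    using \<phi>(1) by (simp add: H1_torus_def)
  define N where "N k = (LINT z|torus_measure. norm (\<phi> k z))" for k
  have "N k \<ge> 0" for k
    by (simp add: N_def)
  then have N: "summable N"
    using \<phi>(3) by (intro summable_comparison_test[OF _ B]) (auto simp: N_def)
  note series = L1_series[OF int N[unfolded N_def]]
  define S where "S z = (\<Sum>k. \<phi> k z)" for z
  have intS: "integrable torus_measure S"
    unfolding S_def[abs_def] by (rule series)
  have tail: "(LINT z|torus_measure. norm (S z - (\<Sum>k<K. \<phi> k z))) \<le> (\<Sum>k. N (k + K))" for K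
    unfolding S_def N_def by (rule series)
  have "(\<lambda>K. suminf N - (\<Sum>k<K. N k)) \<longlonglongrightarrow> suminf N - suminf N"
    by (intro tendsto_intros summable_LIMSEQ N)
  then have "(\<lambda>K. \<Sum>k. N (k + K)) \<longlonglongrightarrow> 0"
    using suminf_minus_initial_segment[OF N] by simp
  then have conv: "(\<lambda>K. LINT z|torus_measure. norm (S z - (\<Sum>k<K. \<phi> k z))) \<longlonglongrightarrow> 0"
    by (rule tendsto_sandwich[OF _ _ tendsto_const, rotated 2]) (auto intro: tail always_eventually)
  have "S \<in> H1_torus"
  proof (rule H1_torus_closed[OF intS])
    fix e :: real
    assume "e > 0"
    then obtain K where "(LINT z|torus_measure. norm (S z - (\<Sum>k<K. \<phi> k z))) < e"
      using eventually_happens'[OF sequentially_bot order_tendstoD(2)[OF conv]] by blast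
    then show "\<exists>\<psi>\<in>H1_torus. (LINT z|torus_measure. norm (S z - \<psi> z)) < e"
      by (intro bexI[of _ "\<lambda>z. \<Sum>k<K. \<phi> k z"] H1_torus_sum \<phi>(1))
  qed
  moreover have "bohr_lift a S"
    unfolding bohr_lift_iff
  proof (intro allI impI)
    fix n :: nat
    assume n: "n \<ge> 1"
    let ?c = "\<lambda>\<psi>. LINT z|torus_measure. \<psi> z * cnj (character z n)"
    have partial: "?c (\<lambda>z. \<Sum>k<K. \<phi> k z) = (\<Sum>k<K. b k n)" for K
    proof -
      have "?c (\<lambda>z. \<Sum>k<K. \<phi> k z) = (\<Sum>k<K. ?c (\<phi> k))"
        unfolding sum_distrib_right by (intro Bochner_Integration.integral_sum integrable_mult_cnj_character int)
      also have "\<dots> = (\<Sum>k<K. b k n)"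
        using \<phi>(2) n by (simp add: bohr_lift_iff)
      finally show ?thesis .
    qed
    have "norm ((\<Sum>k<K. b k n) - ?c S) \<le> (LINT z|torus_measure. norm (S z - (\<Sum>k<K. \<phi> k z)))" for K
    proof -
      have "norm ((\<Sum>k<K. b k n) - ?c S) = norm (?c (\<lambda>z. (\<Sum>k<K. \<phi> k z) - S z))"
        unfolding partial[symmetric] using intS int
        by (simp add: left_diff_distrib integrable_mult_cnj_character)
      also have "\<dots> \<le> (LINT z|torus_measure. norm (((\<Sum>k<K. \<phi> k z) - S z) * cnj (character z n)))"
        by (rule integral_norm_bound)
      also have "\<dots> = (LINT z|torus_measure. norm (S z - (\<Sum>k<K. \<phi> k z)))"
        by (intro Bochner_Integration.integral_cong) (auto simp: norm_mult norm_character norm_minus_commute)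
      finally show ?thesis .
    qed
    then have "(\<lambda>K. (\<Sum>k<K. b k n) - ?c S) \<longlonglongrightarrow> 0"
      by (intro Lim_null_comparison[OF _ conv]) auto
    then have "(\<lambda>K. \<Sum>k<K. b k n) \<longlonglongrightarrow> ?c S"
      by (simp add: LIM_zero_iff)
    moreover have "(\<lambda>K. \<Sum>k<K. b k n) \<longlonglongrightarrow> a n"
      using sums[OF n] by (simp add: sums_def)
    ultimately show "a n = ?c S"
      by (rule LIMSEQ_unique[OF _ , rotated])
  qed
  moreover have "(LINT z|torus_measure. norm (S z)) \<le> suminf B"
  proof -
    have "(LINT z|torus_measure. norm (S z)) \<le> suminf N"
      using tail[of 0] by simp
    also have "\<dots> \<le> suminf B"
      using \<phi>(3) by (intro suminf_le N B) (simp add: N_def)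
    finally show ?thesis .
  qed
  ultimately show ?thesis
    unfolding lifts_def by blast
qed

section \<open>The skew product space is contained in \<open>H\<^sup>1\<close>\<close>

lemma H2_norm_nonneg: "f \<in> H2 \<Longrightarrow> H2_norm f \<ge> 0"
  by (auto simp: H2_norm_def H2_def intro!: real_sqrt_ge_zero suminf_nonneg)

lemma H2_norm_finite: "finite A \<Longrightarrow> (\<And>n. n \<notin> A \<Longrightarrow> f n = 0) \<Longrightarrow> H2_norm f = sqrt (\<Sum>n\<in>A. (norm (f n))\<^sup>2)"
  unfolding H2_norm_def by (subst suminf_finite[of A]) auto

text \<open>Cutting f where its tails fall below c / 2^k gives blocks with summable norms: at most c
  for the first and 2 c for all others. The bilinear estimate for polynomials then extends to
  \<open>H2\<close> by summing over blocks.\<close>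

lemma H2_blocks:
  assumes f: "f \<in> H2"
  obtains F :: "nat \<Rightarrow> dirichlet" and N :: "nat \<Rightarrow> nat"
  where "\<And>k n. n \<notin> {0<..<N k} \<Longrightarrow> F k n = 0" "\<And>n. (\<lambda>k. F k n) sums f n"
    "summable (\<lambda>k. H2_norm (F k))" "(\<Sum>k. H2_norm (F k)) \<le> 3 * H2_norm f"
proof -
  define c where "c = H2_norm f"
  define e where "e n = (norm (f n))\<^sup>2" for n
  define t where "t M = sqrt (\<Sum>n. e (n + M))" for M
  have e: "summable e" "e n \<ge> 0" for n
    using f by (auto simp: H2_def e_def[abs_def])
  have f0: "f 0 = 0"
    using f by (simp add: H2_def)
  have c: "c \<ge> 0"
    using H2_norm_nonneg[OF f] by (simp add: c_def)
  have t0: "t 0 = c"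
    by (simp add: t_def c_def H2_norm_def e_def)
  have tpart: "sqrt (\<Sum>n\<in>{M..<N}. e n) \<le> t M" for M N
  proof -
    have "(\<Sum>n\<in>{M..<N}. e n) = (\<Sum>n<N - M. e (n + M))"
      by (rule sum.reindex_bij_witness[of _ "\<lambda>n. n + M" "\<lambda>n. n - M"]) auto
    also have "\<dots> \<le> (\<Sum>n. e (n + M))"
      using e by (intro sum_le_suminf summable_ignore_initial_segment) auto
    finally show ?thesis
      by (simp add: t_def)
  qed
  have tdecr: "t N \<le> t M" if "M \<le> N" for M N
  proof -
    have "(\<Sum>n. e (n + N)) = suminf e - (\<Sum>n<N. e n)" "(\<Sum>n. e (n + M)) = suminf e - (\<Sum>n<M. e n)"
      by (rule suminf_minus_initial_segment[OF e(1)])+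
    moreover have "(\<Sum>n<M. e n) \<le> (\<Sum>n<N. e n)"
      using that e by (intro sum_mono2) auto
    ultimately show ?thesis
      by (simp add: t_def)
  qed
  have tlim: "t \<longlonglongrightarrow> 0"
  proof -
    have "(\<lambda>M. sqrt (suminf e - (\<Sum>n<M. e n))) \<longlonglongrightarrow> sqrt (suminf e - suminf e)"
      by (intro tendsto_intros summable_LIMSEQ e)
    then show ?thesis
      unfolding t_def[abs_def] using suminf_minus_initial_segment[OF e(1)] by simp
  qed
  \<comment> \<open>The case c = 0 is separate because tending to 0 yields a strict bound only below
    a positive number.\<close>
  have "\<exists>M. t M \<le> c * (1/2) ^ k" for k
  proof (cases "c = 0")
    case True
    then show ?thesis
      using t0 by (intro exI[of _ 0]) simp
  next
    case False
    then have "c * (1/2) ^ k > 0"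
      using c by simp
    then have "\<exists>M. t M < c * (1/2) ^ k"
      by (intro eventually_happens'[OF sequentially_bot order_tendstoD(2)[OF tlim]])
    then show ?thesis
      by (auto intro: less_imp_le)
  qed
  then obtain M where M: "\<And>k. t (M k) \<le> c * (1/2) ^ k"
    by metis
  \<comment> \<open>The cumulative sum makes the cut points increase, and adding k makes them
    unbounded, so every index lies in some block.\<close>
  define N where "N k = (\<Sum>i\<le>k. M i) + k" for k
  have N: "M k \<le> N k" "k \<le> N k" "N k \<le> N (Suc k)" for k
    using member_le_sum[of k "{..k}" M] by (auto simp: N_def)
  define lo where "lo k = (case k of 0 \<Rightarrow> 0 | Suc j \<Rightarrow> N j)" for k
  define F where "F k n = (if lo k \<le> n \<and> n < N k then f n else 0)" for k n
  have F_norm: "H2_norm (F k) \<le> t (lo k)" for k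
  proof -
    have "H2_norm (F k) = sqrt (\<Sum>n\<in>{lo k..<N k}. (norm (F k n))\<^sup>2)"
      by (rule H2_norm_finite) (auto simp: F_def)
    also have "\<dots> = sqrt (\<Sum>n\<in>{lo k..<N k}. e n)"
      by (intro arg_cong[where f = sqrt] sum.cong) (auto simp: F_def e_def)
    finally show ?thesis
      using tpart by simp
  qed
  have F0: "F k n = 0" if "n \<notin> {0<..<N k}" for k n
    using that f0 by (auto simp: F_def)
  have F_H2_norm: "0 \<le> H2_norm (F k)" for k
    using F0 by (subst H2_norm_finite[of "{0<..<N k}"]) (auto simp: sum_nonneg)
  have psum: "(\<Sum>k<Suc K. F k n) = (if n < N K then f n else 0)" for K n
  proof (induction K)
    case (Suc K)
    then show ?case
      using N(3)[of K] by (auto simp: F_def lo_def)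
  qed (simp add: F_def lo_def)
  have sums: "(\<lambda>k. F k n) sums f n" for n
    unfolding sums_def
  proof (rule LIMSEQ_imp_Suc, rule tendsto_eventually)
    have "(\<Sum>k<Suc K. F k n) = f n" if "K \<ge> Suc n" for K
      using that N(2)[of K] by (simp only: psum) simp
    then show "\<forall>\<^sub>F K in sequentially. (\<Sum>k<Suc K. F k n) = f n"
      by (rule eventually_sequentiallyI)
  qed
  have B: "H2_norm (F (Suc k)) \<le> c * (1/2) ^ k" for k
    using F_norm[of "Suc k"] tdecr[OF N(1)[of k]] M[of k] by (simp add: lo_def)
  have geo: "summable (\<lambda>k. c * (1/2::real) ^ k)"
    by (intro summable_mult summable_geometric) simp
  have sum': "summable (\<lambda>k. H2_norm (F (Suc k)))"
    using B F_H2_norm by (intro summable_comparison_test[OF _ geo]) auto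
  then have summ: "summable (\<lambda>k. H2_norm (F k))"
    using summable_Suc_iff[of "\<lambda>k. H2_norm (F k)"] by simp
  have "(\<Sum>k. H2_norm (F k)) = H2_norm (F 0) + (\<Sum>k. H2_norm (F (Suc k)))"
    using suminf_split_head[OF summ] by simp
  also have "(\<Sum>k. H2_norm (F (Suc k))) \<le> (\<Sum>k. c * (1/2) ^ k)"
    by (intro suminf_le B sum' geo)
  also have "(\<Sum>k. c * (1/2) ^ k) = 2 * c"
    by (subst suminf_mult) (auto simp: suminf_geometric)
  also have "H2_norm (F 0) \<le> c"
    using F_norm[of 0] t0 by (simp add: lo_def)
  finally have "(\<Sum>k. H2_norm (F k)) \<le> 3 * c"
    by simp
  then show thesis
    using that[of N F, OF F0 sums summ] by (simp add: c_def)
qed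

text \<open>The primitive of \<open>f g'\<close> vanishing at \<open>+\<infinity>\<close>; the value at \<open>1\<close> is \<open>0\<close> since \<open>ln 1 = 0\<close>.\<close>

definition skew_primitive :: "dirichlet \<Rightarrow> dirichlet \<Rightarrow> dirichlet" where
  "skew_primitive f g n = (\<Sum>d | d dvd n. f d * g (n div d) * of_real (ln (real (n div d)) / ln (real n)))"

text \<open>Passes from divisors d of n to pairs (d, e) with product n, the indexing of
  \<open>skew_poly\<close>.\<close>

lemma skew_primitive_finite_support:
  assumes A: "finite A" "\<And>n. n \<in> A \<Longrightarrow> n > 0"
    and f: "\<And>n. n \<notin> A \<Longrightarrow> f n = 0" and g: "\<And>n. n \<notin> A \<Longrightarrow> g n = 0" and n: "n \<ge> 1"
  shows "skew_primitive f g n =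
    (\<Sum>(d, e)\<in>A \<times> A. if d * e = n then f d * g e * of_real (ln (real e) / ln (real (d * e))) else 0)"
proof -
  let ?c = "\<lambda>d e. f d * g e * of_real (ln (real e) / ln (real n))"
  have "(\<Sum>(d, e)\<in>A \<times> A. if d * e = n then f d * g e * of_real (ln (real e) / ln (real (d * e))) else 0) =
      (\<Sum>d\<in>A. \<Sum>e\<in>A. if d * e = n then ?c d e else 0)"
    unfolding sum.cartesian_product by (intro sum.cong) auto
  also have "\<dots> = (\<Sum>d\<in>A. if d dvd n then ?c d (n div d) else 0)"
  proof (intro sum.cong refl)
    fix d
    assume d: "d \<in> A"
    have "(\<Sum>e\<in>A. if d * e = n then ?c d e else 0) = (\<Sum>e\<in>A. if e = n div d then (if d dvd n then ?c d (n div d) else 0) else 0)"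
      using A(2)[OF d] by (intro sum.cong) auto
    also have "\<dots> = (if d dvd n then ?c d (n div d) else 0)"
      using A g by (simp add: sum.delta)
    finally show "(\<Sum>e\<in>A. if d * e = n then ?c d e else 0) = (if d dvd n then ?c d (n div d) else 0)" .
  qed
  also have "\<dots> = (\<Sum>d\<in>A \<inter> {d. d dvd n}. ?c d (n div d))"
    unfolding sum.inter_restrict[OF A(1)] by (intro sum.cong) auto
  also have "\<dots> = (\<Sum>d | d dvd n. ?c d (n div d))"
    using n f by (intro sum.mono_neutral_left) (auto intro: finite_divisors_nat)
  finally show ?thesis
    by (simp add: skew_primitive_def)
qed

lemma lifts_skew_primitive_finite:
  assumes A: "finite A" "\<And>n. n \<in> A \<Longrightarrow> n > 0"
    and f: "\<And>n. n \<notin> A \<Longrightarrow> f n = 0" and g: "\<And>n. n \<notin> A \<Longrightarrow> g n = 0"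
  shows "lifts (skew_primitive f g) (5 * H2_norm f * H2_norm g)"
proof -
  let ?c = "\<lambda>(d, e). f d * g e * of_real (ln (real e) / ln (real (d * e)))"
  have "lifts (\<lambda>n. \<Sum>i\<in>A \<times> A. if (case i of (d, e) \<Rightarrow> d * e) = n then ?c i else 0)
      (LINT z|torus_measure. norm (\<Sum>i\<in>A \<times> A. ?c i * character z (case i of (d, e) \<Rightarrow> d * e)))"
    by (rule lifts_poly) (use A in auto)
  also have "(LINT z|torus_measure. norm (\<Sum>i\<in>A \<times> A. ?c i * character z (case i of (d, e) \<Rightarrow> d * e))) =
      (LINT z|torus_measure. norm (skew_poly A f g 0 (character z)))"
  proof (intro Bochner_Integration.integral_cong refl arg_cong[where f = norm])
    fix z
    assume "z \<in> space torus_measure"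
    then have "character z 1 = 1"
      using character_in_characters characters_one by blast
    then show "(\<Sum>i\<in>A \<times> A. ?c i * character z (case i of (d, e) \<Rightarrow> d * e)) = skew_poly A f g 0 (character z)"
      unfolding skew_poly_def sum.cartesian_product by (intro sum.cong) (auto simp: wave_def)
  qed
  finally have "lifts (\<lambda>n. \<Sum>i\<in>A \<times> A. if (case i of (d, e) \<Rightarrow> d * e) = n then ?c i else 0)
      (LINT z|torus_measure. norm (skew_poly A f g 0 (character z)))" .
  then have "lifts (skew_primitive f g) (LINT z|torus_measure. norm (skew_poly A f g 0 (character z)))"
  proof (rule lifts_cong)
    fix n :: nat
    assume "n \<ge> 1"
    then show "skew_primitive f g n = (\<Sum>i\<in>A \<times> A. if (case i of (d, e) \<Rightarrow> d * e) = n then ?c i else 0)"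
      by (subst skew_primitive_finite_support[OF A f g]) (auto intro!: sum.cong)
  qed
  moreover have "(LINT z|torus_measure. norm (skew_poly A f g 0 (character z))) \<le> 5 * H2_norm f * H2_norm g"
    using skew_poly_L1[OF A, of f g] H2_norm_finite[OF A(1) f] H2_norm_finite[OF A(1) g] by simp
  ultimately show ?thesis
    by (rule lifts_mono)
qed

text \<open>Here 45 = 5 * 3 * 3, one factor 3 for each block decomposition. The two series are
  summed one after the other, first in g and then in f; divisor sums are finite and commute with
  them.\<close>

lemma lifts_skew_primitive:
  assumes f: "f \<in> H2" and g: "g \<in> H2"
  shows "lifts (skew_primitive f g) (45 * H2_norm f * H2_norm g)"
proof -
  obtain G N where G: "\<And>k n. n \<notin> {0<..<N k} \<Longrightarrow> G k n = 0" "\<And>n. (\<lambda>k. G k n) sums g n"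
    "summable (\<lambda>k. H2_norm (G k))" "(\<Sum>k. H2_norm (G k)) \<le> 3 * H2_norm g"
    by (rule H2_blocks[OF g]) blast
  obtain F M where F: "\<And>k n. n \<notin> {0<..<M k} \<Longrightarrow> F k n = 0" "\<And>n. (\<lambda>k. F k n) sums f n"
    "summable (\<lambda>k. H2_norm (F k))" "(\<Sum>k. H2_norm (F k)) \<le> 3 * H2_norm f"
    by (rule H2_blocks[OF f]) blast
  have F0: "H2_norm (F k) \<ge> 0" for k
    using F(1) by (subst H2_norm_finite[of "{0<..<M k}"]) (auto simp: sum_nonneg)
  have step: "lifts (skew_primitive (F k) g) (15 * H2_norm g * H2_norm (F k))" for k
  proof -
    have "lifts (skew_primitive (F k) g) (\<Sum>j. 5 * H2_norm (F k) * H2_norm (G j))"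
    proof (rule lifts_series)
      show "lifts (skew_primitive (F k) (G j)) (5 * H2_norm (F k) * H2_norm (G j))" for j
      proof (rule lifts_skew_primitive_finite[of "{0<..<max (M k) (N j)}"])
        show "F k n = 0" "G j n = 0" if "n \<notin> {0<..<max (M k) (N j)}" for n
          using that by (intro F(1) G(1); auto)+
      qed auto
      show "summable (\<lambda>j. 5 * H2_norm (F k) * H2_norm (G j))"
        by (intro summable_mult G)
      show "(\<lambda>j. skew_primitive (F k) (G j) n) sums skew_primitive (F k) g n" for n
        unfolding skew_primitive_def by (intro sums_sum sums_mult sums_mult2 G)
    qed
    moreover have "(\<Sum>j. 5 * H2_norm (F k) * H2_norm (G j)) = 5 * H2_norm (F k) * (\<Sum>j. H2_norm (G j))"
      by (rule suminf_mult[OF G(3)])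
    moreover have "5 * H2_norm (F k) * (\<Sum>j. H2_norm (G j)) \<le> 5 * H2_norm (F k) * (3 * H2_norm g)"
      using F0 G(4) by (intro mult_left_mono) auto
    ultimately show ?thesis
      by (auto intro: lifts_mono simp: mult_ac)
  qed
  have "lifts (skew_primitive f g) (\<Sum>k. 15 * H2_norm g * H2_norm (F k))"
  proof (rule lifts_series[OF step])
    show "summable (\<lambda>k. 15 * H2_norm g * H2_norm (F k))"
      by (intro summable_mult F)
    show "(\<lambda>k. skew_primitive (F k) g n) sums skew_primitive f g n" for n
      unfolding skew_primitive_def by (intro sums_sum sums_mult2 F)
  qed
  moreover have "(\<Sum>k. 15 * H2_norm g * H2_norm (F k)) = 15 * H2_norm g * (\<Sum>k. H2_norm (F k))"
    by (rule suminf_mult[OF F(3)])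
  moreover have "15 * H2_norm g * (\<Sum>k. H2_norm (F k)) \<le> 15 * H2_norm g * (3 * H2_norm f)"
    using F(4) H2_norm_nonneg[OF g] by (intro mult_left_mono) auto
  ultimately show ?thesis
    by (auto intro: lifts_mono simp: mult_ac)
qed

section \<open>From representations of F' to the completed space\<close>

lemma skew_rep_coefficient:
  assumes rep: "skew_rep F N f g" and n: "n \<ge> 2"
  shows "F n = (\<Sum>k<N. skew_primitive (f k) (g k) n)"
proof -
  have l: "ln (real n) \<noteq> 0"
    using n by (simp add: ln_eq_zero_iff)
  have mult: "dir_mult (f k) (dir_deriv (g k)) n = - (skew_primitive (f k) (g k) n * of_real (ln (real n)))" for k
  proof -
    have "skew_primitive (f k) (g k) n * of_real (ln (real n)) =
        (\<Sum>d | d dvd n. f k d * g k (n div d) * of_real (ln (real (n div d))))"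
      unfolding skew_primitive_def sum_distrib_right using l by (intro sum.cong refl) simp
    then show ?thesis
      by (simp add: dir_mult_def dir_deriv_def sum_negf mult.assoc)
  qed
  have "- (F n * of_real (ln (real n))) = dir_deriv F n"
    by (simp add: dir_deriv_def)
  also have "\<dots> = (\<Sum>k<N. dir_mult (f k) (dir_deriv (g k)) n)"
    using rep unfolding skew_rep_def by (blast dest: fun_cong)
  also have "\<dots> = - ((\<Sum>k<N. skew_primitive (f k) (g k) n) * of_real (ln (real n)))"
    by (simp only: mult sum_negf sum_distrib_right)
  finally have "F n * of_real (ln (real n)) = (\<Sum>k<N. skew_primitive (f k) (g k) n) * of_real (ln (real n))"
    by simp
  then show ?thesis
    using l by simp
qed

lemma lifts_sum:
  "finite I \<Longrightarrow> (\<And>i. i \<in> I \<Longrightarrow> lifts (a i) (K i)) \<Longrightarrow> lifts (\<lambda>n. \<Sum>i\<in>I. a i n) (\<Sum>i\<in>I. K i)"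
proof (induction I rule: finite_induct)
  case empty
  show ?case
    using lifts_poly[of "{} :: nat set"] by simp
next
  case (insert i I)
  then show ?case
    by (simp add: lifts_add)
qed

text \<open>A representation of F' does not see F(+infinity), so the constant term is lifted on its
  own.\<close>

lemma lifts_skew_rep:
  assumes rep: "skew_rep F N f g"
  shows "lifts F (norm (F 1) + 45 * (\<Sum>k<N. H2_norm (f k) * H2_norm (g k)))"
proof -
  have H2: "f k \<in> H2" "g k \<in> H2" if "k < N" for k
    using rep that by (auto simp: skew_rep_def)
  have "lifts (\<lambda>n. \<Sum>i\<in>{0::nat}. if 1 = n then F 1 else 0) (LINT z|torus_measure. norm (\<Sum>i\<in>{0::nat}. F 1 * character z 1))"
    by (rule lifts_poly) auto
  then have 1: "lifts (\<lambda>n. if n = 1 then F 1 else 0) (norm (F 1))"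
  proof (rule lifts_mono[OF lifts_cong])
    have "(LINT z|torus_measure. norm (\<Sum>i\<in>{0::nat}. F 1 * character z 1)) = (LINT z|torus_measure. norm (F 1))"
      by (intro Bochner_Integration.integral_cong) (auto simp: norm_mult norm_character)
    then show "(LINT z|torus_measure. norm (\<Sum>i\<in>{0::nat}. F 1 * character z 1)) \<le> norm (F 1)"
      by (simp add: torus_measure.prob_space)
  qed auto
  have 2: "lifts (\<lambda>n. \<Sum>k<N. skew_primitive (f k) (g k) n) (\<Sum>k<N. 45 * H2_norm (f k) * H2_norm (g k))"
    by (intro lifts_sum lifts_skew_primitive H2) auto
  have "skew_primitive a b 1 = 0" for a b
    by (simp add: skew_primitive_def)
  then have "F n = (if n = 1 then F 1 else 0) + (\<Sum>k<N. skew_primitive (f k) (g k) n)" if "n \<ge> 1" for n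
    using that skew_rep_coefficient[OF rep, of n] by (cases "n = 1") auto
  then have "lifts F (norm (F 1) + (\<Sum>k<N. 45 * H2_norm (f k) * H2_norm (g k)))"
    by (rule lifts_cong[OF lifts_add[OF 1 2]])
  then show ?thesis
    by (simp only: sum_distrib_left mult.assoc)
qed

text \<open>Cauchy sequences involve differences, which must stay finitely represented: the
  representations are concatenated, with the sign moved into the left factors.\<close>

lemma skew_rep_diff:
  assumes "skew_rep F N f g" "skew_rep G M f' g'"
  shows "skew_rep (\<lambda>n. F n - G n) (N + M) (\<lambda>k. if k < N then f k else (\<lambda>n. - f' (k - N) n))
    (\<lambda>k. if k < N then g k else g' (k - N))"
proof -
  have sum_split: "(\<Sum>k<N + M. h k) = (\<Sum>k<N. h k) + (\<Sum>k<M. h (N + k))" for h :: "nat \<Rightarrow> complex"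
    by (induction M) (auto simp: add.assoc)
  have "(\<lambda>n. - a n) \<in> H2" if "a \<in> H2" for a
    using that by (simp add: H2_def)
  then have "(if k < N then f k else (\<lambda>n. - f' (k - N) n)) \<in> H2" "(if k < N then g k else g' (k - N)) \<in> H2"
    if "k < N + M" for k
    using assms that by (auto simp: skew_rep_def)
  moreover have "dir_deriv (\<lambda>n. F n - G n) n = (\<Sum>k<N + M. dir_mult (if k < N then f k else (\<lambda>n. - f' (k - N) n))
      (dir_deriv (if k < N then g k else g' (k - N))) n)" for n
  proof -
    have "dir_deriv (\<lambda>n. F n - G n) n = dir_deriv F n - dir_deriv G n"
      by (simp add: dir_deriv_def left_diff_distrib)
    also have "\<dots> = (\<Sum>k<N. dir_mult (f k) (dir_deriv (g k)) n) - (\<Sum>k<M. dir_mult (f' k) (dir_deriv (g' k)) n)"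
      using assms by (simp add: skew_rep_def)
    also have "\<dots> = (\<Sum>k<N. dir_mult (f k) (dir_deriv (g k)) n) + (\<Sum>k<M. dir_mult (\<lambda>n. - f' k n) (dir_deriv (g' k)) n)"
      by (simp add: dir_mult_def sum_negf)
    finally show ?thesis
      by (simp add: sum_split)
  qed
  ultimately show ?thesis
    unfolding skew_rep_def by blast
qed

lemma skew_finite_diff: "F \<in> skew_finite \<Longrightarrow> G \<in> skew_finite \<Longrightarrow> (\<lambda>n. F n - G n) \<in> skew_finite"
  unfolding skew_finite_def using skew_rep_diff by fastforce

lemma skew_finite_rep_less:
  assumes F: "F \<in> skew_finite" and less: "skew_norm F < e"
  obtains N f g where "skew_rep F N f g" "norm (F 1) + (\<Sum>k<N. H2_norm (f k) * H2_norm (g k)) < e"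
proof -
  let ?S = "{\<Sum>k<N. H2_norm (f k) * H2_norm (g k) | N f g. skew_rep F N f g}"
  have ne: "?S \<noteq> {}"
    using F unfolding skew_finite_def by blast
  have "Inf ?S < e - norm (F 1)"
    using less by (simp add: skew_norm_def)
  from cInf_lessD[OF ne this] obtain s where "s \<in> ?S" "s < e - norm (F 1)" ..
  then obtain N f g where "s = (\<Sum>k<N. H2_norm (f k) * H2_norm (g k))" "skew_rep F N f g"
    by blast
  then show thesis
    using \<open>s < e - norm (F 1)\<close> by (intro that[of N f g]) simp_all
qed

lemma lifts_skew_finite: "F \<in> skew_finite \<Longrightarrow> skew_norm F < e \<Longrightarrow> lifts F (45 * e)"
proof -
  assume "F \<in> skew_finite" "skew_norm F < e"
  then obtain N f g where rep: "skew_rep F N f g" "norm (F 1) + (\<Sum>k<N. H2_norm (f k) * H2_norm (g k)) < e"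
    by (rule skew_finite_rep_less)
  show ?thesis
    using rep(2) by (intro lifts_mono[OF lifts_skew_rep[OF rep(1)]]) (use norm_ge_zero[of "F 1"] in linarith)
qed

text \<open>A rapidly Cauchy subsequence is written as a telescoping series, whose terms have
  geometrically small L1 bounds.\<close>

lemma skew_product_space_subset_H1: "skew_product_space \<subseteq> H1"
proof
  fix F
  assume "F \<in> skew_product_space"
  then obtain G where G: "\<And>m. G m \<in> skew_finite"
    "\<And>e. e > 0 \<Longrightarrow> \<exists>M. \<forall>i\<ge>M. \<forall>j\<ge>M. skew_norm (\<lambda>n. G i n - G j n) < e"
    "\<And>n. (\<lambda>m. G m n) \<longlonglongrightarrow> F n"
    unfolding skew_product_space_def by blast
  have "\<exists>M. \<forall>i\<ge>M. \<forall>j\<ge>M. skew_norm (\<lambda>n. G i n - G j n) < (1/2) ^ k" for k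
    by (rule G(2)) simp
  then obtain M where M: "\<And>k i j. i \<ge> M k \<Longrightarrow> j \<ge> M k \<Longrightarrow> skew_norm (\<lambda>n. G i n - G j n) < (1/2) ^ k"
    by metis
  \<comment> \<open>A strictly increasing choice of indices with
    \<open>M k \<le> I k\<close>.\<close>
  define I where "I k = (\<Sum>i\<le>k. M i) + k" for k
  have I: "M k \<le> I k" "M k \<le> I (Suc k)" for k
    using member_le_sum[of k "{..k}" M] by (auto simp: I_def)
  have "strict_mono I"
    by (rule strict_monoI_Suc) (simp add: I_def)
  define b where "b k = (case k of 0 \<Rightarrow> G (I 0) | Suc j \<Rightarrow> (\<lambda>n. G (I (Suc j)) n - G (I j) n))" for k
  \<comment> \<open>The + 1 is there because \<open>lifts_skew_finite\<close> asks for a strict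
    upper bound of the skew norm.\<close>
  define B :: "nat \<Rightarrow> real" where
    "B k = (case k of 0 \<Rightarrow> 45 * (skew_norm (G (I 0)) + 1) | Suc j \<Rightarrow> 45 * (1/2) ^ j)" for k
  have "lifts F (suminf B)"
  proof (rule lifts_series)
    show "lifts (b k) (B k)" for k
    proof (cases k)
      case 0
      then show ?thesis
        using lifts_skew_finite[OF G(1), of "I 0" "skew_norm (G (I 0)) + 1"] by (simp add: b_def B_def)
    next
      case (Suc j)
      then show ?thesis
        by (auto simp: b_def B_def intro!: lifts_skew_finite skew_finite_diff G(1) M I)
    qed
    have "summable (\<lambda>j. B (Suc j))"
      unfolding B_def nat.case by (intro summable_mult summable_geometric) simp
    then show "summable B"
      by (simp only: summable_Suc_iff)
    fix n
    have "(\<Sum>k<Suc K. b k n) = G (I K) n" for K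
      by (induction K) (auto simp: b_def)
    then have psum: "(\<lambda>K. \<Sum>k<Suc K. b k n) = (\<lambda>K. G (I K) n)"
      by (rule ext)
    have "(\<lambda>K. G (I K) n) \<longlonglongrightarrow> F n"
      using LIMSEQ_subseq_LIMSEQ[OF G(3) \<open>strict_mono I\<close>] by (simp add: o_def)
    then show "(\<lambda>k. b k n) sums F n"
      unfolding sums_def psum[symmetric] by (rule LIMSEQ_imp_Suc)
  qed
  moreover have "F 0 = 0"
    using G(1) LIMSEQ_unique[OF G(3)[of 0], of 0] by (simp add: skew_finite_def)
  ultimately show "F \<in> H1"
    unfolding H1_def lifts_def by blast
qed

section \<open>A function in \<open>H\<^sup>1\<close> outside the skew product space\<close>

text \<open>The frequencies of the product over \<open>j < N\<close> of the sums of the coordinates \<open>2 j\<close> and \<open>2 j + 1\<close>.\<close>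

fun pair_products :: "nat \<Rightarrow> nat set" where
  "pair_products 0 = {1}"
| "pair_products (Suc N) =
    (\<lambda>n. nth_prime (2 * N) * n) ` pair_products N \<union> (\<lambda>n. nth_prime (2 * N + 1) * n) ` pair_products N"

text \<open>All divisors of elements of \<open>pair_products N\<close>: each pair contributes no
  prime or exactly one. They index the rows and columns of the Hankel form.\<close>

fun pair_divisors :: "nat \<Rightarrow> nat set" where
  "pair_divisors 0 = {1}"
| "pair_divisors (Suc N) = pair_divisors N \<union>
    ((\<lambda>n. nth_prime (2 * N) * n) ` pair_divisors N \<union> (\<lambda>n. nth_prime (2 * N + 1) * n) ` pair_divisors N)"

lemma prime_dvd_nth_prime: "i \<noteq> j \<Longrightarrow> \<not> nth_prime i dvd nth_prime j"
  using primes_dvd_imp_eq[of "nth_prime i" "nth_prime j"] by auto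

lemma not_nth_prime_dvd_mult: "i \<noteq> j \<Longrightarrow> \<not> nth_prime i dvd n \<Longrightarrow> \<not> nth_prime i dvd nth_prime j * n"
  by (simp add: prime_dvd_mult_iff prime_dvd_nth_prime)

lemma finite_pair_products: "finite (pair_products N)"
  by (induction N) auto

lemma finite_pair_divisors: "finite (pair_divisors N)"
  by (induction N) auto

lemma pair_products_pos: "n \<in> pair_products N \<Longrightarrow> n > 0"
  by (induction N arbitrary: n) (auto simp: prime_gt_0_nat)

lemma pair_products_not_dvd: "n \<in> pair_products N \<Longrightarrow> 2 * N \<le> i \<Longrightarrow> \<not> nth_prime i dvd n"
proof (induction N arbitrary: n)
  case 0
  then show ?case
    using prime_nth_prime[of i] by (auto simp del: prime_nth_prime)
next
  case (Suc N)
  then show ?case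
    by (auto simp: prime_dvd_mult_iff prime_dvd_nth_prime)
qed

lemma pair_divisors_not_dvd: "n \<in> pair_divisors N \<Longrightarrow> 2 * N \<le> i \<Longrightarrow> \<not> nth_prime i dvd n"
proof (induction N arbitrary: n)
  case 0
  then show ?case
    using prime_nth_prime[of i] by (auto simp del: prime_nth_prime)
next
  case (Suc N)
  then show ?case
    by (auto simp: prime_dvd_mult_iff prime_dvd_nth_prime)
qed

lemma inj_on_nth_prime_mult: "inj_on (\<lambda>n. nth_prime i * n) A"
  using prime_gt_0_nat[OF prime_nth_prime, of i] by (auto intro!: inj_onI)

lemma sum_pair_products_Suc:
  fixes h :: "nat \<Rightarrow> 'a::comm_monoid_add"
  shows "(\<Sum>n\<in>pair_products (Suc N). h n) =
    (\<Sum>n\<in>pair_products N. h (nth_prime (2 * N) * n)) + (\<Sum>n\<in>pair_products N. h (nth_prime (2 * N + 1) * n))"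
proof -
  have "(\<lambda>n. nth_prime (2 * N) * n) ` pair_products N \<inter> (\<lambda>n. nth_prime (2 * N + 1) * n) ` pair_products N = {}"
  proof (intro equals0I, elim IntE imageE)
    fix x m n
    assume *: "x = nth_prime (2 * N) * m" "x = nth_prime (2 * N + 1) * n" "m \<in> pair_products N"
    have "\<not> nth_prime (2 * N + 1) dvd nth_prime (2 * N) * m"
      using * by (intro not_nth_prime_dvd_mult pair_products_not_dvd) auto
    then show False
      using * by (metis dvd_triv_left)
  qed
  then show ?thesis
    by (simp add: sum.union_disjoint finite_pair_products sum.reindex inj_on_nth_prime_mult)
qed

lemma sum_pair_divisors_Suc:
  fixes h :: "nat \<Rightarrow> real"
  shows "(\<Sum>n\<in>pair_divisors (Suc N). h n) = (\<Sum>n\<in>pair_divisors N. h n) +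
    ((\<Sum>n\<in>pair_divisors N. h (nth_prime (2 * N) * n)) + (\<Sum>n\<in>pair_divisors N. h (nth_prime (2 * N + 1) * n)))"
proof -
  let ?p = "nth_prime (2 * N)" and ?q = "nth_prime (2 * N + 1)" and ?D = "pair_divisors N"
  have p: "\<not> ?p dvd n" and q: "\<not> ?q dvd n" if "n \<in> ?D" for n
    using pair_divisors_not_dvd[OF that, of "2 * N"] pair_divisors_not_dvd[OF that, of "2 * N + 1"] by auto
  have pq: "\<not> ?q dvd ?p * n" if "n \<in> ?D" for n
    using that by (intro not_nth_prime_dvd_mult q) auto
  have "(\<lambda>n. ?p * n) ` ?D \<inter> (\<lambda>n. ?q * n) ` ?D = {}"
    using pq by (auto, metis dvd_triv_left)
  moreover have "?D \<inter> ((\<lambda>n. ?p * n) ` ?D \<union> (\<lambda>n. ?q * n) ` ?D) = {}"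
    by (auto dest: p q)
  ultimately show ?thesis
    by (simp add: sum.union_disjoint finite_pair_divisors sum.reindex inj_on_nth_prime_mult)
qed

text \<open>As p divides p n exactly once, in each factorisation of p n into two factors it lies in
  exactly one of them.\<close>

lemma sum_divisors_prime_mult:
  fixes h :: "nat \<Rightarrow> nat \<Rightarrow> 'a::comm_monoid_add"
  assumes p: "prime p" and n: "n > 0" "\<not> p dvd n"
  shows "(\<Sum>d | d dvd p * n. h d (p * n div d)) =
    (\<Sum>d | d dvd n. h d (p * (n div d))) + (\<Sum>d | d dvd n. h (p * d) (n div d))"
proof -
  have p0: "p > 0"
    using p by (rule prime_gt_0_nat)
  have eq: "{d. d dvd p * n} = {d. d dvd n} \<union> (\<lambda>d. p * d) ` {d. d dvd n}"
  proof (intro equalityI subsetI)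
    fix d
    assume "d \<in> {d. d dvd p * n}"
    then have d: "d dvd p * n"
      by simp
    show "d \<in> {d. d dvd n} \<union> (\<lambda>d. p * d) ` {d. d dvd n}"
    proof (cases "p dvd d")
      case True
      then show ?thesis
        using d p0 by auto
    next
      case False
      then have "coprime d p"
        using p by (metis coprime_commute prime_imp_coprime)
      then show ?thesis
        using d by (simp add: coprime_dvd_mult_right_iff)
    qed
  qed auto
  have disj: "{d. d dvd n} \<inter> (\<lambda>d. p * d) ` {d. d dvd n} = {}"
    using n(2) by (auto dest: dvd_mult_left)
  have inj: "inj_on (\<lambda>d. p * d) {d. d dvd n}"
    using p0 by (auto intro: inj_onI)
  have "(\<Sum>d | d dvd p * n. h d (p * n div d)) =
      (\<Sum>d | d dvd n. h d (p * n div d)) + (\<Sum>d | d dvd n. h (p * d) (p * n div (p * d)))"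
    unfolding eq using n(1) by (simp add: sum.union_disjoint[OF _ _ disj] sum.reindex[OF inj] o_def)
  also have "(\<Sum>d | d dvd n. h d (p * n div d)) = (\<Sum>d | d dvd n. h d (p * (n div d)))"
    by (intro sum.cong refl) (auto simp: div_mult_swap)
  finally show ?thesis
    using p0 by simp
qed

section \<open>The Hankel form of a product of pairs\<close>

lemma sqrt_sum_square_add_le:
  fixes a b :: "'a \<Rightarrow> real"
  shows "sqrt (\<Sum>n\<in>D. (a n + b n)\<^sup>2) \<le> sqrt 2 * sqrt ((\<Sum>n\<in>D. (a n)\<^sup>2) + (\<Sum>n\<in>D. (b n)\<^sup>2))"
proof -
  have "(a n + b n)\<^sup>2 \<le> 2 * ((a n)\<^sup>2 + (b n)\<^sup>2)" for n
    using zero_le_power2[of "a n - b n"] by (simp add: power2_eq_square algebra_simps)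
  then have "(\<Sum>n\<in>D. (a n + b n)\<^sup>2) \<le> (\<Sum>n\<in>D. 2 * ((a n)\<^sup>2 + (b n)\<^sup>2))"
    by (intro sum_mono)
  also have "\<dots> = 2 * ((\<Sum>n\<in>D. (a n)\<^sup>2) + (\<Sum>n\<in>D. (b n)\<^sup>2))"
    by (simp add: sum_distrib_left sum.distrib distrib_left)
  finally show ?thesis
    by (simp add: real_sqrt_mult[symmetric])
qed

text \<open>Cauchy-Schwarz for (x, y) and (v, u).\<close>

lemma cross_le_sqrt_mult_sqrt:
  fixes x y u v :: real
  shows "x * v + y * u \<le> sqrt (x\<^sup>2 + y\<^sup>2) * sqrt (u\<^sup>2 + v\<^sup>2)"
proof -
  have "(x * v + y * u)\<^sup>2 \<le> (x\<^sup>2 + y\<^sup>2) * (u\<^sup>2 + v\<^sup>2)"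
    using zero_le_power2[of "x * u - y * v"] by (simp add: power2_eq_square algebra_simps)
  then show ?thesis
    unfolding real_sqrt_mult[symmetric] by (rule real_le_rsqrt)
qed

text \<open>The Hankel form of a product over disjoint sets of variables has multiplicative norm.\<close>

lemma pair_products_bilinear:
  fixes a b :: "nat \<Rightarrow> real"
  shows "(\<Sum>n\<in>pair_products N. \<Sum>d | d dvd n. a d * b (n div d)) \<le>
    sqrt 2 ^ N * (sqrt (\<Sum>d\<in>pair_divisors N. (a d)\<^sup>2) * sqrt (\<Sum>d\<in>pair_divisors N. (b d)\<^sup>2))"
proof (induction N arbitrary: a b)
  case 0
  have "a 1 * b 1 \<le> \<bar>a 1\<bar> * \<bar>b 1\<bar>"
    by (metis abs_ge_self abs_mult)
  then show ?case
    by simp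
next
  case (Suc N)
  let ?S = "pair_products N" and ?D = "pair_divisors N"
  let ?p = "nth_prime (2 * N)" and ?q = "nth_prime (2 * N + 1)"
  let ?B = "\<lambda>a b. \<Sum>n\<in>?S. \<Sum>d | d dvd n. a d * (b (n div d) :: real)"
  let ?n = "\<lambda>a. sqrt (\<Sum>d\<in>?D. (a d :: real)\<^sup>2)"
  define a' b' where "a' d = a (?p * d) + a (?q * d)" and "b' d = b (?p * d) + b (?q * d)" for d
  define x u y v where "x = ?n a" and "u = ?n b"
    and "y = sqrt ((\<Sum>d\<in>?D. (a (?p * d))\<^sup>2) + (\<Sum>d\<in>?D. (a (?q * d))\<^sup>2))"
    and "v = sqrt ((\<Sum>d\<in>?D. (b (?p * d))\<^sup>2) + (\<Sum>d\<in>?D. (b (?q * d))\<^sup>2))"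
  have div: "(\<Sum>d | d dvd nth_prime i * n. a d * b (nth_prime i * n div d)) =
      (\<Sum>d | d dvd n. a d * b (nth_prime i * (n div d))) + (\<Sum>d | d dvd n. a (nth_prime i * d) * b (n div d))"
    if "n \<in> ?S" "i \<ge> 2 * N" for i n
    using that by (intro sum_divisors_prime_mult) (auto simp: pair_products_pos dest: pair_products_not_dvd)
  \<comment> \<open>The new prime goes to the right or to the left factor. This is the tensor
    product of the old form with the 3 by 3 matrix with rows 0 1 1, 1 0 0, 1 0 0, whose norm is sqrt
    2.\<close>
  have "(\<Sum>n\<in>pair_products (Suc N). \<Sum>d | d dvd n. a d * b (n div d)) = ?B a b' + ?B a' b"
    by (simp add: sum_pair_products_Suc div a'_def b'_def distrib_left distrib_right sum.distrib
        del: pair_products.simps cong: sum.cong)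
  also have "\<dots> \<le> sqrt 2 ^ N * (x * ?n b') + sqrt 2 ^ N * (?n a' * u)"
    unfolding x_def u_def by (intro add_mono Suc.IH)
  also have "\<dots> \<le> sqrt 2 ^ N * (x * (sqrt 2 * v)) + sqrt 2 ^ N * ((sqrt 2 * y) * u)"
    unfolding a'_def b'_def y_def v_def
    by (intro add_mono mult_left_mono mult_right_mono sqrt_sum_square_add_le)
       (auto simp: x_def u_def sum_nonneg)
  also have "\<dots> = sqrt 2 ^ Suc N * (x * v + y * u)"
    by (simp add: algebra_simps)
  also have "\<dots> \<le> sqrt 2 ^ Suc N * (sqrt (x\<^sup>2 + y\<^sup>2) * sqrt (u\<^sup>2 + v\<^sup>2))"
    by (intro mult_left_mono cross_le_sqrt_mult_sqrt) simp
  also have "x\<^sup>2 + y\<^sup>2 = (\<Sum>d\<in>pair_divisors (Suc N). (a d)\<^sup>2)"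
    unfolding sum_pair_divisors_Suc by (simp add: x_def y_def sum_nonneg)
  also have "u\<^sup>2 + v\<^sup>2 = (\<Sum>d\<in>pair_divisors (Suc N). (b d)\<^sup>2)"
    unfolding sum_pair_divisors_Suc by (simp add: u_def v_def sum_nonneg)
  finally show ?case .
qed

lemma norm_skew_primitive_le:
  assumes "n > 0"
  shows "norm (skew_primitive f g n) \<le> (\<Sum>d | d dvd n. norm (f d) * norm (g (n div d)))"
  unfolding skew_primitive_def
proof (rule sum_norm_le)
  fix d
  assume "d \<in> {d. d dvd n}"
  then have "n div d > 0" "n div d \<le> n"
    using assms by (auto simp: dvd_div_eq_0_iff)
  then have "0 \<le> ln (real (n div d))" "ln (real (n div d)) \<le> ln (real n)"
    using assms by (simp_all add: Suc_le_eq)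
  then have "\<bar>ln (real (n div d)) / ln (real n)\<bar> \<le> 1"
    by (auto simp: divide_le_eq_1)
  then show "norm (f d * g (n div d) * of_real (ln (real (n div d)) / ln (real n))) \<le> norm (f d) * norm (g (n div d))"
    unfolding norm_mult norm_of_real by (intro mult_left_le) auto
qed

lemma H2_norm_ge_finite: "f \<in> H2 \<Longrightarrow> finite D \<Longrightarrow> sqrt (\<Sum>n\<in>D. (norm (f n))\<^sup>2) \<le> H2_norm f"
  unfolding H2_norm_def H2_def by (auto intro: sum_le_suminf)

text \<open>\<open>N \<ge> 1\<close> keeps the frequency 1, whose coefficient F' does not determine,
  out of the sum. The bound holds for every representation, hence for the infimum.\<close>

lemma pair_products_skew_finite:
  assumes F: "F \<in> skew_finite" and N: "N \<ge> 1"
  shows "norm (\<Sum>n\<in>pair_products N. F n) \<le> sqrt 2 ^ N * skew_norm F"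
proof -
  let ?T = "{\<Sum>k<K. H2_norm (f k) * H2_norm (g k) | K f g. skew_rep F K f g}"
  have "norm (\<Sum>n\<in>pair_products N. F n) / sqrt 2 ^ N \<le> Inf ?T"
  proof (rule cInf_greatest)
    show "?T \<noteq> {}"
      using F unfolding skew_finite_def by blast
    fix s
    assume "s \<in> ?T"
    then obtain K f g where s: "s = (\<Sum>k<K. H2_norm (f k) * H2_norm (g k))" and rep: "skew_rep F K f g"
      by blast
    have ge2: "n \<ge> 2" if "n \<in> pair_products N" for n
    proof -
      obtain N' where "N = Suc N'"
        using N by (cases N) auto
      with that obtain i m where "n = nth_prime i * m" "m > 0"
        using pair_products_pos by auto
      then show ?thesis
        using prime_ge_2_nat[OF prime_nth_prime, of i] by (metis le_trans less_eq_nat.simps(2) mult_le_mono2 mult.right_neutral Suc_leI One_nat_def)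
    qed
    have "norm (\<Sum>n\<in>pair_products N. F n) = norm (\<Sum>k<K. \<Sum>n\<in>pair_products N. skew_primitive (f k) (g k) n)"
      by (subst sum.swap) (intro arg_cong[where f = norm] sum.cong refl skew_rep_coefficient[OF rep] ge2)
    also have "\<dots> \<le> (\<Sum>k<K. sqrt 2 ^ N * (H2_norm (f k) * H2_norm (g k)))"
    proof (rule sum_norm_le)
      fix k
      assume "k \<in> {..<K}"
      then have H2: "f k \<in> H2" "g k \<in> H2"
        using rep by (auto simp: skew_rep_def)
      have "norm (\<Sum>n\<in>pair_products N. skew_primitive (f k) (g k) n) \<le>
          (\<Sum>n\<in>pair_products N. \<Sum>d | d dvd n. norm (f k d) * norm (g k (n div d)))"
        by (intro sum_norm_le norm_skew_primitive_le pair_products_pos)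
      also have "\<dots> \<le> sqrt 2 ^ N * (sqrt (\<Sum>d\<in>pair_divisors N. (norm (f k d))\<^sup>2) *
          sqrt (\<Sum>d\<in>pair_divisors N. (norm (g k d))\<^sup>2))"
        by (rule pair_products_bilinear)
      also have "\<dots> \<le> sqrt 2 ^ N * (H2_norm (f k) * H2_norm (g k))"
        by (intro mult_left_mono mult_mono H2_norm_ge_finite finite_pair_divisors H2 H2_norm_nonneg)
           (auto simp: sum_nonneg)
      finally show "norm (\<Sum>n\<in>pair_products N. skew_primitive (f k) (g k) n) \<le> sqrt 2 ^ N * (H2_norm (f k) * H2_norm (g k))" .
    qed
    finally show "norm (\<Sum>n\<in>pair_products N. F n) / sqrt 2 ^ N \<le> s"
      by (simp add: s sum_distrib_left[symmetric] pos_divide_le_eq mult.commute)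
  qed
  also have "Inf ?T \<le> skew_norm F"
    by (simp add: skew_norm_def)
  finally show ?thesis
    by (simp add: pos_divide_le_eq mult.commute)
qed

text \<open>For fixed N the sum involves finitely many coefficients and passes to the
  coefficientwise limit; the Cauchy property makes the bound uniform along the sequence.\<close>

lemma pair_products_skew_product_space:
  assumes "F \<in> skew_product_space"
  obtains K where "\<And>N. N \<ge> 1 \<Longrightarrow> norm (\<Sum>n\<in>pair_products N. F n) \<le> K * sqrt 2 ^ N"
proof -
  obtain G where G: "\<And>m. G m \<in> skew_finite"
    "\<And>e. e > 0 \<Longrightarrow> \<exists>M. \<forall>i\<ge>M. \<forall>j\<ge>M. skew_norm (\<lambda>n. G i n - G j n) < e"
    "\<And>n. (\<lambda>m. G m n) \<longlonglongrightarrow> F n"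
    using assms unfolding skew_product_space_def by blast
  obtain M where M: "\<And>i. i \<ge> M \<Longrightarrow> skew_norm (\<lambda>n. G i n - G M n) < 1"
    using G(2)[of 1] by auto
  show thesis
  proof (rule that)
    fix N :: nat
    assume N: "N \<ge> 1"
    have bound: "norm (\<Sum>n\<in>pair_products N. G i n) \<le> (skew_norm (G M) + 1) * sqrt 2 ^ N" if "i \<ge> M" for i
    proof -
      have "(\<Sum>n\<in>pair_products N. G i n) = (\<Sum>n\<in>pair_products N. G i n - G M n) + (\<Sum>n\<in>pair_products N. G M n)"
        by (simp add: sum_subtractf)
      also have "norm \<dots> \<le> sqrt 2 ^ N * skew_norm (\<lambda>n. G i n - G M n) + sqrt 2 ^ N * skew_norm (G M)"
        by (intro norm_triangle_le add_mono pair_products_skew_finite skew_finite_diff G(1) N)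
      also have "\<dots> \<le> sqrt 2 ^ N * 1 + sqrt 2 ^ N * skew_norm (G M)"
        using M[OF that] by (intro add_right_mono mult_left_mono) auto
      finally show ?thesis
        by (simp add: algebra_simps)
    qed
    have "(\<lambda>i. norm (\<Sum>n\<in>pair_products N. G i n)) \<longlonglongrightarrow> norm (\<Sum>n\<in>pair_products N. F n)"
      by (intro tendsto_intros G(3))
    then show "norm (\<Sum>n\<in>pair_products N. F n) \<le> (skew_norm (G M) + 1) * sqrt 2 ^ N"
      by (rule tendsto_upperbound) (auto intro!: eventually_sequentiallyI[of M] bound)
  qed
qed

section \<open>The L1 norm of a product of pairs\<close>

definition pair_ratio :: "nat \<Rightarrow> (nat \<Rightarrow> complex) \<Rightarrow> complex" where
  "pair_ratio j z = character z (nth_prime (2 * j)) * cnj (character z (nth_prime (2 * j + 1)))"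

text \<open>
  With \<open>w = pair_ratio j z\<close> and \<open>r = Re w\<close> the factor equals \<open>1 + r/2 - r\<^sup>2/12\<close>, which bounds
  \<open>sqrt (1 + r) = \<bar>1 + w\<bar> / sqrt 2\<close> and has mean \<open>23/24 < 1\<close>.
\<close>

definition pair_majorant :: "nat \<Rightarrow> (nat \<Rightarrow> complex) \<Rightarrow> complex" where
  "pair_majorant N z = (\<Prod>j<N. 23/24 + (pair_ratio j z + cnj (pair_ratio j z)) / 4
    - ((pair_ratio j z)\<^sup>2 + cnj ((pair_ratio j z)\<^sup>2)) / 48)"

lemma norm_pair_ratio: "z \<in> space torus_measure \<Longrightarrow> norm (pair_ratio j z) = 1"
  by (simp add: pair_ratio_def norm_mult norm_character)

lemma measurable_pair_ratio [measurable]: "pair_ratio j \<in> borel_measurable torus_measure"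
  unfolding pair_ratio_def[abs_def] by measurable

text \<open>On the unit circle r^2 = (1 + Re (w^2)) / 2, which produces 23/24 and 1/48. The form in
  w suits integration, the form in r suits pointwise bounds.\<close>

lemma pair_majorant_eq:
  assumes z: "z \<in> space torus_measure"
  shows "pair_majorant N z = of_real (\<Prod>j<N. 1 + Re (pair_ratio j z) / 2 - (Re (pair_ratio j z))\<^sup>2 / 12)"
  unfolding pair_majorant_def of_real_prod
proof (intro prod.cong refl)
  fix j
  define w where "w = pair_ratio j z"
  have "norm w = 1"
    using z by (simp add: w_def norm_pair_ratio)
  then have "(Re w)\<^sup>2 + (Im w)\<^sup>2 = 1"
    by (simp add: cmod_def)
  then have Im: "(Im w)\<^sup>2 = 1 - (Re w)\<^sup>2"
    by simp
  then have "23/24 + (w + cnj w) / 4 - (w\<^sup>2 + cnj (w\<^sup>2)) / 48 = of_real (1 + Re w / 2 - (Re w)\<^sup>2 / 12)"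
    by (simp add: complex_eq_iff Re_power2 Im_power2 Im field_simps)
  then show "23/24 + (pair_ratio j z + cnj (pair_ratio j z)) / 4
      - ((pair_ratio j z)\<^sup>2 + cnj ((pair_ratio j z)\<^sup>2)) / 48 =
      of_real (1 + Re (pair_ratio j z) / 2 - (Re (pair_ratio j z))\<^sup>2 / 12)"
    by (simp only: w_def)
qed

text \<open>The tangent 1 + r/2 alone has mean 1 and would gain nothing. With - c r^2 added,
  squaring and subtracting 1 + r leaves (1/4 - 2 c) r^2 - c r^3 + c^2 r^4; c = 1/12 makes the first
  two coefficients opposite, so that they combine to c r^2 (1 - r).\<close>

lemma sqrt_one_plus_le:
  fixes r :: real
  assumes "\<bar>r\<bar> \<le> 1"
  shows "sqrt (1 + r) \<le> 1 + r / 2 - r\<^sup>2 / 12"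
proof (rule real_le_lsqrt)
  have "r\<^sup>2 \<le> 1"
    using assms by (simp add: abs_square_le_1)
  then show "0 \<le> 1 + r / 2 - r\<^sup>2 / 12"
    using assms by (simp add: abs_le_iff)
  have "0 \<le> r\<^sup>2 * (1 - r) / 12 + (r\<^sup>2)\<^sup>2 / 144"
    using assms by (intro add_nonneg_nonneg divide_nonneg_nonneg mult_nonneg_nonneg) auto
  also have "\<dots> = (1 + r / 2 - r\<^sup>2 / 12)\<^sup>2 - (1 + r)"
    by (simp add: power2_eq_square field_simps)
  finally show "1 + r \<le> (1 + r / 2 - r\<^sup>2 / 12)\<^sup>2"
    by simp
qed

text \<open>The sum factors into terms a + b, and for unimodular a, b the modulus depends only on
  the ratio: |a + b|^2 = 2 (1 + Re (a cnj b)).\<close>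

lemma norm_sum_pair_products_le:
  assumes z: "z \<in> space torus_measure"
  shows "norm (\<Sum>n\<in>pair_products N. character z n) \<le> sqrt 2 ^ N * Re (pair_majorant N z)"
proof -
  define r where "r j = Re (pair_ratio j z)" for j
  have "norm (\<Sum>n\<in>pair_products N. character z n) \<le> sqrt 2 ^ N * (\<Prod>j<N. 1 + r j / 2 - (r j)\<^sup>2 / 12)"
  proof (induction N)
    case 0
    show ?case
      using norm_character[OF z] by simp
  next
    case (Suc N)
    define a b where "a = character z (nth_prime (2 * N))" and "b = character z (nth_prime (2 * N + 1))"
    have ab: "norm a = 1" "norm b = 1" "r N = Re (a * cnj b)"
      using norm_character[OF z] by (simp_all add: a_def b_def r_def pair_ratio_def)
    have "(\<Sum>n\<in>pair_products (Suc N). character z n) = (a + b) * (\<Sum>n\<in>pair_products N. character z n)"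
    proof -
      have "(\<Sum>n\<in>pair_products N. character z (nth_prime i * n)) = character z (nth_prime i) * (\<Sum>n\<in>pair_products N. character z n)" for i
        by (simp add: sum_distrib_left character_mult pair_products_pos prime_gt_0_nat)
      then show ?thesis
        by (simp only: sum_pair_products_Suc a_def b_def distrib_right)
    qed
    then have "norm (\<Sum>n\<in>pair_products (Suc N). character z n) = norm (a + b) * norm (\<Sum>n\<in>pair_products N. character z n)"
      by (simp only: norm_mult)
    also have "norm (a + b) = sqrt 2 * sqrt (1 + r N)"
    proof -
      have "(norm (a + b))\<^sup>2 = 2 * (1 + r N)"
        using ab unfolding cmod_power2 by (simp add: cmod_def power2_eq_square algebra_simps)
      then show ?thesis
        by (metis norm_ge_zero real_sqrt_mult real_sqrt_unique)
    qed
    also have "sqrt 2 * sqrt (1 + r N) * norm (\<Sum>n\<in>pair_products N. character z n) \<le>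
        sqrt 2 * (1 + r N / 2 - (r N)\<^sup>2 / 12) * (sqrt 2 ^ N * (\<Prod>j<N. 1 + r j / 2 - (r j)\<^sup>2 / 12))"
    proof -
      have r1: "\<bar>r N\<bar> \<le> 1"
        using abs_Re_le_cmod[of "pair_ratio N z"] norm_pair_ratio[OF z] by (simp add: r_def)
      then have "0 \<le> sqrt (1 + r N)"
        by simp
      also have "\<dots> \<le> 1 + r N / 2 - (r N)\<^sup>2 / 12"
        by (rule sqrt_one_plus_le[OF r1])
      finally show ?thesis
        using sqrt_one_plus_le[OF r1] by (intro mult_mono mult_left_mono Suc.IH) auto
    qed
    finally show ?case
      by (simp add: mult_ac)
  qed
  then show ?thesis
    by (simp only: pair_majorant_eq[OF z] r_def Re_complex_of_real)
qed

lemma integrable_pair_majorant: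
  "integrable torus_measure (\<lambda>z. pair_majorant N z * (character z m * cnj (character z n)))"
proof (rule torus_measure.integrable_const_bound[of _ "2 ^ N"])
  show "(\<lambda>z. pair_majorant N z * (character z m * cnj (character z n))) \<in> borel_measurable torus_measure"
  proof -
    have [measurable]: "(\<lambda>z. cnj (pair_ratio j z)) \<in> borel_measurable torus_measure"
      "(\<lambda>z. cnj ((pair_ratio j z)\<^sup>2)) \<in> borel_measurable torus_measure" for j
      by (intro borel_measurable_continuous_on[OF continuous_on_cnj[OF continuous_on_id]]; measurable)+
    show ?thesis
      unfolding pair_majorant_def by measurable
  qed
  show "AE z in torus_measure. norm (pair_majorant N z * (character z m * cnj (character z n))) \<le> 2 ^ N"
  proof (intro AE_I2)
    fix z
    assume z: "z \<in> space torus_measure"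
    have "norm (pair_majorant N z) = (\<Prod>j<N. \<bar>1 + Re (pair_ratio j z) / 2 - (Re (pair_ratio j z))\<^sup>2 / 12\<bar>)"
      unfolding pair_majorant_eq[OF z] norm_of_real abs_prod ..
    also have "\<dots> \<le> (\<Prod>j<N. 2)"
    proof (intro prod_mono conjI abs_ge_zero)
      fix j
      have r: "\<bar>Re (pair_ratio j z)\<bar> \<le> 1"
        using abs_Re_le_cmod[of "pair_ratio j z"] norm_pair_ratio[OF z] by simp
      then have "(Re (pair_ratio j z))\<^sup>2 \<le> 1"
        by (simp add: abs_square_le_1)
      with r zero_le_power2[of "Re (pair_ratio j z)"]
      show "\<bar>1 + Re (pair_ratio j z) / 2 - (Re (pair_ratio j z))\<^sup>2 / 12\<bar> \<le> 2"
        unfolding abs_le_iff by linarith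
    qed
    finally show "norm (pair_majorant N z * (character z m * cnj (character z n))) \<le> 2 ^ N"
      using z by (simp add: norm_mult norm_character)
  qed
qed

text \<open>Independence of the pairs, done algebraically. Expanding the last factor multiplies m
  and n by the two new primes, hence the induction over all m and n free of the primes already used.
  In each shifted term one of the two new primes divides one integer and not the other, so only
  23/24 survives.\<close>

lemma integral_pair_majorant:
  assumes "m > 0" "n > 0" "\<And>i. i < 2 * N \<Longrightarrow> \<not> nth_prime i dvd m" "\<And>i. i < 2 * N \<Longrightarrow> \<not> nth_prime i dvd n"
  shows "(LINT z|torus_measure. pair_majorant N z * (character z m * cnj (character z n))) =
    (if m = n then (23/24) ^ N else 0)"
  using assms
proof (induction N arbitrary: m n)
  case 0
  then show ?case
    by (simp add: pair_majorant_def integral_character)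
next
  case (Suc N)
  define p q where "p = nth_prime (2 * N)" and "q = nth_prime (2 * N + 1)"
  have pq: "p > 0" "q > 0"
    by (simp_all add: p_def q_def prime_gt_0_nat)
  define I where "I m n = (LINT z|torus_measure. pair_majorant N z * (character z m * cnj (character z n)))" for m n
  let ?f = "\<lambda>m n z. pair_majorant N z * (character z m * cnj (character z n))"
  have "(LINT z|torus_measure. pair_majorant (Suc N) z * (character z m * cnj (character z n))) =
      (LINT z|torus_measure. 23/24 * ?f m n z + 1/4 * ?f (p * m) (q * n) z + 1/4 * ?f (q * m) (p * n) z
        - 1/48 * ?f (p * (p * m)) (q * (q * n)) z - 1/48 * ?f (q * (q * m)) (p * (p * n)) z)"
  proof (intro Bochner_Integration.integral_cong refl)
    fix z
    have expand: "R * (23/24 + (P * Q' + P' * Q) / 4 - ((P * Q')\<^sup>2 + (P' * Q)\<^sup>2) / 48) * (M * L) =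
        23/24 * (R * (M * L)) + 1/4 * (R * ((P * M) * (Q' * L))) + 1/4 * (R * ((Q * M) * (P' * L)))
        - 1/48 * (R * ((P * (P * M)) * (Q' * (Q' * L)))) - 1/48 * (R * ((Q * (Q * M)) * (P' * (P' * L))))"
      for R P P' Q Q' M L :: complex
      by (simp add: power2_eq_square algebra_simps add_divide_distrib)
    have "pair_majorant (Suc N) z * (character z m * cnj (character z n)) =
        pair_majorant N z * (23/24 + (character z p * cnj (character z q) + cnj (character z p) * character z q) / 4
          - ((character z p * cnj (character z q))\<^sup>2 + (cnj (character z p) * character z q)\<^sup>2) / 48)
          * (character z m * cnj (character z n))"
      by (simp add: pair_majorant_def pair_ratio_def p_def q_def)
    then show "pair_majorant (Suc N) z * (character z m * cnj (character z n)) =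
        23/24 * ?f m n z + 1/4 * ?f (p * m) (q * n) z + 1/4 * ?f (q * m) (p * n) z
        - 1/48 * ?f (p * (p * m)) (q * (q * n)) z - 1/48 * ?f (q * (q * m)) (p * (p * n)) z"
      using pq Suc.prems(1,2) by (simp only: expand character_mult complex_cnj_mult nat_0_less_mult_iff)
  qed
  also have "\<dots> = 23/24 * I m n + 1/4 * I (p * m) (q * n) + 1/4 * I (q * m) (p * n)
      - 1/48 * I (p * (p * m)) (q * (q * n)) - 1/48 * I (q * (q * m)) (p * (p * n))"
    unfolding I_def
    by (simp only: Bochner_Integration.integral_add Bochner_Integration.integral_diff integral_mult_right_zero
        Bochner_Integration.integrable_add Bochner_Integration.integrable_diff integrable_mult_right integrable_pair_majorant)
  also have "\<dots> = 23/24 * (if m = n then (23/24) ^ N else 0)"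
  proof -
    have m: "\<not> p dvd m" "\<not> q dvd m"
      using Suc.prems(3)[of "2 * N"] Suc.prems(3)[of "2 * N + 1"] by (simp_all add: p_def q_def)
    have ndvd: "\<not> nth_prime i dvd nth_prime j * k" if "i < 2 * N" "j \<ge> 2 * N" "\<not> nth_prime i dvd k" for i j k
      using that by (intro not_nth_prime_dvd_mult) auto
    have npq: "\<not> p dvd q" "\<not> q dvd p"
      by (simp_all add: p_def q_def prime_dvd_nth_prime)
    have prime: "prime p" "prime q"
      by (simp_all add: p_def q_def)
    have ne: "p * m \<noteq> q * n" "q * m \<noteq> p * n" "p * (p * m) \<noteq> q * (q * n)" "q * (q * m) \<noteq> p * (p * n)"
      using m npq prime by (metis dvd_triv_left prime_dvd_mult_iff)+
    show ?thesis
      unfolding I_def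
      by (subst (1 2 3 4 5) Suc.IH) (use Suc.prems pq ne ndvd in \<open>auto simp: p_def q_def\<close>)
  qed
  also have "\<dots> = (if m = n then (23/24) ^ Suc N else 0)"
    by simp
  finally show ?case .
qed

lemma integral_norm_pair_products:
  "(LINT z|torus_measure. norm (\<Sum>n\<in>pair_products N. character z n)) \<le> (sqrt 2 * (23/24)) ^ N"
proof -
  have one: "character z 1 = 1" if "z \<in> space torus_measure" for z
    using that character_in_characters characters_one by blast
  have int: "integrable torus_measure (\<lambda>z. pair_majorant N z * (character z 1 * cnj (character z 1)))"
    by (rule integrable_pair_majorant)
  have "(LINT z|torus_measure. norm (\<Sum>n\<in>pair_products N. character z n)) \<le>
      (LINT z|torus_measure. sqrt 2 ^ N * Re (pair_majorant N z * (character z 1 * cnj (character z 1))))"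
  proof (rule integral_mono)
    have "integrable torus_measure (\<lambda>z. \<Sum>n\<in>pair_products N. 1 * character z n)"
      by (intro integrable_analytic_polynomial analytic_polynomials_sum analytic_polynomials_character)
    then show "integrable torus_measure (\<lambda>z. norm (\<Sum>n\<in>pair_products N. character z n))"
      by simp
    show "integrable torus_measure (\<lambda>z. sqrt 2 ^ N * Re (pair_majorant N z * (character z 1 * cnj (character z 1))))"
      by (intro integrable_mult_right integrable_Re int)
  qed (use one norm_sum_pair_products_le in simp)
  also have "\<dots> = sqrt 2 ^ N * Re (LINT z|torus_measure. pair_majorant N z * (character z 1 * cnj (character z 1)))"
    using integral_Re[OF int] by simp
  also have "\<dots> = (sqrt 2 * (23/24)) ^ N"
  proof -
    have "\<not> nth_prime i dvd 1" for i
      using prime_nth_prime[of i] by (auto simp del: prime_nth_prime)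
    then have "(LINT z|torus_measure. pair_majorant N z * (character z 1 * cnj (character z 1))) = of_real ((23/24) ^ N)"
      by (subst integral_pair_majorant) auto
    then show ?thesis
      by (simp only: Re_complex_of_real power_mult_distrib)
  qed
  finally show ?thesis .
qed

text \<open>The number of prime factors recovers N, so the sets \<open>pair_products N\<close> are
  disjoint and at most one N contributes to each coefficient of the witness.\<close>

lemma size_prime_factorization_pair_products:
  "n \<in> pair_products N \<Longrightarrow> size (prime_factorization n) = N"
proof (induction N arbitrary: n)
  case (Suc N)
  then obtain i m where "n = nth_prime i * m" "m \<in> pair_products N"
    by auto
  then show ?case
    using Suc.IH[of m] pair_products_pos[of m N] prime_gt_0_nat[OF prime_nth_prime, of i]
    by (simp add: prime_factorization_mult prime_factorization_prime)
qed simp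

lemma card_pair_products: "card (pair_products N) = 2 ^ N"
proof (induction N)
  case (Suc N)
  have "card (pair_products (Suc N)) = (\<Sum>n\<in>pair_products (Suc N). 1)"
    by simp
  also have "\<dots> = 2 * card (pair_products N)"
    unfolding sum_pair_products_Suc by simp
  finally show ?case
    using Suc.IH by simp
qed simp

text \<open>The base 48/47 lies strictly between 1 and 24/23: the pairings outgrow sqrt 2 ^ N, while
  the L1 norms are at most (48/47 * 23/24)^N = (46/47)^N and are summable.\<close>

definition witness_coeff :: "nat \<Rightarrow> real" where
  "witness_coeff N = (48/47) ^ N / sqrt 2 ^ N"

definition witness :: dirichlet where
  "witness n = (let N = size (prime_factorization n) in if n \<in> pair_products N then of_real (witness_coeff N) else 0)"

lemma witness_pair_products: "n \<in> pair_products N \<Longrightarrow> witness n = of_real (witness_coeff N)"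
  by (simp add: witness_def size_prime_factorization_pair_products)

lemma witness_in_H1: "witness \<in> H1"
proof -
  let ?b = "\<lambda>N n. if n \<in> pair_products N then complex_of_real (witness_coeff N) else 0"
  have "lifts witness (\<Sum>N. (46/47) ^ N)"
  proof (rule lifts_series)
    show "summable (\<lambda>N. (46/47 :: real) ^ N)"
      by (intro summable_geometric) simp
    show "lifts (?b N) ((46/47) ^ N)" for N
    proof -
      have nonneg: "witness_coeff N \<ge> 0"
        by (simp add: witness_coeff_def)
      have "lifts (\<lambda>n. \<Sum>i\<in>pair_products N. if i = n then complex_of_real (witness_coeff N) else 0)
          (LINT z|torus_measure. norm (\<Sum>i\<in>pair_products N. of_real (witness_coeff N) * character z i))"
        by (rule lifts_poly[OF finite_pair_products]) (rule pair_products_pos)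
      then have "lifts (?b N) (LINT z|torus_measure. norm (\<Sum>i\<in>pair_products N. of_real (witness_coeff N) * character z i))"
        by (rule lifts_cong) (simp add: finite_pair_products)
      moreover have "(LINT z|torus_measure. norm (\<Sum>i\<in>pair_products N. of_real (witness_coeff N) * character z i)) \<le> (46/47) ^ N"
      proof -
        have "(LINT z|torus_measure. norm (\<Sum>i\<in>pair_products N. of_real (witness_coeff N) * character z i)) =
            witness_coeff N * (LINT z|torus_measure. norm (\<Sum>i\<in>pair_products N. character z i))"
          unfolding sum_distrib_left[symmetric] norm_mult norm_of_real using nonneg by simp
        also have "\<dots> \<le> witness_coeff N * (sqrt 2 * (23/24)) ^ N"
          by (intro mult_left_mono integral_norm_pair_products nonneg)
        also have "\<dots> = (48/47) ^ N * (23/24) ^ N"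
          unfolding witness_coeff_def power_mult_distrib[of "sqrt 2"] by simp
        also have "\<dots> = (46/47) ^ N"
          unfolding power_mult_distrib[symmetric] by simp
        finally show ?thesis .
      qed
      ultimately show ?thesis
        by (rule lifts_mono)
    qed
    fix n :: nat
    have "(\<lambda>N. if N = size (prime_factorization n) then ?b N n else 0) sums ?b (size (prime_factorization n)) n"
      by (rule sums_single)
    moreover have "(if N = size (prime_factorization n) then ?b N n else 0) = ?b N n" for N
      using size_prime_factorization_pair_products by auto
    ultimately show "(\<lambda>N. ?b N n) sums witness n"
      by (simp only: witness_def Let_def)
  qed
  moreover have "witness 0 = 0"
    using pair_products_pos[of 0] by (auto simp: witness_def Let_def)
  ultimately show ?thesis
    unfolding H1_def lifts_def by blast
qed

lemma witness_not_in_skew_product_space: "witness \<notin> skew_product_space"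
proof
  assume "witness \<in> skew_product_space"
  then obtain K where K: "\<And>N. N \<ge> 1 \<Longrightarrow> norm (\<Sum>n\<in>pair_products N. witness n) \<le> K * sqrt 2 ^ N"
    by (rule pair_products_skew_product_space) blast
  have bound: "(48/47) ^ N \<le> K" if "N \<ge> 1" for N
  proof -
    have "(\<Sum>n\<in>pair_products N. witness n) = of_real (2 ^ N * witness_coeff N)"
      by (simp add: witness_pair_products card_pair_products)
    also have "2 ^ N = sqrt 2 ^ N * sqrt 2 ^ N"
      by (simp add: power_mult_distrib[symmetric])
    also have "sqrt 2 ^ N * sqrt 2 ^ N * witness_coeff N = (48/47) ^ N * sqrt 2 ^ N"
      by (simp add: witness_coeff_def)
    finally have "(48/47) ^ N * sqrt 2 ^ N \<le> K * sqrt 2 ^ N"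
      using K[OF that] by (simp add: abs_mult norm_mult norm_power)
    then show ?thesis
      by simp
  qed
  obtain N where "K < (48/47) ^ N"
    using real_arch_pow[of "48/47" K] by auto
  \<comment> \<open>\<open>N\<close> may be 0, which \<open>bound\<close> excludes; its successor is
    safe.\<close>
  also have "\<dots> \<le> (48/47) ^ Suc N"
    by simp
  also have "\<dots> \<le> K"
    by (rule bound) simp
  finally show False
    by simp
qed

theorem theorem11: "skew_product_space \<subset> H1"
  using skew_product_space_subset_H1 witness_in_H1 witness_not_in_skew_product_space by blast

end
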